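(* Let $\mathscr F$ be an admissible space of analytic functions $U\to W$ and fix $z\in U$. If the inclusion map $\imath_{1,2}:\mathscr X^{(1)}\to \mathscr X^{(2)}$ is strictly cosingular, then so is $\imath_{k,n}:\mathscr X^{(k)}\to\mathscr X^{(n)}$ for all integers $1\le k<n$.
   Context: Let $\mathbb D=\{w\in\mathbb C:|w|<1\}$, let $U\subset\mathbb C$ be an open set conformally equivalent to $\mathbb D$, and let $W$ be a complex Banach space. A Banach space $\mathscr F$ of analytic functions $F:U\to W$ is called admissible if: (a) for each $z\in U$ the evaluation map $\delta_z:\mathscr F\to W$, $\delta_z(F)=F(z)$, is bounded; (b) if $\varphi:U\to\mathbb D$ is a conformal equivalence, then an analytic $F:U\to W$ belongs to $\mathscr F$ if and only if $\varphi\cdot F\in\mathscr F$, and in this case $\|\varphi\cdot F\|_{\mathscr F}=\|F\|_{\mathscr F}$. Fix $z\in U$ and write $\widehat f[i;z]=f^{(i)}(z)/i!$. For $n\ge1$, $$\mathscr X^{(n)}=\{(x_{n-1},\dots,x_0)\in W^n:\ \exists f\in\mathscr F,\ x_i=\widehat f[i;z]\text{ for all }0\le i<n\},$$ with norm the infimum of $\|f\|_{\mathscr F}$ over all such $f$; this is a Banach space. For $k<n$, $\imath_{k,n}:\mathscr X^{(k)}\to\mathscr X^{(n)}$ is the (bounded) inclusion on the left, $\imath_{k,n}(x_k,\dots,x_1)=(x_k,\dots,x_1,0,\dots,0)$. A bounded operator $u:A\to B$ between Banach spaces is strictly cosingular if for every closed subspace $C$ of $B$ of infinite codimension, with quotient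 map $\pi:B\to B/C$, the composition $\pi\circ u:A\to B/C$ is not onto. *)

theory Defs
  imports "HOL-Complex_Analysis.Complex_Analysis" "HOL-Library.Function_Algebras"
begin

section \<open>Complex Banach spaces\<close>

class scaleC =
  fixes scaleC :: "complex \<Rightarrow> 'a \<Rightarrow> 'a" (infixr "*\<^sub>C" 75)

class complex_vector = scaleC + ab_group_add +
  assumes scaleC_add_right: "a *\<^sub>C (x + y) = a *\<^sub>C x + a *\<^sub>C y"
    and scaleC_add_left: "(a + b) *\<^sub>C x = a *\<^sub>C x + b *\<^sub>C x"
    and scaleC_scaleC: "a *\<^sub>C (b *\<^sub>C x) = (a * b) *\<^sub>C x"
    and scaleC_one: "1 *\<^sub>C x = x"

class complex_banach = complex_vector + banach +
  assumes scaleR_scaleC: "r *\<^sub>R x = complex_of_real r *\<^sub>C x"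
    and norm_scaleC: "norm (a *\<^sub>C x) = cmod a * norm x"

interpretation complex_vector:
  vector_space "scaleC :: complex \<Rightarrow> 'a \<Rightarrow> 'a::complex_vector"
  by unfold_locales
    (simp_all add: scaleC_add_right scaleC_add_left scaleC_scaleC scaleC_one)

instantiation complex :: complex_banach
begin
definition scaleC_complex :: "complex \<Rightarrow> complex \<Rightarrow> complex" where
  "scaleC_complex a x = a * x"
instance
  by standard (simp_all add: scaleC_complex_def algebra_simps norm_mult scaleR_conv_of_real)
end

instantiation "fun" :: (type, complex_vector) complex_vector
begin
definition scaleC_fun :: "complex \<Rightarrow> ('a \<Rightarrow> 'b) \<Rightarrow> 'a \<Rightarrow> 'b" where
  "scaleC_fun a f = (\<lambda>x. a *\<^sub>C f x)"
instance
  by standard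
    (simp_all add: scaleC_fun_def fun_eq_iff scaleC_add_right scaleC_add_left
      scaleC_scaleC scaleC_one)
end

text \<open>
  Function spaces and spaces of tuples carry norms of their own, so they are given by a carrier
  \<^term>\<open>V\<close> in an ambient complex vector space together with a norm \<^term>\<open>N\<close>; the values of
  \<^term>\<open>N\<close> outside \<^term>\<open>V\<close> are irrelevant.
\<close>

definition normed_space_on :: "'v::complex_vector set \<Rightarrow> ('v \<Rightarrow> real) \<Rightarrow> bool" where
  "normed_space_on V N \<longleftrightarrow>
     complex_vector.subspace V \<and>
     (\<forall>x\<in>V. 0 \<le> N x \<and> (N x = 0 \<longleftrightarrow> x = 0)) \<and>
     (\<forall>x\<in>V. \<forall>y\<in>V. N (x + y) \<le> N x + N y) \<and>
     (\<forall>a. \<forall>x\<in>V. N (a *\<^sub>C x) = cmod a * N x)"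

definition banach_space_on :: "'v::complex_vector set \<Rightarrow> ('v \<Rightarrow> real) \<Rightarrow> bool" where
  "banach_space_on V N \<longleftrightarrow>
     normed_space_on V N \<and>
     (\<forall>X::nat \<Rightarrow> 'v.
        (\<forall>n. X n \<in> V) \<and> (\<forall>e>0. \<exists>M. \<forall>m\<ge>M. \<forall>n\<ge>M. N (X m - X n) < e) \<longrightarrow>
        (\<exists>l\<in>V. (\<lambda>n. N (X n - l)) \<longlonglongrightarrow> 0))"

definition bounded_operator_on ::
  "'a::complex_vector set \<Rightarrow> ('a \<Rightarrow> real) \<Rightarrow> 'b::complex_vector set \<Rightarrow> ('b \<Rightarrow> real)
     \<Rightarrow> ('a \<Rightarrow> 'b) \<Rightarrow> bool" where
  "bounded_operator_on A NA B NB u \<longleftrightarrow>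
     (\<forall>x\<in>A. u x \<in> B) \<and>
     (\<forall>x\<in>A. \<forall>y\<in>A. u (x + y) = u x + u y) \<and>
     (\<forall>a. \<forall>x\<in>A. u (a *\<^sub>C x) = a *\<^sub>C u x) \<and>
     (\<exists>K. \<forall>x\<in>A. NB (u x) \<le> K * NA x)"

definition closed_subspace_of ::
  "'v::complex_vector set \<Rightarrow> 'v set \<Rightarrow> ('v \<Rightarrow> real) \<Rightarrow> bool" where
  "closed_subspace_of C B N \<longleftrightarrow>
     complex_vector.subspace C \<and> C \<subseteq> B \<and>
     (\<forall>X l. (\<forall>n::nat. X n \<in> C) \<and> l \<in> B \<and> (\<lambda>n. N (X n - l)) \<longlonglongrightarrow> 0 \<longrightarrow> l \<in> C)"

text \<open>\<^term>\<open>B\<close> modulo \<^term>\<open>C\<close> is not spanned by the classes of finitely many vectors.\<close>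

definition infinite_codimension :: "'v::complex_vector set \<Rightarrow> 'v set \<Rightarrow> bool" where
  "infinite_codimension C B \<longleftrightarrow>
     \<not> (\<exists>S. finite S \<and> S \<subseteq> B \<and> B \<subseteq> complex_vector.span (S \<union> C))"

definition cong_mod :: "'v::complex_vector set \<Rightarrow> 'v set \<Rightarrow> ('v \<times> 'v) set" where
  "cong_mod B C = {(x, y). x \<in> B \<and> y \<in> B \<and> x - y \<in> C}"

definition quotient_space :: "'v::complex_vector set \<Rightarrow> 'v set \<Rightarrow> 'v set set" where
  "quotient_space B C = B // cong_mod B C"

definition quotient_map :: "'v::complex_vector set \<Rightarrow> 'v set \<Rightarrow> 'v \<Rightarrow> 'v set" where
  "quotient_map B C x = cong_mod B C `` {x}"

definition strictly_cosingular ::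
  "'a::complex_vector set \<Rightarrow> ('a \<Rightarrow> real) \<Rightarrow> 'b::complex_vector set \<Rightarrow> ('b \<Rightarrow> real)
     \<Rightarrow> ('a \<Rightarrow> 'b) \<Rightarrow> bool" where
  "strictly_cosingular A NA B NB u \<longleftrightarrow>
     bounded_operator_on A NA B NB u \<and>
     (\<forall>C. closed_subspace_of C B NB \<and> infinite_codimension C B \<longrightarrow>
        (quotient_map B C \<circ> u) ` A \<noteq> quotient_space B C)"

section \<open>Admissible spaces of vector-valued analytic functions\<close>

definition conformal_equivalence ::
  "(complex \<Rightarrow> complex) \<Rightarrow> complex set \<Rightarrow> complex set \<Rightarrow> bool" where
  "conformal_equivalence \<phi> U V \<longleftrightarrow>
     \<phi> holomorphic_on U \<and>
     (\<exists>\<psi>. \<psi> holomorphic_on V \<and>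
          (\<forall>z\<in>U. \<phi> z \<in> V \<and> \<psi> (\<phi> z) = z) \<and>
          (\<forall>w\<in>V. \<psi> w \<in> U \<and> \<phi> (\<psi> w) = w))"

text \<open>
  Analyticity of a vector-valued function is local representability by a power series.
  A function on \<^term>\<open>U\<close> is encoded by its extension by zero to the whole plane, so that equality
  of functions is equality on \<^term>\<open>U\<close>, and the pointwise operations on the function type are
  those of functions on \<^term>\<open>U\<close>.
\<close>

definition analytic_functions :: "complex set \<Rightarrow> (complex \<Rightarrow> 'w::complex_banach) set" where
  "analytic_functions U =
     {f. (\<forall>w. w \<notin> U \<longrightarrow> f w = 0) \<and>
         (\<forall>w\<in>U. \<exists>r>0. \<exists>a::nat \<Rightarrow> 'w. \<forall>u\<in>ball w r. (\<lambda>n. (u - w) ^ n *\<^sub>C a n) sums f u)}"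

definition admissible ::
  "complex set \<Rightarrow> (complex \<Rightarrow> 'w::complex_banach) set \<Rightarrow> ((complex \<Rightarrow> 'w) \<Rightarrow> real) \<Rightarrow> bool"
where
  "admissible U \<F> N \<longleftrightarrow>
     banach_space_on \<F> N \<and> \<F> \<subseteq> analytic_functions U \<and>
     (\<forall>z\<in>U. \<exists>K. \<forall>f\<in>\<F>. norm (f z) \<le> K * N f) \<and>
     (\<forall>\<phi>. conformal_equivalence \<phi> U (ball 0 1) \<longrightarrow>
        (\<forall>f\<in>analytic_functions U.
           (f \<in> \<F> \<longleftrightarrow> (\<lambda>w. \<phi> w *\<^sub>C f w) \<in> \<F>) \<and>
           (f \<in> \<F> \<longrightarrow> N (\<lambda>w. \<phi> w *\<^sub>C f w) = N f)))"

section \<open>Spaces of Taylor coefficients\<close>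

definition cderiv :: "(complex \<Rightarrow> 'w::complex_banach) \<Rightarrow> complex \<Rightarrow> 'w" where
  "cderiv f z = (SOME d. (f has_derivative (\<lambda>h. h *\<^sub>C d)) (at z))"

definition taylor_coeff :: "(complex \<Rightarrow> 'w::complex_banach) \<Rightarrow> nat \<Rightarrow> complex \<Rightarrow> 'w" where
  "taylor_coeff f i z = (1 / fact i) *\<^sub>C (cderiv ^^ i) f z"

text \<open>
  A tuple \<open>(x\<^sub>n\<^sub>-\<^sub>1, \<dots>, x\<^sub>0)\<close> is encoded by the sequence with entries \<open>x\<^sub>i\<close> for \<open>i < n\<close>
  and \<open>0\<close> for \<open>i \<ge> n\<close>.
\<close>

definition coeff_space ::
  "(complex \<Rightarrow> 'w::complex_banach) set \<Rightarrow> complex \<Rightarrow> nat \<Rightarrow> (nat \<Rightarrow> 'w) set" where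
  "coeff_space \<F> z n =
     {x. (\<forall>i\<ge>n. x i = 0) \<and> (\<exists>f\<in>\<F>. \<forall>i<n. x i = taylor_coeff f i z)}"

definition coeff_norm ::
  "(complex \<Rightarrow> 'w::complex_banach) set \<Rightarrow> ((complex \<Rightarrow> 'w) \<Rightarrow> real) \<Rightarrow> complex \<Rightarrow> nat
     \<Rightarrow> (nat \<Rightarrow> 'w) \<Rightarrow> real" where
  "coeff_norm \<F> N z n x = Inf {N f | f. f \<in> \<F> \<and> (\<forall>i<n. x i = taylor_coeff f i z)}"

text \<open>
  Tuples are written with the highest index first, so appending \<open>n - k\<close> zeros on the right of a
  \<open>k\<close>-tuple shifts its entries to the indices \<open>n - k, \<dots>, n - 1\<close>.
\<close>

definition left_inclusion :: "nat \<Rightarrow> nat \<Rightarrow> (nat \<Rightarrow> 'w::complex_banach) \<Rightarrow> nat \<Rightarrow> 'w" where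
  "left_inclusion k n x = (\<lambda>i. if i < n - k then 0 else x (i - (n - k)))"

end

theory Submission imports Defs
begin

text \<open>
  After composition with a disc automorphism, the conformal equivalence \<open>\<phi>\<close> may be assumed to vanish
  at \<open>z\<close>. Multiplication by \<open>\<phi>\<close> is then an isometry \<open>M\<close> of \<open>\<F>\<close>, and admissibility
  makes the range of \<open>M ^^ n\<close> the space of all functions in \<open>\<F>\<close> with \<open>n\<close> vanishing
  Taylor coefficients. So the coefficient space of order \<open>n\<close> is the quotient of \<open>\<F>\<close> by the range
  of \<open>M ^^ n\<close>, and the range of every left inclusion into it consists of classes of elements of the
  range of \<open>M\<close>. It suffices to show, for each \<open>n\<close>, that a closed subspace \<open>C\<close> of \<open>\<F>\<close>
  that contains the range of \<open>M ^^ n\<close> and satisfies \<open>C + M \<F> = \<F>\<close> has finite codimension.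
  The hypothesis on the inclusion of order one into order two is the case \<open>n = 2\<close>
  (\<open>cosingular_mod_power_2\<close>), and the remaining cases follow by induction
  (\<open>cosingular_mod_power_induct\<close>).

  For the induction step, let \<open>C\<close> contain the range of \<open>M ^^ (n + 1)\<close>, let
  \<open>C + M \<F> = \<F>\<close>, and suppose that the codimension of \<open>C\<close> is infinite. Put
  \<open>R = (M ^^ n) \<F>\<close>. Pulling back along \<open>M ^^ (n - 1)\<close>, the case \<open>2\<close> shows that
  \<open>C' + R \<noteq> \<F>\<close> for every closed \<open>C'\<close> of infinite codimension above \<open>C\<close>
  (\<open>power_image_not_complementary\<close>). Were \<open>R\<close> contained in \<open>C\<close>, the case \<open>n\<close> would
  give a contradiction; in general \<open>C\<close> has to be perturbed to achieve this. The failure of all the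
  sums \<open>C' + R\<close> to fill the space yields, by the Hahn-Banach theorem, a sequence of functionals
  vanishing on \<open>C\<close>, biorthogonal to a sequence of vectors, whose restrictions to \<open>R\<close> have
  extensions that are as small as desired (\<open>biorthogonal_functionals\<close>). Subtracting these extensions
  gives functionals that vanish on \<open>R\<close>, and their common kernel is still a closed subspace of infinite
  codimension which together with \<open>M \<F>\<close> spans the space (\<open>perturbed_closed_subspace\<close>); the last
  property survives because, by Baire's theorem, decompositions along \<open>C\<close> and \<open>M \<F>\<close> can be
  chosen with norm control. This kernel contradicts the case \<open>n\<close>.
\<close>

section \<open>The Hahn-Banach theorem on a subspace\<close>

definition sublinear_on :: "'a::complex_vector set \<Rightarrow> ('a \<Rightarrow> real) \<Rightarrow> bool" where
  "sublinear_on W q \<longleftrightarrow>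
     (\<forall>x\<in>W. \<forall>y\<in>W. q (x + y) \<le> q x + q y) \<and>
     (\<forall>t\<ge>0. \<forall>x\<in>W. q (complex_of_real t *\<^sub>C x) \<le> t * q x)"

lemma sublinear_onD:
  assumes "sublinear_on W q"
  shows "x \<in> W \<Longrightarrow> y \<in> W \<Longrightarrow> q (x + y) \<le> q x + q y"
    and "t \<ge> 0 \<Longrightarrow> x \<in> W \<Longrightarrow> q (complex_of_real t *\<^sub>C x) \<le> t * q x"
  using assms by (auto simp: sublinear_on_def)

lemma sublinear_on_zero:
  assumes "complex_vector.subspace W" "sublinear_on W q"
  shows "q 0 = 0"
proof -
  have 0: "(0::'a) \<in> W"
    using assms(1) by (rule complex_vector.subspace_0)
  have "q 0 \<le> 0"
    using sublinear_onD(2)[OF assms(2), of 0 0] 0 by simp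
  moreover have "q 0 \<le> q 0 + q 0"
    using sublinear_onD(1)[OF assms(2) 0 0] by simp
  ultimately show ?thesis by simp
qed

lemma sublinear_on_minus:
  assumes "complex_vector.subspace W" "sublinear_on W q" "x \<in> W"
  shows "- q (- x) \<le> q x"
proof -
  have "q (x + (- x)) \<le> q x + q (- x)"
    using assms by (intro sublinear_onD) (auto intro: complex_vector.subspace_neg)
  then show ?thesis
    using sublinear_on_zero[OF assms(1,2)] by simp
qed

lemma sublinear_on_scale:
  assumes "complex_vector.subspace W" "sublinear_on W q" "x \<in> W" "t \<ge> 0"
  shows "q (complex_of_real t *\<^sub>C x) = t * q x"
proof (cases "t = 0")
  case True
  then show ?thesis using sublinear_on_zero[OF assms(1,2)] by simp
next
  case False
  have "q (complex_of_real (1 / t) *\<^sub>C (complex_of_real t *\<^sub>C x))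
      \<le> 1 / t * q (complex_of_real t *\<^sub>C x)"
    using assms by (intro sublinear_onD) (auto intro: complex_vector.subspace_scale)
  then have "q x \<le> 1 / t * q (complex_of_real t *\<^sub>C x)"
    using False by (simp add: scaleC_scaleC scaleC_one)
  then have "t * q x \<le> q (complex_of_real t *\<^sub>C x)"
    using False assms(4) by (simp add: field_simps)
  then show ?thesis
    using sublinear_onD(2)[OF assms(2,4,3)] by simp
qed

text \<open>
  The new functional is \<open>x \<mapsto> inf {q (x + t y) - t q y | t \<ge> 0}\<close>. Its bound at
  \<open>- y\<close> forces every additive functional below it to take the value \<^term>\<open>q y\<close> at
  \<^term>\<open>y\<close>.
\<close>

lemma sublinear_on_lower_in_direction:
  assumes W: "complex_vector.subspace W" and q: "sublinear_on W q" and y: "y \<in> W"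
  obtains q' where "sublinear_on W q'" "\<And>x. x \<in> W \<Longrightarrow> q' x \<le> q x" "q' (- y) \<le> - q y"
proof
  define h where "h x t = q (x + complex_of_real t *\<^sub>C y) - t * q y" for x t
  define q' where "q' x = (INF t\<in>{0..}. h x t)" for x
  note WI = complex_vector.subspace_add[OF W] complex_vector.subspace_scale[OF W]
    complex_vector.subspace_neg[OF W]
  have bdd: "bdd_below (h x ` {0..})" if x: "x \<in> W" for x
  proof (rule bdd_belowI2[of _ "- q (- x)"])
    fix t :: real assume t: "t \<in> {0..}"
    have "q (complex_of_real t *\<^sub>C y) = q (- x + (x + complex_of_real t *\<^sub>C y))"
      by simp
    also have "\<dots> \<le> q (- x) + q (x + complex_of_real t *\<^sub>C y)"
      using x y by (intro sublinear_onD[OF q] WI)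
    finally show "- q (- x) \<le> h x t"
      using sublinear_on_scale[OF W q y, of t] t by (simp add: h_def)
  qed
  have le: "q' x \<le> h x t" if "x \<in> W" "t \<ge> 0" for x t
    unfolding q'_def using that by (intro cINF_lower bdd) auto
  have ge: "m \<le> q' x" if "\<And>t. t \<ge> 0 \<Longrightarrow> m \<le> h x t" for m x
    unfolding q'_def using that by (intro cINF_greatest) auto
  show "sublinear_on W q'"
    unfolding sublinear_on_def
  proof (intro conjI ballI allI impI)
    fix a b assume a: "a \<in> W" and b: "b \<in> W"
    have *: "q' (a + b) \<le> h a s + h b t" if "s \<ge> 0" "t \<ge> 0" for s t
    proof -
      have "q (a + b + complex_of_real (s + t) *\<^sub>C y)
          = q ((a + complex_of_real s *\<^sub>C y) + (b + complex_of_real t *\<^sub>C y))"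
        by (simp add: scaleC_add_left algebra_simps)
      also have "\<dots> \<le> q (a + complex_of_real s *\<^sub>C y) + q (b + complex_of_real t *\<^sub>C y)"
        using a b y by (intro sublinear_onD[OF q] WI)
      finally have "h (a + b) (s + t) \<le> h a s + h b t"
        by (simp add: h_def algebra_simps)
      then show ?thesis
        using le[of "a + b" "s + t"] that a b WI by force
    qed
    have "q' (a + b) - h a s \<le> q' b" if "s \<ge> 0" for s
      using *[OF that] by (intro ge) (simp add: algebra_simps)
    then have "q' (a + b) - q' b \<le> q' a"
      by (intro ge) (simp add: algebra_simps)
    then show "q' (a + b) \<le> q' a + q' b"
      by simp
  next
    fix s :: real and a assume s: "0 \<le> s" and a: "a \<in> W"
    have *: "q' (complex_of_real s *\<^sub>C a) \<le> s * h a t" if "t \<ge> 0" for t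
    proof -
      have "q (complex_of_real s *\<^sub>C a + complex_of_real (s * t) *\<^sub>C y)
          = q (complex_of_real s *\<^sub>C (a + complex_of_real t *\<^sub>C y))"
        by (simp add: scaleC_add_right scaleC_scaleC)
      also have "\<dots> \<le> s * q (a + complex_of_real t *\<^sub>C y)"
        using a s y by (intro sublinear_onD[OF q] WI)
      finally have "h (complex_of_real s *\<^sub>C a) (s * t) \<le> s * h a t"
        by (simp add: h_def algebra_simps)
      then show ?thesis
        using le[of "complex_of_real s *\<^sub>C a" "s * t"] that a s WI by force
    qed
    show "q' (complex_of_real s *\<^sub>C a) \<le> s * q' a"
    proof (cases "s = 0")
      case True
      then show ?thesis using *[of 0] by simp
    next
      case False
      have "q' (complex_of_real s *\<^sub>C a) / s \<le> q' a"
        using * False s by (intro ge) (simp add: field_simps)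
      then show ?thesis using False s by (simp add: field_simps)
    qed
  qed
  show "q' x \<le> q x" if "x \<in> W" for x
    using le[OF that, of 0] by (simp add: h_def)
  show "q' (- y) \<le> - q y"
    using le[of "- y" 1] y WI sublinear_on_zero[OF W q] by (simp add: h_def scaleC_one)
qed

text \<open>
  Order the sublinear functionals below \<^term>\<open>p\<close> pointwise. A minimal one is additive, because
  lowering it in any direction cannot change it; Zorn's lemma provides one.
\<close>

lemma sublinear_on_dominates_additive:
  assumes W: "complex_vector.subspace W" and p: "sublinear_on W p"
  obtains u where "sublinear_on W u" "\<And>x. x \<in> W \<Longrightarrow> u x \<le> p x"
    "\<And>x y. x \<in> W \<Longrightarrow> y \<in> W \<Longrightarrow> u (x + y) = u x + u y"
proof -
  note WI = complex_vector.subspace_add[OF W] complex_vector.subspace_scale[OF W]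
    complex_vector.subspace_neg[OF W]
  define A where "A = {q. sublinear_on W q \<and> (\<forall>x\<in>W. q x \<le> p x) \<and> (\<forall>x. x \<notin> W \<longrightarrow> q x = 0)}"
  define below where "below q r \<longleftrightarrow> (\<forall>x\<in>W. r x \<le> q x)" for q r :: "'a \<Rightarrow> real"
  define cut where "cut q = (\<lambda>x. if x \<in> W then q x else 0)" for q :: "'a \<Rightarrow> real"
  have cut: "cut q \<in> A" if "sublinear_on W q" "\<And>x. x \<in> W \<Longrightarrow> q x \<le> p x" for q
    using that WI by (simp add: A_def cut_def sublinear_on_def)
  have "\<exists>m\<in>A. \<forall>a\<in>A. below m a \<longrightarrow> a = m"
  proof (rule predicate_Zorn)
    show "partial_order_on A (relation_of below A)"
    proof (rule partial_order_on_relation_ofI)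
      fix a b assume "a \<in> A" "b \<in> A" "below a b" "below b a"
      then show "a = b"
        by (auto simp: A_def below_def fun_eq_iff intro: antisym) (metis antisym)
    qed (auto simp: below_def intro: order_trans)
  next
    fix C assume C: "C \<in> Chains (relation_of below A)"
    have CA: "C \<subseteq> A"
      using C by (rule Chains_relation_of)
    show "\<exists>u\<in>A. \<forall>a\<in>C. below a u"
    proof (cases "C = {}")
      case True
      then show ?thesis using cut[OF p] by auto
    next
      case False
      define u where "u x = (INF q\<in>C. q x)" for x
      have bdd: "bdd_below ((\<lambda>q. q x) ` C)" if x: "x \<in> W" for x
      proof (rule bdd_belowI2[of _ "- p (- x)"])
        fix q assume "q \<in> C"
        then have "sublinear_on W q" "q (- x) \<le> p (- x)"
          using CA x WI by (auto simp: A_def)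
        then show "- p (- x) \<le> q x"
          using sublinear_on_minus[OF W _ x, of q] by simp
      qed
      have le: "u x \<le> q x" if "x \<in> W" "q \<in> C" for x q
        unfolding u_def using that by (intro cINF_lower bdd)
      have ge: "m \<le> u x" if "\<And>q. q \<in> C \<Longrightarrow> m \<le> q x" for m x
        unfolding u_def using that False by (intro cINF_greatest)
      have "sublinear_on W u"
        unfolding sublinear_on_def
      proof (intro conjI ballI allI impI)
        fix a b assume a: "a \<in> W" and b: "b \<in> W"
        have *: "u (a + b) \<le> q a + r b" if q: "q \<in> C" and r: "r \<in> C" for q r
        proof -
          have "(q, r) \<in> relation_of below A \<or> (r, q) \<in> relation_of below A"
            using C q r by (auto simp: Chains_def)
          then obtain m where m: "m \<in> C" "m a \<le> q a" "m b \<le> r b"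
            using q r a b unfolding relation_of_def below_def by auto
          have "u (a + b) \<le> m (a + b)"
            using m a b by (intro le WI)
          also have "\<dots> \<le> m a + m b"
            using m CA a b by (intro sublinear_onD) (auto simp: A_def)
          finally show ?thesis using m by simp
        qed
        have "u (a + b) - q a \<le> u b" if "q \<in> C" for q
          using *[OF that] by (intro ge) (simp add: algebra_simps)
        then have "u (a + b) - u b \<le> u a"
          by (intro ge) (simp add: algebra_simps)
        then show "u (a + b) \<le> u a + u b"
          by simp
      next
        fix s :: real and a assume s: "0 \<le> s" and a: "a \<in> W"
        have *: "u (complex_of_real s *\<^sub>C a) \<le> s * q a" if q: "q \<in> C" for q
        proof -
          have "u (complex_of_real s *\<^sub>C a) \<le> q (complex_of_real s *\<^sub>C a)"
            using q a by (intro le WI)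
          also have "\<dots> \<le> s * q a"
            using q CA s a by (intro sublinear_onD) (auto simp: A_def)
          finally show ?thesis .
        qed
        show "u (complex_of_real s *\<^sub>C a) \<le> s * u a"
        proof (cases "s = 0")
          case True
          then show ?thesis using * False by auto
        next
          case s0: False
          have "u (complex_of_real s *\<^sub>C a) / s \<le> u a"
            using * s0 s by (intro ge) (simp add: field_simps)
          then show ?thesis using s0 s by (simp add: field_simps)
        qed
      qed
      moreover have "u x \<le> p x" if "x \<in> W" for x
      proof -
        obtain q where "q \<in> C" using False by auto
        then show ?thesis using le[OF that] CA that by (force simp: A_def)
      qed
      ultimately have "cut u \<in> A"
        by (rule cut)
      moreover have "below q (cut u)" if "q \<in> C" for q
        using le that by (simp add: below_def cut_def)
      ultimately show ?thesis by blast
    qed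
  qed
  then obtain m where m: "m \<in> A" and min: "\<And>a. a \<in> A \<Longrightarrow> below m a \<Longrightarrow> a = m"
    by blast
  have ms: "sublinear_on W m" and mp: "\<And>x. x \<in> W \<Longrightarrow> m x \<le> p x"
    using m by (auto simp: A_def)
  have odd: "m (- y) \<le> - m y" if y: "y \<in> W" for y
  proof -
    obtain q' where q': "sublinear_on W q'" "\<And>x. x \<in> W \<Longrightarrow> q' x \<le> m x" "q' (- y) \<le> - m y"
      using sublinear_on_lower_in_direction[OF W ms y] by blast
    have "cut q' \<in> A"
      using q' mp by (intro cut) (auto intro: order_trans)
    then have "cut q' = m"
      using q'(2) by (intro min) (auto simp: below_def cut_def)
    then have "m (- y) = q' (- y)"
      using y WI by (auto simp: cut_def)
    then show ?thesis using q'(3) by simp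
  qed
  have "m (x + y) = m x + m y" if x: "x \<in> W" and y: "y \<in> W" for x y
  proof -
    have "m x = m ((x + y) + (- y))"
      by simp
    also have "\<dots> \<le> m (x + y) + m (- y)"
      using x y by (intro sublinear_onD[OF ms] WI)
    finally have "m x + m y \<le> m (x + y)"
      using odd[OF y] by simp
    then show ?thesis
      using sublinear_onD(1)[OF ms x y] by simp
  qed
  with ms mp show ?thesis
    by (intro that)
qed

definition linear_functional_on :: "'a::complex_vector set \<Rightarrow> ('a \<Rightarrow> complex) \<Rightarrow> bool" where
  "linear_functional_on W f \<longleftrightarrow>
     (\<forall>x\<in>W. \<forall>y\<in>W. f (x + y) = f x + f y) \<and> (\<forall>a. \<forall>x\<in>W. f (a *\<^sub>C x) = a * f x)"

text \<open>
  The Hahn-Banach theorem in its separation form. An additive functional below the quotient seminorm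
  of \<^term>\<open>Q\<close> modulo \<^term>\<open>D\<close>, lowered first in the direction of
  \<^term>\<open>x0\<close> so that its value there is the distance of \<^term>\<open>x0\<close> to
  \<^term>\<open>D\<close>, is the real part of the functional that is needed.
\<close>

theorem hahn_banach_separation:
  assumes W: "complex_vector.subspace W"
    and D: "complex_vector.subspace D" "D \<subseteq> W"
    and Q0: "\<And>x. x \<in> W \<Longrightarrow> 0 \<le> Q x"
    and Qadd: "\<And>x y. x \<in> W \<Longrightarrow> y \<in> W \<Longrightarrow> Q (x + y) \<le> Q x + Q y"
    and Qscale: "\<And>a x. x \<in> W \<Longrightarrow> Q (a *\<^sub>C x) = cmod a * Q x"
    and x0: "x0 \<in> W" and far: "\<And>d. d \<in> D \<Longrightarrow> e \<le> Q (x0 - d)"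
  obtains f where "linear_functional_on W f" "\<And>x. x \<in> W \<Longrightarrow> cmod (f x) \<le> Q x"
    "\<And>d. d \<in> D \<Longrightarrow> f d = 0" "e \<le> cmod (f x0)"
proof -
  note WI = complex_vector.subspace_add[OF W] complex_vector.subspace_scale[OF W]
    complex_vector.subspace_neg[OF W] complex_vector.subspace_diff[OF W]
  note DI = complex_vector.subspace_add[OF D(1)] complex_vector.subspace_scale[OF D(1)]
    complex_vector.subspace_0[OF D(1)]
  define p where "p x = (INF d\<in>D. Q (x - d))" for x
  have le: "p x \<le> Q (x - d)" if "x \<in> W" "d \<in> D" for x d
    unfolding p_def using that D(2)
    by (intro cINF_lower bdd_belowI2[of _ 0] Q0 WI) auto
  have ge: "m \<le> p x" if "\<And>d. d \<in> D \<Longrightarrow> m \<le> Q (x - d)" for m x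
    unfolding p_def using that DI(3) by (intro cINF_greatest) auto
  have pscale_le: "p (a *\<^sub>C x) \<le> cmod a * p x" if x: "x \<in> W" for a x
  proof (cases "a = 0")
    case True
    then show ?thesis
      using le[of 0 0] complex_vector.subspace_0[OF W] DI(3) Qscale[of 0 0] by simp
  next
    case False
    have "p (a *\<^sub>C x) / cmod a \<le> p x"
    proof (rule ge)
      fix d assume d: "d \<in> D"
      have "p (a *\<^sub>C x) \<le> Q (a *\<^sub>C x - a *\<^sub>C d)"
        using x d by (intro le WI DI)
      also have "\<dots> = cmod a * Q (x - d)"
        using Qscale[of "x - d" a] x d D(2) WI
        by (auto simp: complex_vector.scale_right_diff_distrib)
      finally show "p (a *\<^sub>C x) / cmod a \<le> Q (x - d)"
        using False by (simp add: field_simps)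
    qed
    then show ?thesis using False by (simp add: field_simps)
  qed
  have p: "sublinear_on W p"
    unfolding sublinear_on_def
  proof (intro conjI ballI allI impI)
    fix a b assume a: "a \<in> W" and b: "b \<in> W"
    have *: "p (a + b) \<le> Q (a - c) + Q (b - d)" if c: "c \<in> D" and d: "d \<in> D" for c d
    proof -
      have "p (a + b) \<le> Q ((a + b) - (c + d))"
        using a b c d by (intro le WI DI)
      also have "\<dots> = Q ((a - c) + (b - d))"
        by (simp add: algebra_simps)
      also have "\<dots> \<le> Q (a - c) + Q (b - d)"
        using a b c d D(2) by (intro Qadd WI) auto
      finally show ?thesis .
    qed
    have "p (a + b) - Q (a - c) \<le> p b" if "c \<in> D" for c
      using *[OF that] by (intro ge) (simp add: algebra_simps)
    then have "p (a + b) - p b \<le> p a"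
      by (intro ge) (simp add: algebra_simps)
    then show "p (a + b) \<le> p a + p b"
      by simp
  next
    fix t :: real and x assume "0 \<le> t" "x \<in> W"
    then show "p (complex_of_real t *\<^sub>C x) \<le> t * p x"
      using pscale_le[of x "complex_of_real t"] by simp
  qed
  obtain p' where p': "sublinear_on W p'" "\<And>x. x \<in> W \<Longrightarrow> p' x \<le> p x" "p' (- x0) \<le> - p x0"
    using sublinear_on_lower_in_direction[OF W p x0] by blast
  obtain u where u: "sublinear_on W u" and up': "\<And>x. x \<in> W \<Longrightarrow> u x \<le> p' x"
    and uadd: "\<And>x y. x \<in> W \<Longrightarrow> y \<in> W \<Longrightarrow> u (x + y) = u x + u y"
    using sublinear_on_dominates_additive[OF W p'(1)] by blast
  have up: "u x \<le> p x" if "x \<in> W" for x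
    using up'[OF that] p'(2)[OF that] by simp
  have uminus: "u (- x) = - u x" if x: "x \<in> W" for x
    using uadd[OF x WI(3)[OF x]] sublinear_on_zero[OF W u] by simp
  have uscale: "u (complex_of_real t *\<^sub>C x) = t * u x" if x: "x \<in> W" for t x
  proof (cases "t \<ge> 0")
    case True
    then show ?thesis using sublinear_on_scale[OF W u x] by simp
  next
    case False
    have "u (complex_of_real t *\<^sub>C x) = u (- (complex_of_real (- t) *\<^sub>C x))"
      by simp
    also have "\<dots> = - ((- t) * u x)"
      using False sublinear_on_scale[OF W u x, of "- t"] x
      by (subst uminus) (auto intro: WI)
    finally show ?thesis by simp
  qed
  define f where "f x = Complex (u x) (- u (\<i> *\<^sub>C x))" for x
  have fadd: "f (x + y) = f x + f y" if "x \<in> W" "y \<in> W" for x y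
    using that by (simp add: f_def scaleC_add_right uadd WI complex_eq_iff)
  have fscale: "f (a *\<^sub>C x) = a * f x" if x: "x \<in> W" for a x
  proof -
    have "a *\<^sub>C x = complex_of_real (Re a) *\<^sub>C x + complex_of_real (Im a) *\<^sub>C (\<i> *\<^sub>C x)"
      unfolding scaleC_scaleC scaleC_add_left[symmetric]
      by (rule arg_cong[of _ _ "\<lambda>c. c *\<^sub>C x"]) (simp add: complex_eq_iff)
    moreover have "\<i> *\<^sub>C (a *\<^sub>C x)
        = complex_of_real (Re a) *\<^sub>C (\<i> *\<^sub>C x) + complex_of_real (- Im a) *\<^sub>C x"
      unfolding scaleC_scaleC scaleC_add_left[symmetric]
      by (rule arg_cong[of _ _ "\<lambda>c. c *\<^sub>C x"]) (simp add: complex_eq_iff)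
    ultimately have "u (a *\<^sub>C x) = Re a * u x + Im a * u (\<i> *\<^sub>C x)"
      "u (\<i> *\<^sub>C (a *\<^sub>C x)) = Re a * u (\<i> *\<^sub>C x) - Im a * u x"
      using x by (simp_all only: uadd uscale WI)
    then show ?thesis by (simp add: f_def complex_eq_iff)
  qed
  have bound: "cmod (f x) \<le> p x" if x: "x \<in> W" for x
  proof (cases "f x = 0")
    case True
    then show ?thesis using x D(2) by (auto intro!: ge Q0 WI)
  next
    case False
    \<comment> \<open>Rotate the value of the functional onto the positive real axis.\<close>
    define a where "a = complex_of_real (cmod (f x)) / f x"
    have a: "cmod a = 1" "a * f x = complex_of_real (cmod (f x))"
      using False by (simp_all add: a_def norm_divide)
    have "cmod (f x) = Re (f (a *\<^sub>C x))"
      using fscale[OF x, of a] a(2) by simp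
    also have "\<dots> = u (a *\<^sub>C x)"
      by (simp add: f_def)
    also have "\<dots> \<le> p (a *\<^sub>C x)"
      using x by (intro up WI)
    also have "\<dots> \<le> p x"
      using pscale_le[OF x, of a] a(1) by simp
    finally show ?thesis .
  qed
  show thesis
  proof
    show "linear_functional_on W f"
      using fadd fscale by (simp add: linear_functional_on_def)
    show "cmod (f x) \<le> Q x" if "x \<in> W" for x
      using bound[OF that] le[OF that DI(3)] by simp
    show "f d = 0" if "d \<in> D" for d
    proof -
      have "p d \<le> Q (d - d)"
        using that D(2) by (intro le) auto
      moreover have "Q 0 = 0"
        using Qscale[of 0 0] complex_vector.subspace_0[OF W] by simp
      moreover have "cmod (f d) \<le> p d"
        using that D(2) by (intro bound) auto
      ultimately have "cmod (f d) \<le> 0"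
        by (metis diff_self order_trans)
      then show ?thesis by simp
    qed
    have "e \<le> p x0"
      using far by (rule ge)
    also have "\<dots> \<le> - u (- x0)"
      using p'(3) up'[of "- x0"] x0 WI by force
    also have "\<dots> = Re (f x0)"
      using uminus[OF x0] by (simp add: f_def)
    also have "\<dots> \<le> cmod (f x0)"
      by (rule complex_Re_le_cmod)
    finally show "e \<le> cmod (f x0)" .
  qed
qed

section \<open>Closed subspaces of a Banach space and their sums\<close>

lemma closed_subspace_of_limit:
  assumes "closed_subspace_of C B N" "\<And>n. X n \<in> C" "l \<in> B" "(\<lambda>n. N (X n - l)) \<longlonglongrightarrow> 0"
  shows "l \<in> C"
  using assms by (intro assms(1)[unfolded closed_subspace_of_def, THEN conjunct2, THEN conjunct2, rule_format, of X l]) auto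

locale banach_on =
  fixes V :: "'v::complex_vector set" and N :: "'v \<Rightarrow> real"
  assumes banach: "banach_space_on V N"
begin

lemma normed: "normed_space_on V N"
  using banach by (simp add: banach_space_on_def)

lemma subspace: "complex_vector.subspace V"
  using normed by (simp add: normed_space_on_def)

lemma Cauchy_converges:
  assumes "\<And>n. X n \<in> V" "\<And>e. e > 0 \<Longrightarrow> \<exists>M. \<forall>m\<ge>M. \<forall>n\<ge>M. N (X m - X n) < e"
  obtains l where "l \<in> V" "(\<lambda>n. N (X n - l)) \<longlonglongrightarrow> 0"
proof -
  have "\<exists>l\<in>V. (\<lambda>n. N (X n - l)) \<longlonglongrightarrow> 0"
    using assms by (intro banach[unfolded banach_space_on_def, THEN conjunct2, rule_format]) auto
  then show ?thesis using that by blast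
qed

lemmas VI = complex_vector.subspace_add[OF subspace] complex_vector.subspace_scale[OF subspace]
  complex_vector.subspace_neg[OF subspace] complex_vector.subspace_diff[OF subspace]
  complex_vector.subspace_0[OF subspace] complex_vector.subspace_sum[OF subspace]

lemma N_nonneg: "x \<in> V \<Longrightarrow> 0 \<le> N x"
  and N_eq_0: "x \<in> V \<Longrightarrow> N x = 0 \<longleftrightarrow> x = 0"
  and N_triangle: "x \<in> V \<Longrightarrow> y \<in> V \<Longrightarrow> N (x + y) \<le> N x + N y"
  and N_scale: "x \<in> V \<Longrightarrow> N (a *\<^sub>C x) = cmod a * N x"
  using normed by (auto simp: normed_space_on_def)

lemma N_scale_real: "x \<in> V \<Longrightarrow> 0 \<le> t \<Longrightarrow> N (complex_of_real t *\<^sub>C x) = t * N x"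
  by (simp add: N_scale)

lemma N_zero [simp]: "N 0 = 0"
  using N_eq_0 VI by simp

lemma N_minus: "x \<in> V \<Longrightarrow> N (- x) = N x"
  using N_scale[of x "- 1"] by (simp add: scaleC_one)

lemma N_minus_commute: "x \<in> V \<Longrightarrow> y \<in> V \<Longrightarrow> N (x - y) = N (y - x)"
  using N_minus[of "x - y"] VI by simp

lemma N_diff: "x \<in> V \<Longrightarrow> y \<in> V \<Longrightarrow> N (x - y) \<le> N x + N y"
  using N_triangle[of x "- y"] VI N_minus[of y] by simp

lemma N_sum:
  assumes "\<And>i. i \<in> I \<Longrightarrow> x i \<in> V"
  shows "N (sum x I) \<le> (\<Sum>i\<in>I. N (x i))"
  using assms
proof (induction I rule: infinite_finite_induct)
  case (insert i I)
  then have "N (x i + sum x I) \<le> N (x i) + N (sum x I)"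
    by (intro N_triangle VI) auto
  with insert show ?case by simp
qed auto

lemma limit_unique:
  assumes X: "\<And>n. X n \<in> V" and l: "l \<in> V" "(\<lambda>n. N (X n - l)) \<longlonglongrightarrow> 0"
    and m: "m \<in> V" "(\<lambda>n. N (X n - m)) \<longlonglongrightarrow> 0"
  shows "l = m"
proof -
  have "N (m - l) \<le> N (X n - l) + N (X n - m)" for n
    using N_diff[of "X n - l" "X n - m"] X l(1) m(1) VI by (simp add: algebra_simps)
  moreover have "(\<lambda>n. N (X n - l) + N (X n - m)) \<longlonglongrightarrow> 0 + 0"
    by (intro tendsto_add l m)
  ultimately have "N (m - l) \<le> 0"
    by (intro LIMSEQ_le_const[where X="\<lambda>n. N (X n - l) + N (X n - m)"]) auto
  then show ?thesis
    using N_nonneg[of "m - l"] N_eq_0[of "m - l"] l(1) m(1) VI by force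
qed

lemma norm_limit_le:
  assumes X: "\<And>n. X n \<in> V" and l: "l \<in> V" "(\<lambda>n. N (X n - l)) \<longlonglongrightarrow> 0"
    and B: "\<And>n. N (X n) \<le> B"
  shows "N l \<le> B"
proof -
  have "N l \<le> B + N (X n - l)" for n
    using N_diff[of "X n" "X n - l"] X l(1) VI B[of n] by simp
  moreover have "(\<lambda>n. B + N (X n - l)) \<longlonglongrightarrow> B + 0"
    by (intro tendsto_add l) simp
  ultimately show ?thesis
    by (intro LIMSEQ_le_const[where X="\<lambda>n. B + N (X n - l)"]) auto
qed

lemma absolutely_convergent:
  assumes a: "\<And>n. a n \<in> V" and b: "\<And>n. N (a n) \<le> b n" "summable b"
  obtains l where "l \<in> V" "(\<lambda>n. N (sum a {..<n} - l)) \<longlonglongrightarrow> 0" "N l \<le> suminf b"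
proof -
  have b0: "0 \<le> b n" for n
    using N_nonneg[OF a[of n]] b(1)[of n] by simp
  have S: "sum a {..<n} \<in> V" for n
    using a by (intro VI)
  have less: "N (sum a {..<m} - sum a {..<n}) \<le> \<bar>sum b {n..<m}\<bar>" if "n \<le> m" for m n
  proof -
    have "sum a {..<m} - sum a {..<n} = sum a {n..<m}"
      using that by (metis sum_diff_nat_ivl zero_le lessThan_atLeast0)
    moreover have "N (sum a {n..<m}) \<le> (\<Sum>i=n..<m. N (a i))"
      using a by (intro N_sum)
    moreover have "\<dots> \<le> sum b {n..<m}"
      by (intro sum_mono b)
    ultimately show ?thesis by simp
  qed
  have "\<exists>M. \<forall>m\<ge>M. \<forall>n\<ge>M. N (sum a {..<m} - sum a {..<n}) < e" if e: "e > 0" for e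
  proof -
    obtain M where "\<forall>m\<ge>M. \<forall>n. norm (sum b {m..<n}) < e"
      using b(2) e unfolding summable_Cauchy by meson
    then have M: "\<And>m n. m \<ge> M \<Longrightarrow> norm (sum b {m..<n}) < e"
      by blast
    have "N (sum a {..<m} - sum a {..<n}) < e" if "m \<ge> M" "n \<ge> M" for m n
    proof (cases "n \<le> m")
      case True
      then show ?thesis using less[OF True] M[OF that(2), of m] by simp
    next
      case False
      then show ?thesis
        using less[of m n] M[OF that(1), of n] N_minus_commute[OF S S, of m n] by simp
    qed
    then show ?thesis by blast
  qed
  then obtain l where l: "l \<in> V" "(\<lambda>n. N (sum a {..<n} - l)) \<longlonglongrightarrow> 0"
    by (rule Cauchy_converges[OF S])
  have "N (sum a {..<n}) \<le> suminf b" for n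
  proof -
    have "N (sum a {..<n}) \<le> (\<Sum>i<n. N (a i))"
      using a by (intro N_sum)
    also have "\<dots> \<le> sum b {..<n}"
      by (intro sum_mono b)
    also have "\<dots> \<le> suminf b"
      using b(2) b0 by (intro sum_le_suminf) auto
    finally show ?thesis .
  qed
  then have "N l \<le> suminf b"
    using norm_limit_le[OF S l] by simp
  with l show ?thesis by (rule that)
qed

abbreviation closed_subspace :: "'v set \<Rightarrow> bool" where
  "closed_subspace C \<equiv> closed_subspace_of C V N"

lemma closed_subspaceD:
  assumes "closed_subspace C"
  shows "complex_vector.subspace C" "C \<subseteq> V"
    "(\<And>n. X n \<in> C) \<Longrightarrow> l \<in> V \<Longrightarrow> (\<lambda>n. N (X n - l)) \<longlonglongrightarrow> 0 \<Longrightarrow> l \<in> C"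
  using assms unfolding closed_subspace_of_def by blast+

text \<open>
  Halving the residual at each step turns approximate decompositions into exact ones; the
  corrections taken from \<^term>\<open>D\<close> form a convergent series, and those taken from \<^term>\<open>C\<close>
  then converge as well.
\<close>

lemma exact_decomposition:
  assumes C: "closed_subspace C" and D: "closed_subspace D"
    and halve: "\<And>x. x \<in> V \<Longrightarrow>
      \<exists>c\<in>C. \<exists>d\<in>D. N d \<le> \<rho> * N x \<and> N (x - c - d) \<le> N x / 2"
    and x: "x \<in> V"
  obtains c d where "c \<in> C" "d \<in> D" "x = c + d"
proof -
  note CD = closed_subspaceD(1)[OF C] closed_subspaceD(1)[OF D]
  have CV: "C \<subseteq> V" and DV: "D \<subseteq> V"
    using C D closed_subspaceD(2) by auto
  obtain c d where cd: "\<And>x. x \<in> V \<Longrightarrow> c x \<in> C" "\<And>x. x \<in> V \<Longrightarrow> d x \<in> D"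
    "\<And>x. x \<in> V \<Longrightarrow> N (d x) \<le> \<rho> * N x" "\<And>x. x \<in> V \<Longrightarrow> N (x - c x - d x) \<le> N x / 2"
    using halve by metis
  define r where "r n = ((\<lambda>y. y - c y - d y) ^^ n) x" for n
  have r_Suc: "r (Suc n) = r n - c (r n) - d (r n)" for n
    by (simp add: r_def)
  have r: "r n \<in> V" for n
  proof (induction n)
    case (Suc n)
    then show ?case unfolding r_Suc using cd CV DV by (intro VI) auto
  qed (simp add: r_def x)
  have Nr: "N (r n) \<le> N x * (1/2) ^ n" for n
  proof (induction n)
    case (Suc n)
    then show ?case using cd(4)[OF r[of n]] by (simp add: r_Suc)
  qed (simp add: r_def)
  have sum_eq: "(\<Sum>i<n. c (r i)) = x - r n - (\<Sum>i<n. d (r i))" for n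
  proof (induction n)
    case 0
    then show ?case by (simp add: r_def)
  next
    case (Suc n)
    have "(\<Sum>i<Suc n. c (r i)) = (x - r n - (\<Sum>i<n. d (r i))) + c (r n)"
      using Suc by simp
    also have "\<dots> = x - (r n - c (r n) - d (r n)) - ((\<Sum>i<n. d (r i)) + d (r n))"
      by (simp only: diff_conv_add_uminus minus_add_distrib minus_minus ac_simps) simp
    finally show ?case
      unfolding r_Suc sum.lessThan_Suc .
  qed
  have Nd: "N (d (r n)) \<le> \<bar>\<rho>\<bar> * N x * (1/2) ^ n" for n
  proof -
    have "N (d (r n)) \<le> \<rho> * N (r n)"
      using cd(3)[OF r] .
    also have "\<dots> \<le> \<bar>\<rho>\<bar> * N (r n)"
      using N_nonneg[OF r[of n]] by (intro mult_right_mono) auto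
    also have "\<dots> \<le> \<bar>\<rho>\<bar> * (N x * (1/2) ^ n)"
      using Nr by (intro mult_left_mono) auto
    finally show ?thesis by simp
  qed
  have dr: "d (r n) \<in> V" for n
    using cd(2)[OF r] DV by blast
  have sm: "summable (\<lambda>n. \<bar>\<rho>\<bar> * N x * (1/2) ^ n)"
    by (intro summable_mult summable_geometric) simp
  obtain l where l: "l \<in> V" "(\<lambda>n. N ((\<Sum>i<n. d (r i)) - l)) \<longlonglongrightarrow> 0"
    by (rule absolutely_convergent[OF dr Nd sm])
  have lD: "l \<in> D"
  proof (rule closed_subspaceD(3)[OF D _ l])
    show "(\<Sum>i<n. d (r i)) \<in> D" for n
      using cd(2)[OF r] by (intro complex_vector.subspace_sum[OF CD(2)])
  qed
  have "x - l \<in> C"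
  proof (rule closed_subspaceD(3)[OF C])
    show "(\<Sum>i<n. c (r i)) \<in> C" for n
      using cd(1)[OF r] by (intro complex_vector.subspace_sum[OF CD(1)])
    show "x - l \<in> V"
      using x l(1) by (intro VI)
    have le: "N ((\<Sum>i<n. c (r i)) - (x - l)) \<le> N x * (1/2) ^ n + N ((\<Sum>i<n. d (r i)) - l)" for n
    proof -
      have eq: "(\<Sum>i<n. c (r i)) - (x - l) = - (r n) - ((\<Sum>i<n. d (r i)) - l)"
        unfolding sum_eq by simp
      have "N (- (r n) - ((\<Sum>i<n. d (r i)) - l))
          \<le> N (- r n) + N ((\<Sum>i<n. d (r i)) - l)"
        using r l(1) dr by (intro N_diff VI)
      then show ?thesis
        unfolding eq using Nr[of n] N_minus[OF r[of n]] by simp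
    qed
    have "(\<lambda>n. N x * (1/2) ^ n + N ((\<Sum>i<n. d (r i)) - l)) \<longlonglongrightarrow> N x * 0 + 0"
      by (intro tendsto_add tendsto_mult tendsto_const l LIMSEQ_power_zero) simp
    then have lim: "(\<lambda>n. N x * (1/2) ^ n + N ((\<Sum>i<n. d (r i)) - l)) \<longlonglongrightarrow> 0"
      by simp
    show "(\<lambda>n. N ((\<Sum>i<n. c (r i)) - (x - l))) \<longlonglongrightarrow> 0"
    proof (rule tendsto_sandwich[OF _ _ tendsto_const lim])
      show "\<forall>\<^sub>F n in sequentially. 0 \<le> N ((\<Sum>i<n. c (r i)) - (x - l))"
        using cd(1)[OF r] CV x l(1) by (intro always_eventually allI N_nonneg VI) auto
    qed (use le in auto)
  qed
  then show ?thesis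
    using lD by (intro that[of "x - l" l]) auto
qed

text \<open>
  The open mapping theorem for the sum map on \<open>C \<times> D\<close>, stopped at approximate decompositions:
  by Baire one of the sets of sums with second summand of norm at most \<open>k\<close> is somewhere dense.
\<close>

lemma decomposition_bound:
  assumes C: "closed_subspace C" and D: "closed_subspace D"
    and sum: "\<And>x. x \<in> V \<Longrightarrow> \<exists>c\<in>C. \<exists>d\<in>D. x = c + d"
  obtains K where "0 \<le> K"
    "\<And>x. x \<in> V \<Longrightarrow> \<exists>c\<in>C. \<exists>d\<in>D. N d \<le> K * N x \<and> N (x - c - d) \<le> N x / 4"
proof -
  note CI = complex_vector.subspace_diff[OF closed_subspaceD(1)[OF C]]
    complex_vector.subspace_scale[OF closed_subspaceD(1)[OF C]]
    complex_vector.subspace_0[OF closed_subspaceD(1)[OF C]]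
  note DI = complex_vector.subspace_diff[OF closed_subspaceD(1)[OF D]]
    complex_vector.subspace_scale[OF closed_subspaceD(1)[OF D]]
    complex_vector.subspace_0[OF closed_subspaceD(1)[OF D]]
  have CV: "C \<subseteq> V" and DV: "D \<subseteq> V"
    using C D closed_subspaceD(2) by auto
  define \<delta> where "\<delta> x y = (if x \<in> V \<and> y \<in> V then N (x - y) else 0)" for x y
  interpret M: Metric_space V \<delta>
  proof
    show "0 \<le> \<delta> x y" for x y
      using VI N_nonneg by (simp add: \<delta>_def)
    show "\<delta> x y = \<delta> y x" for x y
      using N_minus_commute by (simp add: \<delta>_def)
    show "\<delta> x y = 0 \<longleftrightarrow> x = y" if "x \<in> V" "y \<in> V" for x y
      using that N_eq_0[of "x - y"] VI by (simp add: \<delta>_def)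
    show "\<delta> x z \<le> \<delta> x y + \<delta> y z" if "x \<in> V" "y \<in> V" "z \<in> V" for x y z
      using N_triangle[of "x - y" "y - z"] that VI by (simp add: \<delta>_def)
  qed
  have complete: "M.mcomplete"
    unfolding M.mcomplete_def
  proof (intro allI impI)
    fix X assume X: "M.MCauchy X"
    have XV: "X n \<in> V" for n
      using X by (auto simp: M.MCauchy_def)
    have "\<exists>M. \<forall>m\<ge>M. \<forall>n\<ge>M. N (X m - X n) < e" if "e > 0" for e
    proof -
      have "\<exists>M. \<forall>m n. M \<le> m \<longrightarrow> M \<le> n \<longrightarrow> N (X m - X n) < e"
        using X that XV by (simp add: M.MCauchy_def \<delta>_def)
      then show ?thesis by blast
    qed
    then obtain l where l: "l \<in> V" "(\<lambda>n. N (X n - l)) \<longlonglongrightarrow> 0"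
      by (rule Cauchy_converges[OF XV])
    then have "(\<lambda>n. \<delta> (X n) l) \<longlonglongrightarrow> 0"
      using XV by (simp add: \<delta>_def)
    then show "\<exists>l. limitin M.mtopology X l sequentially"
      using XV l(1) by (auto simp: M.limitin_metric_dist_null)
  qed
  define S where "S k = {c + d | c d. c \<in> C \<and> d \<in> D \<and> N d \<le> real k}" for k :: nat
  define G where "G k = M.mtopology closure_of S k" for k
  have SV: "S k \<subseteq> V" for k
    using CV DV VI by (auto simp: S_def)
  have SG: "S k \<subseteq> G k" for k
    unfolding G_def using SV by (intro closure_of_subset) simp
  have "V = (\<Union>k. G k)"
  proof
    show "V \<subseteq> (\<Union>k. G k)"
    proof
      fix x assume "x \<in> V"
      then obtain c d where cd: "c \<in> C" "d \<in> D" "x = c + d"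
        using sum by blast
      obtain k :: nat where "N d \<le> real k"
        using real_arch_simple by blast
      then have "x \<in> S k"
        using cd by (auto simp: S_def)
      then show "x \<in> (\<Union>k. G k)"
        using SG by auto
    qed
    show "(\<Union>k. G k) \<subseteq> V"
      unfolding G_def using closure_of_subset_topspace[of M.mtopology] by auto
  qed
  moreover have "M.mtopology interior_of V \<noteq> {}"
    using interior_of_topspace[of M.mtopology] VI by auto
  moreover have "M.mtopology interior_of (\<Union>k. G k) = {}"
    if "\<And>k. M.mtopology interior_of G k = {}"
    using that by (intro M.metric_Baire_category_alt[OF complete]) (auto simp: G_def)
  ultimately have "\<exists>k. M.mtopology interior_of G k \<noteq> {}"
    by metis
  then obtain k x0 where "x0 \<in> M.mtopology interior_of G k"
    by auto
  then obtain r where x0: "x0 \<in> V" and r: "r > 0" "M.mball x0 r \<subseteq> G k"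
    by (auto simp: M.metric_interior_of)
  have approx: "\<exists>s\<in>S k. N (x - s) < \<eta>" if x: "x \<in> G k" and "\<eta> > 0" for x \<eta>
  proof -
    have "x \<in> V" "\<exists>s\<in>S k. s \<in> M.mball x \<eta>"
      using x \<open>\<eta> > 0\<close> unfolding G_def M.metric_closure_of by auto
    then show ?thesis
      using SV by (auto simp: \<delta>_def M.mball_def)
  qed
  show ?thesis
  proof
    show "0 \<le> 4 * real k / r"
      using r by simp
    fix x assume x: "x \<in> V"
    show "\<exists>c\<in>C. \<exists>d\<in>D. N d \<le> 4 * real k / r * N x \<and> N (x - c - d) \<le> N x / 4"
    proof (cases "x = 0")
      case True
      then show ?thesis
        by (intro bexI[of _ 0] CI DI) simp
    next
      case False
      then have Nx: "N x > 0"
        using N_nonneg[OF x] N_eq_0[OF x] by linarith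
      define t where "t = r / (2 * N x)"
      have t: "t > 0"
        using r Nx by (simp add: t_def)
      have Ntx: "N (complex_of_real t *\<^sub>C x) < r"
      proof -
        have "N (complex_of_real t *\<^sub>C x) = t * N x"
          using N_scale_real[OF x, of t] t by simp
        also have "\<dots> < r"
          using r Nx by (simp add: t_def)
        finally show ?thesis .
      qed
      have tx: "complex_of_real t *\<^sub>C x \<in> V"
        using x by (intro VI)
      have "x0 + complex_of_real t *\<^sub>C x \<in> M.mball x0 r"
        using x0 tx Ntx VI N_minus[OF tx] by (simp add: M.mball_def \<delta>_def)
      then obtain s1 where s1: "s1 \<in> S k" "N (x0 + complex_of_real t *\<^sub>C x - s1) < r / 16"
        using approx[of _ "r / 16"] r by (meson divide_pos_pos subsetD zero_less_numeral)
      have "x0 \<in> G k"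
        using r x0 by auto
      then obtain s2 where s2: "s2 \<in> S k" "N (x0 - s2) < r / 16"
        using approx[of _ "r / 16"] r by (meson divide_pos_pos zero_less_numeral)
      obtain c1 d1 c2 d2 where s: "s1 = c1 + d1" "s2 = c2 + d2" "c1 \<in> C" "c2 \<in> C" "d1 \<in> D" "d2 \<in> D"
        "N d1 \<le> real k" "N d2 \<le> real k"
        using s1(1) s2(1) by (auto simp: S_def)
      define c where "c = complex_of_real (1 / t) *\<^sub>C (c1 - c2)"
      define d where "d = complex_of_real (1 / t) *\<^sub>C (d1 - d2)"
      have c: "c \<in> C" and d: "d \<in> D"
        unfolding c_def d_def using s by (auto intro!: CI DI)
      have dV: "d1 \<in> V" "d2 \<in> V"
        using s DV by auto
      have "N d = 1 / t * N (d1 - d2)"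
        unfolding d_def using dV t by (intro N_scale_real VI) auto
      also have "\<dots> \<le> 1 / t * (real k + real k)"
        using N_diff[OF dV] s t by (intro mult_left_mono) auto
      also have "\<dots> = 4 * real k / r * N x"
        using r Nx by (simp add: t_def field_simps)
      finally have Nd: "N d \<le> 4 * real k / r * N x" .
      define e where "e = (x0 + complex_of_real t *\<^sub>C x - s1) - (x0 - s2)"
      have eV: "e \<in> V"
        unfolding e_def using x0 x s1(1) s2(1) SV by (intro VI) auto
      have "x = complex_of_real (1 / t) *\<^sub>C (complex_of_real t *\<^sub>C x)"
        using t by (simp add: scaleC_scaleC scaleC_one)
      then have "x - c - d = complex_of_real (1 / t) *\<^sub>C
          (complex_of_real t *\<^sub>C x - (c1 - c2) - (d1 - d2))"
        unfolding c_def d_def by (metis complex_vector.scale_right_diff_distrib)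
      also have "complex_of_real t *\<^sub>C x - (c1 - c2) - (d1 - d2) = e"
        by (simp add: e_def s algebra_simps)
      finally have "x - c - d = complex_of_real (1 / t) *\<^sub>C e" .
      then have "N (x - c - d) = 1 / t * N e"
        using N_scale_real[OF eV, of "1 / t"] t by simp
      also have "\<dots> \<le> 1 / t * (r / 16 + r / 16)"
      proof (rule mult_left_mono)
        have "N e \<le> N (x0 + complex_of_real t *\<^sub>C x - s1) + N (x0 - s2)"
          unfolding e_def using x0 x s1(1) s2(1) SV by (intro N_diff VI) auto
        then show "N e \<le> r / 16 + r / 16"
          using s1(2) s2(2) by linarith
      qed (use t in simp)
      also have "\<dots> = N x / 4"
        using r Nx by (simp add: t_def field_simps)
      finally show ?thesis
        using Nd c d by blast
    qed
  qed
qed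

end

section \<open>Functionals that are small on a closed subspace\<close>

instantiation prod :: (complex_vector, complex_vector) complex_vector
begin
definition scaleC_prod :: "complex \<Rightarrow> 'a \<times> 'b \<Rightarrow> 'a \<times> 'b" where
  "scaleC_prod a x = (a *\<^sub>C fst x, a *\<^sub>C snd x)"
instance
  by standard
    (simp_all add: scaleC_prod_def prod_eq_iff scaleC_add_right scaleC_add_left
      scaleC_scaleC scaleC_one)
end

lemma scaleC_Pair [simp]: "a *\<^sub>C (x, y) = (a *\<^sub>C x, a *\<^sub>C y)"
  by (simp add: scaleC_prod_def)

lemma linear_functional_onD:
  assumes "linear_functional_on W f"
  shows "x \<in> W \<Longrightarrow> y \<in> W \<Longrightarrow> f (x + y) = f x + f y" "x \<in> W \<Longrightarrow> f (a *\<^sub>C x) = a * f x"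
  using assms by (auto simp: linear_functional_on_def)

lemma linear_functional_on_diff:
  assumes "complex_vector.subspace W" "linear_functional_on W f" "x \<in> W" "y \<in> W"
  shows "f (x - y) = f x - f y"
proof -
  have "f (x + (- 1) *\<^sub>C y) = f x + (- 1) * f y"
    using assms linear_functional_onD[OF assms(2)] complex_vector.subspace_scale[OF assms(1)] by metis
  then show ?thesis by (simp add: scaleC_one)
qed

lemma linear_functional_on_zero:
  assumes "complex_vector.subspace W" "linear_functional_on W f"
  shows "f 0 = 0"
  using linear_functional_on_diff[OF assms, of 0 0] complex_vector.subspace_0[OF assms(1)] by simp

lemma linear_functional_on_sum:
  assumes "complex_vector.subspace W" "linear_functional_on W f" "\<And>i. i \<in> I \<Longrightarrow> x i \<in> W"
  shows "f (sum x I) = (\<Sum>i\<in>I. f (x i))"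
  using assms(3)
proof (induction I rule: infinite_finite_induct)
  case (insert i I)
  then have "sum x I \<in> W"
    by (intro complex_vector.subspace_sum[OF assms(1)]) auto
  with insert have "f (x i + sum x I) = f (x i) + f (sum x I)"
    by (intro linear_functional_onD(1)[OF assms(2)]) auto
  with insert show ?case by simp
qed (simp_all add: linear_functional_on_zero[OF assms(1,2)])

text \<open>
  The values of the functionals define a linear map into sequences that vanishes on \<^term>\<open>C\<close>
  and whose range contains all the unit sequences.
\<close>

lemma biorthogonal_infinite_codimension:
  fixes g :: "nat \<Rightarrow> 'v::complex_vector \<Rightarrow> complex"
  assumes V: "complex_vector.subspace V" and CV: "C \<subseteq> V"
    and g: "\<And>i. linear_functional_on V (g i)" and gC: "\<And>i c. c \<in> C \<Longrightarrow> g i c = 0"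
    and xV: "\<And>j. x j \<in> V" and gx: "\<And>i j. g i (x j) = (if i = j then 1 else 0)"
  shows "infinite_codimension C V"
  unfolding infinite_codimension_def
proof
  assume "\<exists>S. finite S \<and> S \<subseteq> V \<and> V \<subseteq> complex_vector.span (S \<union> C)"
  then obtain S where S: "finite S" "S \<subseteq> V" "V \<subseteq> complex_vector.span (S \<union> C)"
    by blast
  define \<Phi> where "\<Phi> y = (\<lambda>i. g i y)" for y
  define e where "e j = (\<lambda>i. if i = j then 1 else 0 :: complex)" for j :: nat
  have \<Phi>x: "\<Phi> (x j) = e j" for j
    by (simp add: \<Phi>_def e_def gx)
  let ?T = "complex_vector.span (\<Phi> ` S)"
  have "y \<in> V \<and> \<Phi> y \<in> ?T" if "y \<in> complex_vector.span (S \<union> C)" for y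
    using that
  proof (induction rule: complex_vector.span_induct)
    case base
    have "\<Phi> 0 = 0"
      using linear_functional_on_zero[OF V g] by (simp add: \<Phi>_def fun_eq_iff)
    moreover have "\<Phi> (a + b) = \<Phi> a + \<Phi> b" if "a \<in> V" "b \<in> V" for a b
      using that linear_functional_onD[OF g] by (simp add: \<Phi>_def fun_eq_iff)
    moreover have "\<Phi> (c *\<^sub>C a) = c *\<^sub>C \<Phi> a" if "a \<in> V" for a c
      using that linear_functional_onD[OF g]
      by (simp add: \<Phi>_def fun_eq_iff scaleC_fun_def scaleC_complex_def)
    ultimately show ?case
      using V by (auto simp: complex_vector.subspace_def
          intro: complex_vector.span_zero complex_vector.span_add complex_vector.span_scale)
  next
    case (step y)
    show ?case
    proof (cases "y \<in> S")
      case True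
      then show ?thesis using S by (auto intro: complex_vector.span_base)
    next
      case False
      then have "y \<in> C" "\<Phi> y = 0"
        using step gC by (auto simp: \<Phi>_def)
      then show ?thesis
        using CV by (auto simp only: complex_vector.span_zero)
    qed
  qed
  then have "\<Phi> (x j) \<in> ?T" for j
    using S(3) xV by blast
  then have "range e \<subseteq> ?T"
    by (auto simp only: \<Phi>x)
  moreover have "\<not> complex_vector.dependent (range e)"
    unfolding complex_vector.dependent_def
  proof
    assume "\<exists>a\<in>range e. a \<in> complex_vector.span (range e - {a})"
    then obtain j where j: "e j \<in> complex_vector.span (range e - {e j})"
      by blast
    have "complex_vector.subspace {w :: nat \<Rightarrow> complex. w j = 0}"
      by (simp add: complex_vector.subspace_def scaleC_fun_def scaleC_complex_def)
    moreover have "range e - {e j} \<subseteq> {w. w j = 0}"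
      by (auto simp: e_def)
    ultimately have "e j \<in> {w. w j = 0}"
      using j complex_vector.span_minimal by blast
    then show False by (simp add: e_def)
  qed
  ultimately have "finite (range e)"
    using complex_vector.independent_span_bound[of "\<Phi> ` S" "range e"] S(1) by simp
  moreover have "inj e"
    by (auto simp: inj_def e_def fun_eq_iff split: if_splits)
  ultimately show False
    using finite_imageD by blast
qed

context banach_on
begin

text \<open>
  If \<open>C + R\<close> is not the whole space, a functional vanishing on \<^term>\<open>C\<close> can be almost zero on
  \<^term>\<open>R\<close> relative to its norm: otherwise decompositions would be found by halving. Working in
  \<open>V \<times> V\<close> with the seminorm \<open>N x + \<delta> N y\<close> and the subspace of the pairs \<open>(c + r, - r)\<close> yields
  at once the functional \<^term>\<open>f\<close> and an extension \<^term>\<open>h\<close> of its small restriction to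
  \<^term>\<open>R\<close> that is small everywhere.
\<close>

lemma functional_small_on_subspace:
  assumes C: "closed_subspace C" and R: "closed_subspace R"
    and v: "v \<in> V" "\<And>c r. c \<in> C \<Longrightarrow> r \<in> R \<Longrightarrow> v \<noteq> c + r"
    and \<delta>: "\<delta> > 0"
  obtains f h x where
    "linear_functional_on V f" "\<And>y. y \<in> V \<Longrightarrow> cmod (f y) \<le> N y" "\<And>c. c \<in> C \<Longrightarrow> f c = 0"
    "linear_functional_on V h" "\<And>y. y \<in> V \<Longrightarrow> cmod (h y) \<le> \<delta> * N y" "\<And>r. r \<in> R \<Longrightarrow> h r = f r"
    "x \<in> V" "N x \<le> 1" "1 / 2 \<le> cmod (f x)"
proof -
  note CS = closed_subspaceD(1)[OF C] and RS = closed_subspaceD(1)[OF R]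
  have CV: "C \<subseteq> V" and RV: "R \<subseteq> V"
    using C R closed_subspaceD(2) by auto
  have "\<exists>x\<in>V. N x \<le> 1 \<and> (\<forall>c\<in>C. \<forall>r\<in>R. N r \<le> 1 / (2 * \<delta>) \<longrightarrow> 1 / 2 < N (x - c - r))"
  proof (rule ccontr)
    assume neg: "\<not> ?thesis"
    have "\<exists>c\<in>C. \<exists>r\<in>R. N r \<le> 1 / (2 * \<delta>) * N x \<and> N (x - c - r) \<le> N x / 2" if x: "x \<in> V" for x
    proof (cases "x = 0")
      case True
      then show ?thesis
        using complex_vector.subspace_0[OF CS] complex_vector.subspace_0[OF RS]
        by (intro bexI[of _ 0]) auto
    next
      case False
      then have Nx: "N x > 0"
        using N_nonneg[OF x] N_eq_0[OF x] by linarith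
      define y where "y = complex_of_real (1 / N x) *\<^sub>C x"
      have y: "y \<in> V" "N y = 1" "x = complex_of_real (N x) *\<^sub>C y"
        using x Nx by (simp_all add: y_def VI N_scale norm_divide scaleC_scaleC scaleC_one)
      then obtain c r where cr: "c \<in> C" "r \<in> R" "N r \<le> 1 / (2 * \<delta>)" "N (y - c - r) \<le> 1 / 2"
        using neg by (metis linorder_not_le order_refl)
      have mem: "complex_of_real (N x) *\<^sub>C c \<in> C" "complex_of_real (N x) *\<^sub>C r \<in> R"
        using cr complex_vector.subspace_scale[OF CS] complex_vector.subspace_scale[OF RS] by auto
      have "x - complex_of_real (N x) *\<^sub>C c - complex_of_real (N x) *\<^sub>C r
          = complex_of_real (N x) *\<^sub>C (y - c - r)"
        using y(3) by (metis complex_vector.scale_right_diff_distrib)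
      moreover have "N (complex_of_real (N x) *\<^sub>C (y - c - r)) = N x * N (y - c - r)"
        using y cr CV RV Nx by (intro N_scale_real VI) auto
      moreover have "N (complex_of_real (N x) *\<^sub>C r) = N x * N r"
        using cr RV Nx by (intro N_scale_real) auto
      moreover have "N x * N r \<le> N x * (1 / (2 * \<delta>))" "N x * N (y - c - r) \<le> N x * (1 / 2)"
        using mult_left_mono[OF cr(3), of "N x"] mult_left_mono[OF cr(4), of "N x"] Nx by auto
      ultimately show ?thesis
        using mem by (intro bexI[OF _ mem(1)] bexI[OF _ mem(2)]) (simp_all add: mult.commute)
    qed
    then show False
      using exact_decomposition[OF C R _ v(1)] v(2) by blast
  qed
  then obtain x where x: "x \<in> V" "N x \<le> 1"
    and far: "\<And>c r. c \<in> C \<Longrightarrow> r \<in> R \<Longrightarrow> N r \<le> 1 / (2 * \<delta>) \<Longrightarrow> 1 / 2 < N (x - c - r)"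
    by blast
  define D where "D = {(c + r, - r) | c r. c \<in> C \<and> r \<in> R}"
  define Q where "Q p = N (fst p) + \<delta> * N (snd p)" for p
  have VV: "complex_vector.subspace (V \<times> V)"
    by (auto simp: complex_vector.subspace_def zero_prod_def VI)
  have DS: "complex_vector.subspace D"
    unfolding complex_vector.subspace_def
  proof (intro conjI ballI allI)
    show "0 \<in> D"
      using complex_vector.subspace_0[OF CS] complex_vector.subspace_0[OF RS]
      by (force simp: D_def zero_prod_def)
  next
    fix p q assume "p \<in> D" "q \<in> D"
    then obtain c r c' r' where "p = (c + r, - r)" "q = (c' + r', - r')"
      "c \<in> C" "c' \<in> C" "r \<in> R" "r' \<in> R"
      by (auto simp: D_def)
    then have "p + q = ((c + c') + (r + r'), - (r + r'))" "c + c' \<in> C" "r + r' \<in> R"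
      using complex_vector.subspace_add[OF CS] complex_vector.subspace_add[OF RS]
      by (auto simp: algebra_simps)
    then show "p + q \<in> D"
      unfolding D_def by blast
  next
    fix a p assume "p \<in> D"
    then obtain c r where "p = (c + r, - r)" "c \<in> C" "r \<in> R"
      by (auto simp: D_def)
    then have "a *\<^sub>C p = (a *\<^sub>C c + a *\<^sub>C r, - (a *\<^sub>C r))" "a *\<^sub>C c \<in> C" "a *\<^sub>C r \<in> R"
      using complex_vector.subspace_scale[OF CS] complex_vector.subspace_scale[OF RS]
      by (auto simp: scaleC_add_right)
    then show "a *\<^sub>C p \<in> D"
      unfolding D_def by blast
  qed
  have DV: "D \<subseteq> V \<times> V"
    using CV RV by (auto simp: D_def intro!: VI)
  obtain F where F: "linear_functional_on (V \<times> V) F" "\<And>p. p \<in> V \<times> V \<Longrightarrow> cmod (F p) \<le> Q p"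
    "\<And>d. d \<in> D \<Longrightarrow> F d = 0" "1 / 2 \<le> cmod (F (x, 0))"
  proof (rule hahn_banach_separation[OF VV DS DV])
    show "0 \<le> Q p" if "p \<in> V \<times> V" for p
      using that \<delta> by (auto simp: Q_def intro!: add_nonneg_nonneg mult_nonneg_nonneg N_nonneg)
    show "Q (p + q) \<le> Q p + Q q" if "p \<in> V \<times> V" "q \<in> V \<times> V" for p q
    proof -
      have "\<delta> * N (snd p + snd q) \<le> \<delta> * (N (snd p) + N (snd q))"
        using that \<delta> by (intro mult_left_mono N_triangle) auto
      then show ?thesis
        using N_triangle[of "fst p" "fst q"] that by (auto simp: Q_def algebra_simps)
    qed
    show "Q (a *\<^sub>C p) = cmod a * Q p" if "p \<in> V \<times> V" for a p
      using that by (auto simp: Q_def N_scale algebra_simps)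
    show "(x, 0) \<in> V \<times> V"
      using x VI by simp
    fix d assume "d \<in> D"
    then obtain c r where d: "d = (c + r, - r)" and c: "c \<in> C" and r: "r \<in> R"
      by (auto simp: D_def)
    have Q: "Q ((x, 0) - d) = N (x - c - r) + \<delta> * N r"
      by (simp add: d Q_def algebra_simps)
    have "0 \<le> N (x - c - r)"
      using x c r CV RV by (intro N_nonneg VI) auto
    moreover have "0 \<le> \<delta> * N r"
      using r RV \<delta> by (intro mult_nonneg_nonneg N_nonneg) auto
    moreover have "1 / 2 \<le> \<delta> * N r" if "\<not> N r \<le> 1 / (2 * \<delta>)"
      using that \<delta> by (simp add: field_simps)
    ultimately show "1 / 2 \<le> Q ((x, 0) - d)"
      unfolding Q using far[OF c r] by linarith
  qed blast
  have F_Pair: "F (a, b) = F (a, 0) + F (0, b)" if "a \<in> V" "b \<in> V" for a b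
    using linear_functional_onD(1)[OF F(1), of "(a, 0)" "(0, b)"] that VI by simp
  show ?thesis
  proof
    show "linear_functional_on V (\<lambda>y. F (y, 0))" "linear_functional_on V (\<lambda>y. F (0, y))"
      unfolding linear_functional_on_def
      using linear_functional_onD(1)[OF F(1), of "(_, 0)" "(_, 0)"]
        linear_functional_onD(1)[OF F(1), of "(0, _)" "(0, _)"]
        linear_functional_onD(2)[OF F(1), of "(_, 0)"]
        linear_functional_onD(2)[OF F(1), of "(0, _)"] VI(5)
      by simp_all
    show "cmod (F (y, 0)) \<le> N y" if "y \<in> V" for y
      using F(2)[of "(y, 0)"] that VI by (simp add: Q_def)
    show "cmod (F (0, y)) \<le> \<delta> * N y" if "y \<in> V" for y
      using F(2)[of "(0, y)"] that VI by (simp add: Q_def)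
    show "F (c, 0) = 0" if "c \<in> C" for c
    proof (rule F(3))
      have "(c + 0, - 0) \<in> D"
        unfolding D_def using that complex_vector.subspace_0[OF RS] by blast
      then show "(c, 0) \<in> D" by simp
    qed
    show "F (0, r) = F (r, 0)" if "r \<in> R" for r
    proof -
      have "(0 + r, - r) \<in> D"
        unfolding D_def using that complex_vector.subspace_0[OF CS] by blast
      then have "F (r, - r) = 0"
        using F(3) by force
      moreover have "F (0, - r) = - F (0, r)"
        using linear_functional_onD(2)[OF F(1), of "(0, r)" "- 1"] that RV VI(5)
        by (auto simp: scaleC_one)
      ultimately show ?thesis
        using F_Pair[of r "- r"] that RV VI by auto
    qed
  qed (use x F(4) in auto)
qed

end

section \<open>Perturbation of a closed subspace\<close>

context banach_on
begin

lemma bounded_functional_tendsto: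
  assumes g: "linear_functional_on V g" "\<And>y. y \<in> V \<Longrightarrow> cmod (g y) \<le> K * N y"
    and X: "\<And>n. X n \<in> V" and l: "l \<in> V" "(\<lambda>n. N (X n - l)) \<longlonglongrightarrow> 0"
  shows "(\<lambda>n. g (X n)) \<longlonglongrightarrow> g l"
proof -
  have "(\<lambda>n. K * N (X n - l)) \<longlonglongrightarrow> K * 0"
    by (intro tendsto_mult tendsto_const l)
  then have lim: "(\<lambda>n. K * N (X n - l)) \<longlonglongrightarrow> 0"
    by simp
  have "cmod (g (X n) - g l) \<le> K * N (X n - l)" for n
    using g(2)[of "X n - l"] linear_functional_on_diff[OF subspace g(1) X l(1)] X l(1) VI by simp
  then have "(\<lambda>n. g (X n) - g l) \<longlonglongrightarrow> 0"
    by (intro Lim_null_comparison[OF _ lim] always_eventually allI)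
  then show ?thesis
    by (rule LIM_zero_cancel)
qed

text \<open>
  One step of the inductive choice below. The points that fall into \<^term>\<open>C\<close> when their
  components along the vectors chosen so far are removed form the closed subspace
  \<open>C + span (X j)\<close>. The next functional vanishes on it and is small on \<^term>\<open>R\<close>; the
  next vector is corrected so that the previous functionals annihilate it. The norm of the corrected
  vector has a bound that depends only on the previous ones, which tells in advance how small the
  functional has to be.
\<close>

lemma biorthogonal_step:
  fixes n :: nat
  assumes C: "closed_subspace C" "infinite_codimension C V" and R: "closed_subspace R"
    and not_sum: "\<And>C'. closed_subspace C' \<Longrightarrow> C \<subseteq> C' \<Longrightarrow> infinite_codimension C' V \<Longrightarrow>
      \<exists>v\<in>V. \<forall>c\<in>C'. \<forall>r\<in>R. v \<noteq> c + r"
    and \<eta>: "\<eta> > 0"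
    and F: "\<And>j. j < n \<Longrightarrow> linear_functional_on V (F j)"
      "\<And>j y. j < n \<Longrightarrow> y \<in> V \<Longrightarrow> cmod (F j y) \<le> N y" "\<And>j c. j < n \<Longrightarrow> c \<in> C \<Longrightarrow> F j c = 0"
    and X: "\<And>j. j < n \<Longrightarrow> X j \<in> V"
    and FX: "\<And>i j. i < n \<Longrightarrow> j < n \<Longrightarrow> F i (X j) = (if i = j then 1 else 0)"
  obtains f h x where
    "linear_functional_on V f" "\<And>y. y \<in> V \<Longrightarrow> cmod (f y) \<le> N y" "\<And>c. c \<in> C \<Longrightarrow> f c = 0"
    "linear_functional_on V h" "\<And>y. y \<in> V \<Longrightarrow> cmod (h y) * N x \<le> \<eta> * N y"
    "\<And>r. r \<in> R \<Longrightarrow> h r = f r" "x \<in> V" "f x = 1"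
    "\<And>j. j < n \<Longrightarrow> F j x = 0" "\<And>j. j < n \<Longrightarrow> f (X j) = 0"
proof -
  note CS = closed_subspaceD(1)[OF C(1)]
  have CV: "C \<subseteq> V"
    using C closed_subspaceD(2) by auto
  define q where "q y = y - (\<Sum>j<n. F j y *\<^sub>C X j)" for y
  have sumV: "(\<Sum>j<n. F j y *\<^sub>C X j) \<in> V" for y
    using X by (intro VI(6) VI(2)) auto
  have qV: "q y \<in> V" if "y \<in> V" for y
    unfolding q_def using that sumV by (intro VI(4))
  have qdiff: "q (a - b) = q a - q b" if "a \<in> V" "b \<in> V" for a b
  proof -
    have "(\<Sum>j<n. F j (a - b) *\<^sub>C X j) = (\<Sum>j<n. F j a *\<^sub>C X j - F j b *\<^sub>C X j)"
      using linear_functional_on_diff[OF subspace F(1)] that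
      by (intro sum.cong) (auto simp: complex_vector.scale_left_diff_distrib)
    then show ?thesis
      by (simp add: q_def sum_subtractf)
  qed
  have qscale: "q (t *\<^sub>C a) = t *\<^sub>C q a" if "a \<in> V" for t a
  proof -
    have "(\<Sum>j<n. F j (t *\<^sub>C a) *\<^sub>C X j) = (\<Sum>j<n. t *\<^sub>C (F j a *\<^sub>C X j))"
      using linear_functional_onD(2)[OF F(1)] that
      by (intro sum.cong) (auto simp: scaleC_scaleC)
    then show ?thesis
      by (simp add: q_def complex_vector.scale_right_diff_distrib complex_vector.scale_sum_right)
  qed
  define L where "L = 1 + (\<Sum>j<n. N (X j))"
  have L: "L \<ge> 1"
    unfolding L_def using X N_nonneg by (auto intro!: sum_nonneg)
  have qbound: "N (q y) \<le> L * N y" if y: "y \<in> V" for y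
  proof -
    have "N (q y) \<le> N y + N (\<Sum>j<n. F j y *\<^sub>C X j)"
      unfolding q_def using y sumV by (intro N_diff)
    also have "N (\<Sum>j<n. F j y *\<^sub>C X j) \<le> (\<Sum>j<n. N (F j y *\<^sub>C X j))"
      using X by (intro N_sum VI(2)) auto
    also have "\<dots> \<le> (\<Sum>j<n. N y * N (X j))"
      using X F(2) y N_nonneg by (intro sum_mono) (auto simp: N_scale intro!: mult_right_mono)
    finally show ?thesis
      by (simp add: L_def algebra_simps sum_distrib_left)
  qed
  have Fq: "F i (q y) = 0" if "y \<in> V" "i < n" for y i
  proof -
    have "F i (q y) = F i y - F i (\<Sum>j<n. F j y *\<^sub>C X j)"
      unfolding q_def using that sumV F(1) by (intro linear_functional_on_diff[OF subspace])
    also have "F i (\<Sum>j<n. F j y *\<^sub>C X j) = (\<Sum>j<n. F i (F j y *\<^sub>C X j))"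
      using X F(1)[OF that(2)] by (intro linear_functional_on_sum[OF subspace] VI(2)) auto
    also have "\<dots> = (\<Sum>j<n. if j = i then F j y else 0)"
      using X FX[OF that(2)] linear_functional_onD(2)[OF F(1)[OF that(2)]]
      by (intro sum.cong) auto
    also have "\<dots> = F i y"
      using that by simp
    finally show ?thesis by simp
  qed
  define C' where "C' = {y \<in> V. q y \<in> C}"
  have CC': "C \<subseteq> C'"
    using CV F(3) by (auto simp: C'_def q_def)
  have XC': "X i \<in> C'" if i: "i < n" for i
  proof -
    have "(\<Sum>j<n. F j (X i) *\<^sub>C X j) = (\<Sum>j<n. if j = i then X j else 0)"
      using i FX by (intro sum.cong) (auto simp: scaleC_one)
    then have "q (X i) = 0"
      using i by (simp add: q_def)
    then show ?thesis
      using i X complex_vector.subspace_0[OF CS] by (simp add: C'_def)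
  qed
  have C'S: "complex_vector.subspace C'"
    unfolding complex_vector.subspace_def
  proof (intro conjI ballI allI)
    show "0 \<in> C'"
      using CC' complex_vector.subspace_0[OF CS] by auto
    show "a + b \<in> C'" if "a \<in> C'" "b \<in> C'" for a b
    proof -
      have ab: "a \<in> V" "b \<in> V" "q a \<in> C" "q b \<in> C"
        using that by (auto simp: C'_def)
      have "q (a + b) = q (a - (- 1) *\<^sub>C b)"
        by (simp add: scaleC_one)
      also have "\<dots> = q a + q b"
        using ab qdiff[of a "(- 1) *\<^sub>C b"] qscale[of b "- 1"] VI by (simp add: scaleC_one)
      finally show ?thesis
        using ab VI complex_vector.subspace_add[OF CS] by (simp add: C'_def)
    qed
    show "t *\<^sub>C a \<in> C'" if "a \<in> C'" for t a
      using that qscale VI complex_vector.subspace_scale[OF CS] by (simp add: C'_def)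
  qed
  have C': "closed_subspace C'"
    unfolding closed_subspace_of_def
  proof (intro conjI allI impI)
    fix Y l assume "(\<forall>n. Y n \<in> C') \<and> l \<in> V \<and> (\<lambda>n. N (Y n - l)) \<longlonglongrightarrow> 0"
    then have Y: "\<And>n. Y n \<in> V" "\<And>n. q (Y n) \<in> C" and l: "l \<in> V" "(\<lambda>n. N (Y n - l)) \<longlonglongrightarrow> 0"
      by (auto simp: C'_def)
    have "q l \<in> C"
    proof (rule closed_subspaceD(3)[OF C(1) Y(2) qV[OF l(1)]])
      have "(\<lambda>n. L * N (Y n - l)) \<longlonglongrightarrow> L * 0"
        by (intro tendsto_mult tendsto_const l)
      then have lim: "(\<lambda>n. L * N (Y n - l)) \<longlonglongrightarrow> 0"
        by simp
      have "0 \<le> N (q (Y n) - q l)" "N (q (Y n) - q l) \<le> L * N (Y n - l)" for n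
        using qbound[of "Y n - l"] qdiff[of "Y n" l] Y(1) l(1) VI qV N_nonneg by simp_all
      then show "(\<lambda>n. N (q (Y n) - q l)) \<longlonglongrightarrow> 0"
        by (intro tendsto_sandwich[OF _ _ tendsto_const lim]) auto
    qed
    then show "l \<in> C'"
      using l by (simp add: C'_def)
  qed (use C'S in \<open>auto simp: C'_def\<close>)
  have "infinite_codimension C' V"
    unfolding infinite_codimension_def
  proof
    assume "\<exists>S. finite S \<and> S \<subseteq> V \<and> V \<subseteq> complex_vector.span (S \<union> C')"
    then obtain S where S: "finite S" "S \<subseteq> V" "V \<subseteq> complex_vector.span (S \<union> C')"
      by blast
    let ?S = "S \<union> X ` {..<n}"
    have "y \<in> complex_vector.span (?S \<union> C)" if y: "y \<in> C'" for y
    proof -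
      have "q y \<in> complex_vector.span (?S \<union> C)"
        using y by (intro complex_vector.span_base) (auto simp: C'_def)
      moreover have "(\<Sum>j<n. F j y *\<^sub>C X j) \<in> complex_vector.span (?S \<union> C)"
        by (intro complex_vector.span_sum complex_vector.span_scale complex_vector.span_base) auto
      ultimately have "q y + (\<Sum>j<n. F j y *\<^sub>C X j) \<in> complex_vector.span (?S \<union> C)"
        by (rule complex_vector.span_add)
      then show ?thesis
        by (simp add: q_def)
    qed
    moreover have "S \<subseteq> complex_vector.span (?S \<union> C)"
      by (auto intro: complex_vector.span_base)
    ultimately have "complex_vector.span (S \<union> C') \<subseteq> complex_vector.span (?S \<union> C)"
      by (intro complex_vector.span_minimal complex_vector.subspace_span) auto
    then have "V \<subseteq> complex_vector.span (?S \<union> C)" "finite ?S" "?S \<subseteq> V"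
      using S X by auto
    then have "\<exists>S. finite S \<and> S \<subseteq> V \<and> V \<subseteq> complex_vector.span (S \<union> C)"
      by (intro exI[of _ ?S] conjI)
    then show False
      using C(2) by (simp add: infinite_codimension_def)
  qed
  then obtain v where v: "v \<in> V" "\<And>c r. c \<in> C' \<Longrightarrow> r \<in> R \<Longrightarrow> v \<noteq> c + r"
    using not_sum[OF C' CC'] by blast
  have \<delta>: "\<eta> / (2 * L) > 0"
    using \<eta> L by simp
  obtain f h x where f: "linear_functional_on V f" "\<And>y. y \<in> V \<Longrightarrow> cmod (f y) \<le> N y"
      "\<And>c. c \<in> C' \<Longrightarrow> f c = 0"
    and h: "linear_functional_on V h" "\<And>y. y \<in> V \<Longrightarrow> cmod (h y) \<le> \<eta> / (2 * L) * N y"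
      "\<And>r. r \<in> R \<Longrightarrow> h r = f r"
    and x: "x \<in> V" "N x \<le> 1" "1 / 2 \<le> cmod (f x)"
    by (rule functional_small_on_subspace[OF C' R v \<delta>]) blast+
  define w where "w = (1 / f x) *\<^sub>C q x"
  have fx: "f x \<noteq> 0"
    using x(3) by auto
  have wV: "w \<in> V"
    unfolding w_def using qV[OF x(1)] by (rule VI(2))
  have "f (q x) = f x - f (\<Sum>j<n. F j x *\<^sub>C X j)"
    unfolding q_def using x sumV f(1) by (intro linear_functional_on_diff[OF subspace])
  moreover have "(\<Sum>j<n. F j x *\<^sub>C X j) \<in> C'"
    using XC' by (intro complex_vector.subspace_sum[OF C'S] complex_vector.subspace_scale[OF C'S]) auto
  ultimately have fqx: "f (q x) = f x"
    using f(3) by simp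
  have Nw: "N w \<le> 2 * L"
  proof -
    have "N w = N (q x) / cmod (f x)"
      unfolding w_def using qV[OF x(1)] by (simp add: N_scale norm_divide)
    also have "\<dots> \<le> L / (1 / 2)"
    proof (rule frac_le)
      have "L * N x \<le> L * 1"
        using L x(2) by (intro mult_left_mono) auto
      then show "N (q x) \<le> L"
        using qbound[OF x(1)] by simp
    qed (use x L in auto)
    finally show ?thesis by simp
  qed
  show ?thesis
  proof
    show "f c = 0" if "c \<in> C" for c
      using f(3) CC' that by auto
    show "cmod (h y) * N w \<le> \<eta> * N y" if y: "y \<in> V" for y
    proof -
      have "cmod (h y) * N w \<le> (\<eta> / (2 * L) * N y) * (2 * L)"
        using h(2)[OF y] Nw N_nonneg[OF wV] N_nonneg[OF y] \<eta> L by (intro mult_mono) auto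
      then show ?thesis using L by simp
    qed
    show "f w = 1"
      using linear_functional_onD(2)[OF f(1) qV[OF x(1)], of "1 / f x"] fx fqx by (simp add: w_def)
    show "F j w = 0" if "j < n" for j
      using linear_functional_onD(2)[OF F(1)[OF that] qV[OF x(1)], of "1 / f x"] Fq[OF x(1) that]
      by (simp add: w_def)
    show "f (X j) = 0" if "j < n" for j
      using f(3) XC' that by auto
  qed (use f h wV in auto)
qed

text \<open>
  The functions \<open>h n\<close> extend the restrictions of the \<open>f n\<close> to \<^term>\<open>R\<close>. The
  bound on them is relative to the vectors \<open>x n\<close>, so that for summable \<^term>\<open>\<eta>\<close> the
  series \<open>\<Sum>n. h n y *\<^sub>C x n\<close> converges to an operator of norm at most \<open>suminf \<eta>\<close>.
\<close>

lemma biorthogonal_functionals: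
  fixes \<eta> :: "nat \<Rightarrow> real"
  assumes C: "closed_subspace C" "infinite_codimension C V" and R: "closed_subspace R"
    and not_sum: "\<And>C'. closed_subspace C' \<Longrightarrow> C \<subseteq> C' \<Longrightarrow> infinite_codimension C' V \<Longrightarrow>
      \<exists>v\<in>V. \<forall>c\<in>C'. \<forall>r\<in>R. v \<noteq> c + r"
    and \<eta>: "\<And>n. \<eta> n > 0"
  obtains f h x where
    "\<And>n. linear_functional_on V (f n)" "\<And>n y. y \<in> V \<Longrightarrow> cmod (f n y) \<le> N y"
    "\<And>n c. c \<in> C \<Longrightarrow> f n c = 0" "\<And>n. linear_functional_on V (h n)"
    "\<And>n y. y \<in> V \<Longrightarrow> cmod (h n y) * N (x n) \<le> \<eta> n * N y"
    "\<And>n r. r \<in> R \<Longrightarrow> h n r = f n r" "\<And>n. x n \<in> V"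
    "\<And>i j. f i (x j) = (if i = j then 1 else 0)"
proof -
  define ok where "ok n = (\<lambda>(f, h, x). linear_functional_on V f \<and> (\<forall>y\<in>V. cmod (f y) \<le> N y) \<and>
      (\<forall>c\<in>C. f c = 0) \<and> linear_functional_on V h \<and>
      (\<forall>y\<in>V. cmod (h y) * N x \<le> \<eta> n * N y) \<and> (\<forall>r\<in>R. h r = f r) \<and> x \<in> V \<and> f x = 1)" for n :: nat
  define P where "P s n t \<longleftrightarrow> ok n t \<and>
      (\<forall>j<n. fst (s j) (snd (snd t)) = 0 \<and> fst t (snd (snd (s j))) = 0)"
    for s :: "nat \<Rightarrow> ('v \<Rightarrow> complex) \<times> ('v \<Rightarrow> complex) \<times> 'v" and n t
  have "\<exists>s. \<forall>n. P s n (s n)"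
  proof (rule dependent_wellorder_choice)
    show "P s n t = P s' n t" if "\<And>m. m < n \<Longrightarrow> s m = s' m" for s s' n t
      using that by (auto simp: P_def)
    fix n s assume s: "\<And>m. m < n \<Longrightarrow> P s m (s m)"
    define F where "F j = fst (s j)" for j
    define X where "X j = snd (snd (s j))" for j
    have ok: "ok j (s j)" if "j < n" for j
      using s[OF that] by (simp add: P_def)
    have F: "linear_functional_on V (F j)" "\<And>y. y \<in> V \<Longrightarrow> cmod (F j y) \<le> N y"
      "\<And>c. c \<in> C \<Longrightarrow> F j c = 0" "X j \<in> V" "F j (X j) = 1" if "j < n" for j
      using ok[OF that] by (auto simp: ok_def F_def X_def split: prod.splits)
    have FX: "F i (X j) = (if i = j then 1 else 0)" if "i < n" "j < n" for i j
      using F(5)[OF that(1)] s[OF that(1)] s[OF that(2)]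
      by (cases i j rule: linorder_cases) (auto simp: P_def F_def X_def)
    obtain f h x where "linear_functional_on V f" "\<And>y. y \<in> V \<Longrightarrow> cmod (f y) \<le> N y"
      "\<And>c. c \<in> C \<Longrightarrow> f c = 0" "linear_functional_on V h"
      "\<And>y. y \<in> V \<Longrightarrow> cmod (h y) * N x \<le> \<eta> n * N y"
      "\<And>r. r \<in> R \<Longrightarrow> h r = f r" "x \<in> V" "f x = 1"
      "\<And>j. j < n \<Longrightarrow> F j x = 0" "\<And>j. j < n \<Longrightarrow> f (X j) = 0"
      by (rule biorthogonal_step[where n = n and F = F and X = X, OF C R not_sum \<eta>[of n] F(1,2,3,4) FX])
        blast+
    then have "P s n (f, h, x)"
      by (simp add: P_def ok_def F_def X_def)
    then show "\<exists>t. P s n t" by blast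
  qed
  then obtain s where s: "\<And>n. P s n (s n)" by blast
  define f where "f n = fst (s n)" for n
  define h where "h n = fst (snd (s n))" for n
  define x where "x n = snd (snd (s n))" for n
  have "ok n (f n, h n, x n)" for n
    using s[of n] by (simp add: P_def f_def h_def x_def)
  then have ok: "linear_functional_on V (f n) \<and> (\<forall>y\<in>V. cmod (f n y) \<le> N y) \<and>
      (\<forall>c\<in>C. f n c = 0) \<and> linear_functional_on V (h n) \<and>
      (\<forall>y\<in>V. cmod (h n y) * N (x n) \<le> \<eta> n * N y) \<and> (\<forall>r\<in>R. h n r = f n r) \<and>
      x n \<in> V \<and> f n (x n) = 1" for n
    by (simp add: ok_def)
  have fx: "f i (x j) = (if i = j then 1 else 0)" for i j
    using s[of i] s[of j] ok[of i]
    by (cases i j rule: linorder_cases) (auto simp: P_def f_def x_def)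
  show ?thesis
    by (rule that[of f h x]) (use ok fx in auto)
qed

text \<open>
  \<^term>\<open>C'\<close> is the common kernel of the functionals \<open>f n - h n\<close>, which vanish on
  \<^term>\<open>R\<close>. They perturb the \<open>f n\<close> so little that a Neumann series solves
  \<open>(f n - h n) w = f n y\<close> for all \<open>n\<close> at once, with \<open>w\<close> close to \<open>y\<close>.
  Solving for \<open>y = x j\<close> gives vectors biorthogonal to the new functionals, hence infinite
  codimension; solving for \<open>y\<close> in \<^term>\<open>C\<close> moves approximate decompositions along
  \<^term>\<open>C\<close> to approximate decompositions along \<^term>\<open>C'\<close>.
\<close>

theorem perturbed_closed_subspace:
  assumes C: "closed_subspace C" "infinite_codimension C V" and R: "closed_subspace R"
    and D: "closed_subspace D"
    and sum: "\<And>y. y \<in> V \<Longrightarrow> \<exists>c\<in>C. \<exists>d\<in>D. y = c + d"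
    and not_sum: "\<And>C'. closed_subspace C' \<Longrightarrow> C \<subseteq> C' \<Longrightarrow> infinite_codimension C' V \<Longrightarrow>
      \<exists>v\<in>V. \<forall>c\<in>C'. \<forall>r\<in>R. v \<noteq> c + r"
  obtains C' where "closed_subspace C'" "infinite_codimension C' V" "R \<subseteq> C'"
    "\<And>y. y \<in> V \<Longrightarrow> \<exists>c\<in>C'. \<exists>d\<in>D. y = c + d"
proof -
  have CV: "C \<subseteq> V" and DV: "D \<subseteq> V" and RV: "R \<subseteq> V"
    using C D R closed_subspaceD(2) by auto
  obtain K where K: "0 \<le> K"
    "\<And>y. y \<in> V \<Longrightarrow> \<exists>c\<in>C. \<exists>d\<in>D. N d \<le> K * N y \<and> N (y - c - d) \<le> N y / 4"
    using decomposition_bound[OF C(1) D sum] by blast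
  \<comment> \<open>The component of \<open>y\<close> in \<open>C\<close> has norm at most \<open>(2 + K) * N y\<close> and is moved by at most
    \<open>2 * \<epsilon>\<close> times its norm, so \<open>\<epsilon>\<close> is chosen to make this a quarter of \<open>N y\<close>.\<close>
  define \<epsilon> where "\<epsilon> = 1 / (8 * (2 + K))"
  have \<epsilon>: "0 < \<epsilon>" "\<epsilon> \<le> 1 / 2" "2 * \<epsilon> * (2 + K) = 1 / 4"
    using K(1) by (simp_all add: \<epsilon>_def field_simps)
  have pos: "\<And>n. \<epsilon> * (1/2) ^ Suc n > 0"
    using \<epsilon> by simp
  obtain f h x where f: "\<And>n. linear_functional_on V (f n)" "\<And>n y. y \<in> V \<Longrightarrow> cmod (f n y) \<le> N y"
      "\<And>n c. c \<in> C \<Longrightarrow> f n c = 0"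
    and h: "\<And>n. linear_functional_on V (h n)"
      "\<And>n y. y \<in> V \<Longrightarrow> cmod (h n y) * N (x n) \<le> \<epsilon> * (1/2) ^ Suc n * N y"
      "\<And>n r. r \<in> R \<Longrightarrow> h n r = f n r"
    and x: "\<And>n. x n \<in> V" and fx: "\<And>i j. f i (x j) = (if i = j then 1 else 0)"
    by (rule biorthogonal_functionals[where \<eta> = "\<lambda>n. \<epsilon> * (1/2) ^ Suc n", OF C R not_sum pos]) blast+
  have hle: "cmod (h n y) \<le> N y" if y: "y \<in> V" for n y
  proof -
    have "1 \<le> N (x n)"
      using f(2)[OF x[of n], of n] fx by simp
    then have "cmod (h n y) * 1 \<le> cmod (h n y) * N (x n)"
      by (intro mult_left_mono) auto
    also have "\<dots> \<le> \<epsilon> * (1/2) ^ Suc n * N y"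
      using h(2)[OF y] .
    also have "\<dots> \<le> 1 * N y"
    proof (rule mult_right_mono)
      have "(1/2 :: real) ^ Suc n \<le> 1"
        by (intro power_le_one) auto
      then show "\<epsilon> * (1/2) ^ Suc n \<le> 1"
        using \<epsilon> by (intro mult_le_one) auto
    qed (use N_nonneg y in auto)
    finally show ?thesis by simp
  qed
  \<comment> \<open>\<open>z\<close> is the value at \<open>y\<close> of the small operator \<open>\<Sum>n. h n *\<^sub>C x n\<close>.\<close>
  have "\<exists>z\<in>V. N z \<le> \<epsilon> * N y \<and> (\<forall>i. f i z = h i y)" if y: "y \<in> V" for y
  proof -
    have a: "h n y *\<^sub>C x n \<in> V" for n
      using x by (rule VI(2))
    have b: "N (h n y *\<^sub>C x n) \<le> \<epsilon> * N y * (1/2) ^ Suc n" for n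
      using h(2)[OF y, of n] x by (simp add: N_scale mult_ac)
    have sm: "(\<lambda>n. \<epsilon> * N y * (1/2) ^ Suc n) sums (\<epsilon> * N y * 1)"
      by (intro sums_mult power_half_series)
    obtain z where z: "z \<in> V" "(\<lambda>n. N ((\<Sum>i<n. h i y *\<^sub>C x i) - z)) \<longlonglongrightarrow> 0"
      "N z \<le> (\<Sum>n. \<epsilon> * N y * (1/2) ^ Suc n)"
      by (rule absolutely_convergent[OF a b sums_summable[OF sm]])
    have "f i z = h i y" for i
    proof -
      have S: "(\<Sum>i<n. h i y *\<^sub>C x i) \<in> V" for n
        using a by (rule VI(6))
      have "(\<lambda>n. f i (\<Sum>i<n. h i y *\<^sub>C x i)) \<longlonglongrightarrow> f i z"
        using f(2) by (intro bounded_functional_tendsto[OF f(1), of i 1] S z) simp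
      moreover have "f i (\<Sum>i<n. h i y *\<^sub>C x i) = h i y" if "n > i" for n
      proof -
        have "f i (\<Sum>i<n. h i y *\<^sub>C x i) = (\<Sum>j<n. f i (h j y *\<^sub>C x j))"
          using a by (intro linear_functional_on_sum[OF subspace f(1)])
        also have "\<dots> = (\<Sum>j<n. if j = i then h j y else 0)"
          using linear_functional_onD(2)[OF f(1) x] fx by (intro sum.cong) auto
        finally show ?thesis using that by simp
      qed
      then have "\<forall>\<^sub>F n in sequentially. f i (\<Sum>i<n. h i y *\<^sub>C x i) = h i y"
        by (auto intro!: eventually_mono[OF eventually_gt_at_top[of i]])
      then have "(\<lambda>n. f i (\<Sum>i<n. h i y *\<^sub>C x i)) \<longlonglongrightarrow> h i y"
        by (rule tendsto_eventually)
      ultimately show ?thesis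
        by (rule LIMSEQ_unique)
    qed
    then show ?thesis
      using z sums_unique[OF sm] by auto
  qed
  then obtain p where p: "\<And>y. y \<in> V \<Longrightarrow> p y \<in> V" "\<And>y. y \<in> V \<Longrightarrow> N (p y) \<le> \<epsilon> * N y"
    "\<And>y i. y \<in> V \<Longrightarrow> f i (p y) = h i y"
    by metis
  define g where "g i y = f i y - h i y" for i y
  have g: "linear_functional_on V (g i)" for i
    using f(1)[of i] h(1)[of i]
    by (auto simp: linear_functional_on_def g_def algebra_simps)
  have gle: "cmod (g i y) \<le> 2 * N y" if "y \<in> V" for i y
    using norm_triangle_ineq4[of "f i y" "h i y"] f(2)[OF that, of i] hle[OF that, of i]
    by (simp add: g_def)
  have solve: "\<exists>w\<in>V. N (w - y) \<le> 2 * \<epsilon> * N y \<and> (\<forall>i. g i w = f i y)" if y: "y \<in> V" for y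
  proof -
    \<comment> \<open>The solution is \<open>w = y + p y + p (p y) + \<dots>\<close>, since \<open>g i\<close> telescopes along it.\<close>
    define a where "a n = (p ^^ Suc n) y" for n
    have a: "a n \<in> V" for n
      by (induction n) (auto simp: a_def y p)
    have a_Suc: "a (Suc n) = p (a n)" and a_0: "a 0 = p y" for n
      by (simp_all add: a_def)
    have b: "N (a n) \<le> \<epsilon> * N y * (1/2) ^ n" for n
    proof (induction n)
      case 0
      then show ?case using p(2)[OF y] by (simp add: a_0)
    next
      case (Suc n)
      have "N (a (Suc n)) \<le> \<epsilon> * N (a n)"
        unfolding a_Suc using a by (rule p(2))
      also have "\<dots> \<le> (1/2) * N (a n)"
        using \<epsilon> N_nonneg[OF a] by (intro mult_right_mono) auto
      finally show ?case using Suc by simp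
    qed
    have sm: "(\<lambda>n. \<epsilon> * N y * (1/2) ^ n) sums (\<epsilon> * N y * (1 / (1 - 1/2)))"
      by (intro sums_mult geometric_sums) simp
    obtain l where l: "l \<in> V" "(\<lambda>n. N (sum a {..<n} - l)) \<longlonglongrightarrow> 0"
      "N l \<le> (\<Sum>n. \<epsilon> * N y * (1/2) ^ n)"
      by (rule absolutely_convergent[OF a b sums_summable[OF sm]])
    have "g i (y + l) = f i y" for i
    proof -
      have gsum: "g i (sum a {..<n}) = h i y - f i (a n)" for n
      proof -
        have "g i (sum a {..<n}) = (\<Sum>k<n. g i (a k))"
          using a by (intro linear_functional_on_sum[OF subspace g])
        also have "\<dots> = (\<Sum>k<n. f i (a k) - f i (a (Suc k)))"
          using p(3)[OF a] by (simp add: g_def a_Suc)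
        also have "\<dots> = f i (a 0) - f i (a n)"
          using sum_lessThan_telescope'[of "\<lambda>k. f i (a k)" n] by simp
        finally show ?thesis using p(3)[OF y] by (simp add: a_0)
      qed
      have lim: "(\<lambda>n. \<epsilon> * N y * (1/2) ^ n) \<longlonglongrightarrow> 0"
        using summable_LIMSEQ_zero[OF sums_summable[OF sm]] .
      have "(\<lambda>n. f i (a n)) \<longlonglongrightarrow> 0"
        using order_trans[OF f(2)[OF a] b]
        by (intro Lim_null_comparison[OF _ lim] always_eventually allI)
      then have "(\<lambda>n. h i y - f i (a n)) \<longlonglongrightarrow> h i y - 0"
        by (intro tendsto_diff tendsto_const)
      moreover have "(\<lambda>n. g i (sum a {..<n})) \<longlonglongrightarrow> g i l"
        using a by (intro bounded_functional_tendsto[OF g gle] l VI(6))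
      ultimately have "g i l = h i y"
        unfolding gsum by (simp add: LIMSEQ_unique)
      then show ?thesis
        using linear_functional_onD(1)[OF g y l(1), of i] by (simp add: g_def)
    qed
    then show ?thesis
      using l sums_unique[OF sm] y VI by (intro bexI[of _ "y + l"]) auto
  qed
  define C' where "C' = {y \<in> V. \<forall>i. g i y = 0}"
  have C': "closed_subspace C'"
    unfolding closed_subspace_of_def
  proof (intro conjI allI impI)
    show "complex_vector.subspace C'"
      using VI linear_functional_onD[OF g] linear_functional_on_zero[OF subspace g]
      by (auto simp: complex_vector.subspace_def C'_def)
  next
    fix Y l assume "(\<forall>n. Y n \<in> C') \<and> l \<in> V \<and> (\<lambda>n. N (Y n - l)) \<longlonglongrightarrow> 0"
    then have Y: "\<And>n. Y n \<in> V" "\<And>n i. g i (Y n) = 0" and l: "l \<in> V" "(\<lambda>n. N (Y n - l)) \<longlonglongrightarrow> 0"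
      by (auto simp: C'_def)
    have "g i l = 0" for i
      using bounded_functional_tendsto[OF g gle Y(1) l, of i] Y(2) by (simp add: LIMSEQ_const_iff)
    then show "l \<in> C'"
      using l by (simp add: C'_def)
  qed (auto simp: C'_def)
  show ?thesis
  proof
    show "closed_subspace C'" by fact
    show "R \<subseteq> C'"
      using RV h(3) by (auto simp: C'_def g_def)
    obtain w where w: "\<And>j. w j \<in> V" "\<And>i j. g i (w j) = f i (x j)"
      using solve[OF x] by metis
    show "infinite_codimension C' V"
      by (rule biorthogonal_infinite_codimension[OF subspace _ g _ w(1)])
        (auto simp: C'_def w(2) fx)
    show "\<exists>c\<in>C'. \<exists>d\<in>D. y = c + d" if y: "y \<in> V" for y
    proof -
      have "\<exists>c\<in>C'. \<exists>d\<in>D. N d \<le> K * N y \<and> N (y - c - d) \<le> N y / 2" if y: "y \<in> V" for y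
      proof -
        obtain c d where c: "c \<in> C" and d: "d \<in> D"
          and Nd: "N d \<le> K * N y" and res: "N (y - c - d) \<le> N y / 4"
          using K(2)[OF y] by blast
        have cV: "c \<in> V" and dV: "d \<in> V"
          using c d CV DV by auto
        obtain c' where c': "c' \<in> V" "N (c' - c) \<le> 2 * \<epsilon> * N c" "\<And>i. g i c' = f i c"
          using solve[OF cV] by blast
        have "c = y - (y - c - d) - d" by simp
        then have "N c \<le> N (y - (y - c - d)) + N d"
          using N_diff[of "y - (y - c - d)" d] y cV dV VI by simp
        also have "N (y - (y - c - d)) \<le> N y + N (y - c - d)"
          using y cV dV by (intro N_diff VI)
        finally have "N c \<le> (2 + K) * N y"
          using Nd res N_nonneg[OF y] by (simp add: algebra_simps)
        then have "2 * \<epsilon> * N c \<le> 2 * \<epsilon> * ((2 + K) * N y)"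
          using \<epsilon> by (intro mult_left_mono) auto
        also have "\<dots> = N y / 4"
          using \<epsilon>(3) by (metis mult.assoc mult.commute times_divide_eq_right mult.right_neutral)
        finally have "N (c' - c) \<le> N y / 4"
          using c'(2) by simp
        moreover have "N ((y - c - d) - (c' - c)) \<le> N (y - c - d) + N (c' - c)"
          using y cV dV c'(1) by (intro N_diff VI)
        moreover have "(y - c - d) - (c' - c) = y - c' - d"
          by simp
        ultimately have "N (y - c' - d) \<le> N y / 2"
          using res by simp
        moreover have "c' \<in> C'"
          using c' f(3)[OF c] by (simp add: C'_def)
        ultimately show ?thesis
          using d Nd by blast
      qed
      then show ?thesis
        using exact_decomposition[OF C' D _ y] by blast
    qed
  qed
qed

end

section \<open>Powers of an isometry\<close>

locale isometry_on = banach_on V N for V :: "'v::complex_vector set" and N +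
  fixes M :: "'v \<Rightarrow> 'v"
  assumes M_mem: "x \<in> V \<Longrightarrow> M x \<in> V"
    and M_add: "x \<in> V \<Longrightarrow> y \<in> V \<Longrightarrow> M (x + y) = M x + M y"
    and M_scale: "x \<in> V \<Longrightarrow> M (a *\<^sub>C x) = a *\<^sub>C M x"
    and M_norm: "x \<in> V \<Longrightarrow> N (M x) = N x"
begin

lemma power_mem: "x \<in> V \<Longrightarrow> (M ^^ j) x \<in> V"
  by (induction j) (simp_all add: M_mem)

lemma power_add: "x \<in> V \<Longrightarrow> y \<in> V \<Longrightarrow> (M ^^ j) (x + y) = (M ^^ j) x + (M ^^ j) y"
  by (induction j) (simp_all add: M_add power_mem)

lemma power_scale: "x \<in> V \<Longrightarrow> (M ^^ j) (a *\<^sub>C x) = a *\<^sub>C (M ^^ j) x"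
  by (induction j) (simp_all add: M_scale power_mem)

lemma power_norm: "x \<in> V \<Longrightarrow> N ((M ^^ j) x) = N x"
  by (induction j) (simp_all add: M_norm power_mem)

lemma power_diff: "x \<in> V \<Longrightarrow> y \<in> V \<Longrightarrow> (M ^^ j) (x - y) = (M ^^ j) x - (M ^^ j) y"
  using power_add[of x "(- 1) *\<^sub>C y" j] power_scale[of y j "- 1"] VI by (simp add: scaleC_one)

lemma power_zero: "(M ^^ j) 0 = 0"
  using power_diff[of 0 0 j] VI by simp

lemma subspace_power_image: "complex_vector.subspace ((M ^^ j) ` V)"
  unfolding complex_vector.subspace_def
proof (intro conjI ballI allI)
  show "0 \<in> (M ^^ j) ` V"
    using power_zero VI by (metis image_eqI)
  show "a + b \<in> (M ^^ j) ` V" if "a \<in> (M ^^ j) ` V" "b \<in> (M ^^ j) ` V" for a b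
    using that VI by (auto simp flip: power_add)
  show "c *\<^sub>C a \<in> (M ^^ j) ` V" if "a \<in> (M ^^ j) ` V" for c a
    using that VI by (auto simp flip: power_scale)
qed

lemma closed_power_image: "closed_subspace ((M ^^ j) ` V)"
  unfolding closed_subspace_of_def
proof (intro conjI allI impI)
  show "complex_vector.subspace ((M ^^ j) ` V)"
    by (rule subspace_power_image)
  show "(M ^^ j) ` V \<subseteq> V"
    using power_mem by auto
next
  fix X l assume "(\<forall>n. X n \<in> (M ^^ j) ` V) \<and> l \<in> V \<and> (\<lambda>n. N (X n - l)) \<longlonglongrightarrow> 0"
  then have X: "\<And>n. X n \<in> (M ^^ j) ` V" and l: "l \<in> V" "(\<lambda>n. N (X n - l)) \<longlonglongrightarrow> 0"
    by auto
  obtain y where y: "\<And>n. y n \<in> V" "\<And>n. X n = (M ^^ j) (y n)"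
    using X unfolding image_iff by metis
  have XV: "X n \<in> V" for n
    using y power_mem by simp
  have "\<exists>K. \<forall>m\<ge>K. \<forall>n\<ge>K. N (y m - y n) < e" if e: "e > 0" for e
  proof -
    obtain K where K: "\<And>n. n \<ge> K \<Longrightarrow> \<bar>N (X n - l)\<bar> < e / 2"
      using LIMSEQ_D[OF l(2), of "e / 2"] e by auto
    have "N (y m - y n) < e" if "m \<ge> K" "n \<ge> K" for m n
    proof -
      have "N (y m - y n) = N (X m - X n)"
        using power_norm[of "y m - y n" j] power_diff[OF y(1) y(1), of j m n] y VI by simp
      also have "\<dots> \<le> N (X m - l) + N (X n - l)"
        using N_diff[of "X m - l" "X n - l"] XV l(1) VI by simp
      also have "\<dots> < e"
        using K[OF that(1)] K[OF that(2)] by linarith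
      finally show ?thesis .
    qed
    then show ?thesis by blast
  qed
  then obtain k where k: "k \<in> V" "(\<lambda>n. N (y n - k)) \<longlonglongrightarrow> 0"
    by (rule Cauchy_converges[OF y(1)])
  have "(\<lambda>n. N (X n - (M ^^ j) k)) \<longlonglongrightarrow> 0"
  proof -
    have "N (X n - (M ^^ j) k) = N (y n - k)" for n
      using power_norm[of "y n - k" j] power_diff[OF y(1) k(1), of j n] y k(1) VI by simp
    then show ?thesis using k(2) by simp
  qed
  then have "l = (M ^^ j) k"
    using k(1) by (intro limit_unique[OF XV l] power_mem)
  then show "l \<in> (M ^^ j) ` V"
    using k(1) by simp
qed

text \<open>
  This is the strict cosingularity of the map that \<^term>\<open>M\<close> induces into the quotient of
  \<^term>\<open>V\<close> by the range of \<open>M ^^ n\<close>, with the closed subspaces of that quotient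
  encoded by the closed subspaces of \<^term>\<open>V\<close> that contain the range.
\<close>

definition cosingular_mod_power :: "nat \<Rightarrow> bool" where
  "cosingular_mod_power n \<longleftrightarrow>
     (\<forall>C. closed_subspace C \<and> (M ^^ n) ` V \<subseteq> C \<and> (\<forall>y\<in>V. \<exists>c\<in>C. \<exists>d\<in>V. y = c + M d) \<longrightarrow>
        \<not> infinite_codimension C V)"

text \<open>
  This is the strict cosingularity of \<open>M ^^ n\<close> modulo \<open>M ^^ Suc n\<close>. If the sum were the
  whole space, \<^term>\<open>C\<close> would have finite codimension: pulling it back along
  \<open>M ^^ (n - 1)\<close> gives a closed subspace containing the range of \<open>M ^^ 2\<close>, to which the hypothesis applies.
\<close>

lemma power_image_not_complementary:
  assumes two: "cosingular_mod_power 2" and n: "n \<ge> 1"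
    and C: "closed_subspace C" "infinite_codimension C V" "(M ^^ Suc n) ` V \<subseteq> C"
  shows "\<exists>v\<in>V. \<forall>c\<in>C. \<forall>r\<in>(M ^^ n) ` V. v \<noteq> c + r"
proof (rule ccontr)
  assume "\<not> ?thesis"
  then have dec: "\<exists>c\<in>C. \<exists>y\<in>V. v = c + (M ^^ n) y" if "v \<in> V" for v
    using that by blast
  note CS = closed_subspaceD(1)[OF C(1)]
  obtain j where j: "n = Suc j"
    using n by (cases n) auto
  define T where "T = M ^^ j"
  have T_M: "T (M y) = (M ^^ n) y" for y
    by (simp add: T_def j funpow_swap1)
  define C1 where "C1 = {y \<in> V. T y \<in> C}"
  have "closed_subspace C1"
    unfolding closed_subspace_of_def
  proof (intro conjI allI impI)
    show "complex_vector.subspace C1"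
      using VI complex_vector.subspace_add[OF CS] complex_vector.subspace_scale[OF CS]
        complex_vector.subspace_0[OF CS]
      by (auto simp: complex_vector.subspace_def C1_def T_def power_add power_scale power_zero)
  next
    fix X l assume "(\<forall>n. X n \<in> C1) \<and> l \<in> V \<and> (\<lambda>n. N (X n - l)) \<longlonglongrightarrow> 0"
    then have X: "\<And>n. X n \<in> V" "\<And>n. T (X n) \<in> C" and l: "l \<in> V" "(\<lambda>n. N (X n - l)) \<longlonglongrightarrow> 0"
      by (auto simp: C1_def)
    have "N (T (X n) - T l) = N (X n - l)" for n
      using power_norm[of "X n - l" j] power_diff[OF X(1) l(1), of j n] X(1) l(1) VI
      by (simp add: T_def)
    then have "T l \<in> C"
      using l by (intro closed_subspaceD(3)[OF C(1) X(2)]) (simp_all add: T_def power_mem)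
    then show "l \<in> C1"
      using l by (simp add: C1_def)
  qed (auto simp: C1_def)
  moreover have "(M ^^ 2) ` V \<subseteq> C1"
  proof -
    have "T ((M ^^ 2) y) = (M ^^ Suc n) y" for y
      using T_M[of "M y"] by (simp add: numeral_2_eq_2 funpow_swap1)
    then show ?thesis
      using C(3) by (auto simp: C1_def power_mem)
  qed
  moreover have "\<exists>c\<in>C1. \<exists>d\<in>V. y = c + M d" if y: "y \<in> V" for y
  proof -
    obtain c d where cd: "c \<in> C" "d \<in> V" "T y = c + (M ^^ n) d"
      using dec[of "T y"] y power_mem by (auto simp: T_def)
    have "T (y - M d) = c"
      using cd T_M[of d] power_diff[OF y M_mem[OF cd(2)], of j] by (simp add: T_def)
    then have "y - M d \<in> C1"
      using cd y M_mem VI by (simp add: C1_def)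
    then show ?thesis
      using cd(2) by (intro bexI[of _ "y - M d"] bexI[of _ d]) auto
  qed
  ultimately have "\<not> infinite_codimension C1 V"
    using two by (auto simp: cosingular_mod_power_def)
  then obtain S where S: "finite S" "S \<subseteq> V" "V \<subseteq> complex_vector.span (S \<union> C1)"
    by (auto simp: infinite_codimension_def)
  let ?E = "complex_vector.span (T ` S \<union> C)"
  have TE: "y \<in> V \<and> T y \<in> ?E" if "y \<in> complex_vector.span (S \<union> C1)" for y
    using that
  proof (induction rule: complex_vector.span_induct)
    case base
    show ?case
      using VI by (auto simp: complex_vector.subspace_def T_def power_add power_scale power_zero
          intro: complex_vector.span_zero complex_vector.span_add complex_vector.span_scale)
  next
    case (step y)
    then show ?case
      using S(2) by (auto simp: C1_def intro: complex_vector.span_base)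
  qed
  have "V \<subseteq> ?E"
  proof
    fix v assume "v \<in> V"
    then obtain c y where cy: "c \<in> C" "y \<in> V" "v = c + T (M y)"
      using dec T_M by metis
    have "T (M y) \<in> ?E"
      using TE S(3) M_mem[OF cy(2)] by blast
    moreover have "c \<in> ?E"
      using cy(1) by (intro complex_vector.span_base) simp
    ultimately show "v \<in> ?E"
      using cy(3) complex_vector.span_add by simp
  qed
  moreover have "finite (T ` S)" "T ` S \<subseteq> V"
    using S power_mem by (auto simp: T_def)
  ultimately have "\<exists>S. finite S \<and> S \<subseteq> V \<and> V \<subseteq> complex_vector.span (S \<union> C)"
    by (intro exI[of _ "T ` S"] conjI)
  then show False
    using C(2) by (simp add: infinite_codimension_def)
qed

text \<open>
  A counterexample \<^term>\<open>C\<close> for \<open>Suc n\<close> is perturbed into one that contains the range of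
  \<open>M ^^ n\<close>, that is, into a counterexample for \<open>n\<close>.
\<close>

theorem cosingular_mod_power_induct:
  assumes two: "cosingular_mod_power 2" and n: "n \<ge> 2"
  shows "cosingular_mod_power n"
  using n
proof (induction n rule: dec_induct)
  case base
  show ?case by (rule two)
next
  case (step n)
  show ?case
    unfolding cosingular_mod_power_def
  proof (intro allI impI notI, elim conjE)
    fix C assume C: "closed_subspace C" "(M ^^ Suc n) ` V \<subseteq> C" "infinite_codimension C V"
      and sum: "\<forall>y\<in>V. \<exists>c\<in>C. \<exists>d\<in>V. y = c + M d"
    have M1: "closed_subspace (M ` V)"
      using closed_power_image[of 1] by simp
    obtain C' where C': "closed_subspace C'" "infinite_codimension C' V" "(M ^^ n) ` V \<subseteq> C'"
      "\<And>y. y \<in> V \<Longrightarrow> \<exists>c\<in>C'. \<exists>d\<in>M ` V. y = c + d"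
    proof (rule perturbed_closed_subspace[OF C(1,3) closed_power_image[of n] M1])
      show "\<exists>c\<in>C. \<exists>d\<in>M ` V. y = c + d" if "y \<in> V" for y
        using sum that by blast
      show "\<exists>v\<in>V. \<forall>c\<in>C'. \<forall>r\<in>(M ^^ n) ` V. v \<noteq> c + r"
        if "closed_subspace C'" "C \<subseteq> C'" "infinite_codimension C' V" for C'
        using that C(2) step(1) by (intro power_image_not_complementary[OF two]) auto
    qed blast
    have "\<exists>c\<in>C'. \<exists>d\<in>V. y = c + M d" if "y \<in> V" for y
      using C'(4)[OF that] by blast
    then show False
      using step.IH C'(1,2,3) by (simp add: cosingular_mod_power_def)
  qed
qed

end

section \<open>Power series with coefficients in a Banach space\<close>

lemma bounded_bilinear_scaleC:
  "bounded_bilinear (\<lambda>c. \<lambda>a::'w::complex_banach. c *\<^sub>C a)"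
proof
  show "(r *\<^sub>R c) *\<^sub>C a = r *\<^sub>R (c *\<^sub>C a)" for r c and a :: 'w
    by (simp add: scaleR_scaleC scaleC_scaleC scaleC_complex_def)
  show "c *\<^sub>C (r *\<^sub>R a) = r *\<^sub>R (c *\<^sub>C a)" for r c and a :: 'w
    by (simp add: scaleR_scaleC scaleC_scaleC mult.commute)
  show "\<exists>K. \<forall>c. \<forall>a::'w. norm (c *\<^sub>C a) \<le> cmod c * norm a * K"
    by (intro exI[of _ 1]) (simp add: norm_scaleC)
qed (simp_all add: scaleC_add_left scaleC_add_right)

lemmas bounded_linear_scaleC_left = bounded_bilinear.bounded_linear_left[OF bounded_bilinear_scaleC]
  and bounded_linear_scaleC_right = bounded_bilinear.bounded_linear_right[OF bounded_bilinear_scaleC]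

definition power_series_on ::
  "(complex \<Rightarrow> 'w::complex_banach) \<Rightarrow> complex \<Rightarrow> real \<Rightarrow> (nat \<Rightarrow> 'w) \<Rightarrow> bool" where
  "power_series_on f z r a \<longleftrightarrow> (\<forall>u\<in>ball z r. (\<lambda>n. (u - z) ^ n *\<^sub>C a n) sums f u)"

lemma power_series_onD:
  "power_series_on f z r a \<Longrightarrow> u \<in> ball z r \<Longrightarrow> (\<lambda>n. (u - z) ^ n *\<^sub>C a n) sums f u"
  by (simp add: power_series_on_def)

lemma power_series_on_subset:
  "power_series_on f z r a \<Longrightarrow> s \<le> r \<Longrightarrow> power_series_on f z s a"
  by (auto simp: power_series_on_def)

lemma power_series_on_cong:
  "(\<And>u. u \<in> ball z r \<Longrightarrow> f u = g u) \<Longrightarrow> power_series_on f z r a = power_series_on g z r a"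
  by (simp add: power_series_on_def)

lemma sums_at_centre: "(\<lambda>n. 0 ^ n *\<^sub>C (a n :: 'w::complex_banach)) sums a 0"
proof -
  have "(\<lambda>n. 0 ^ n *\<^sub>C a n) sums (\<Sum>n\<in>{0}. 0 ^ n *\<^sub>C a n)"
    by (rule sums_finite) (auto simp: power_0_left)
  then show ?thesis by (simp add: scaleC_one)
qed

lemma power_series_on_centre:
  assumes "power_series_on f z r a" "r > 0"
  shows "f z = a 0"
  using power_series_onD[OF assms(1), of z] assms(2) sums_at_centre[of a] sums_unique2 by force

lemma power_series_on_summable_norm:
  assumes f: "power_series_on f z r a" and t: "0 \<le> t" "t < r"
  shows "summable (\<lambda>n. norm (a n) * t ^ n)"
proof -
  define s where "s = (t + r) / 2"
  have s: "t < s" "s < r" "0 \<le> s"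
    using t by (auto simp: s_def)
  have "z + complex_of_real s \<in> ball z r"
    using s by (simp add: dist_norm)
  then have "summable (\<lambda>n. complex_of_real s ^ n *\<^sub>C a n)"
    using power_series_onD[OF f] sums_summable by fastforce
  then have "Bseq (\<lambda>n. complex_of_real s ^ n *\<^sub>C a n)"
    by (rule convergent_imp_Bseq[OF convergentI[OF summable_LIMSEQ_zero]])
  then obtain B where B: "\<And>n. norm (complex_of_real s ^ n *\<^sub>C a n) \<le> B"
    by (auto simp: Bseq_def)
  have "norm (a n) * s ^ n \<le> B" for n
    using B[of n] s by (simp add: norm_scaleC norm_power mult.commute)
  then show ?thesis
    by (rule Abel_lemma[OF t(1) s(1)])
qed

lemma cderiv_eq:
  assumes "(f has_derivative (\<lambda>h. h *\<^sub>C d)) (at z)"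
  shows "cderiv f z = d"
  unfolding cderiv_def
proof (rule some_equality)
  fix d' assume "(f has_derivative (\<lambda>h. h *\<^sub>C d')) (at z)"
  then have "(\<lambda>h. h *\<^sub>C d') = (\<lambda>h. h *\<^sub>C d)"
    using assms has_derivative_unique by blast
  then show "d' = d"
    by (metis scaleC_one)
qed (rule assms)

text \<open>
  The derived series converges uniformly on smaller discs, because the real series with coefficients
  \<open>norm (a n)\<close> can be differentiated termwise.
\<close>

lemma power_series_on_cderiv:
  assumes f: "power_series_on f z r a"
  shows "power_series_on (cderiv f) z r (\<lambda>n. of_nat (Suc n) *\<^sub>C a (Suc n))"
  unfolding power_series_on_def
proof
  fix u assume u: "u \<in> ball z r"
  obtain t where t: "dist z u < t" "t < r"
    using u dense by auto
  have t0: "0 \<le> t"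
    using t(1) zero_le_dist[of z u] by linarith
  define d where "d n x = (of_nat n * (x - z) ^ (n - 1)) *\<^sub>C a n" for n x
  define D where "D x = (\<Sum>n. d n x)" for x
  have "summable (\<lambda>n. diffs (\<lambda>n. norm (a n)) n * t ^ n)"
  proof (rule termdiff_converges)
    show "norm t < r"
      using t t0 by simp
    fix x :: real assume x: "norm x < r"
    have "summable (\<lambda>n. norm (a n) * \<bar>x\<bar> ^ n)"
      using x by (intro power_series_on_summable_norm[OF f]) auto
    then have "summable (\<lambda>n. norm (norm (a n) * x ^ n))"
      by (simp add: abs_mult power_abs)
    then show "summable (\<lambda>n. norm (a n) * x ^ n)"
      by (rule summable_norm_cancel)
  qed
  then have sm: "summable (\<lambda>n. of_nat n * t ^ (n - 1) * norm (a n))"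
    by (subst summable_Suc_iff[symmetric]) (simp add: diffs_def mult_ac)
  have dle: "norm (d n x) \<le> of_nat n * t ^ (n - 1) * norm (a n)" if "x \<in> ball z t" for n x
  proof -
    have "norm (x - z) ^ (n - 1) \<le> t ^ (n - 1)"
      using that by (intro power_mono) (auto simp: dist_norm norm_minus_commute)
    then show ?thesis
      by (simp add: d_def norm_scaleC norm_mult norm_power mult_left_mono mult_right_mono)
  qed
  have dsm: "summable (\<lambda>n. d n x)" if "x \<in> ball z t" for x
    using dle[OF that] by (intro summable_comparison_test'[OF sm]) auto
  have "\<exists>g. \<forall>x\<in>ball z t. (\<lambda>n. (x - z) ^ n *\<^sub>C a n) sums g x \<and>
      (g has_derivative (\<lambda>h. h *\<^sub>C D x)) (at x within ball z t)"
  proof (rule has_derivative_series)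
    show "((\<lambda>x. (x - z) ^ n *\<^sub>C a n) has_derivative (\<lambda>h. h *\<^sub>C d n x)) (at x within ball z t)" for n x
    proof -
      have "((\<lambda>x. (x - z) ^ n) has_derivative (\<lambda>h. h * (of_nat n * (x - z) ^ (n - 1))))
          (at x within ball z t)"
        by (auto intro!: derivative_eq_intros simp: mult_ac)
      from bounded_linear.has_derivative[OF bounded_linear_scaleC_left[of "a n"] this]
      show ?thesis by (simp add: d_def scaleC_scaleC)
    qed
    show "\<forall>\<^sub>F n in sequentially. \<forall>x\<in>ball z t. \<forall>h. norm ((\<Sum>i<n. h *\<^sub>C d i x) - h *\<^sub>C D x) \<le> e * norm h"
      if e: "e > 0" for e
    proof -
      have "uniform_limit (ball z t) (\<lambda>n x. \<Sum>i<n. d i x) D sequentially"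
        unfolding D_def using dle sm by (rule Weierstrass_m_test)
      then have "\<forall>\<^sub>F n in sequentially. \<forall>x\<in>ball z t. dist (\<Sum>i<n. d i x) (D x) < e"
        using e by (rule uniform_limitD)
      then show ?thesis
      proof (rule eventually_mono, intro ballI allI)
        fix n x h assume *: "\<forall>x\<in>ball z t. dist (\<Sum>i<n. d i x) (D x) < e" and "x \<in> ball z t"
        have "(\<Sum>i<n. h *\<^sub>C d i x) - h *\<^sub>C D x = h *\<^sub>C ((\<Sum>i<n. d i x) - D x)"
          by (simp add: complex_vector.scale_sum_right complex_vector.scale_right_diff_distrib)
        then have "norm ((\<Sum>i<n. h *\<^sub>C d i x) - h *\<^sub>C D x) = norm h * dist (\<Sum>i<n. d i x) (D x)"
          by (simp add: norm_scaleC dist_norm)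
        also have "\<dots> \<le> norm h * e"
          using * \<open>x \<in> ball z t\<close> by (intro mult_left_mono) (auto intro: less_imp_le)
        finally show "norm ((\<Sum>i<n. h *\<^sub>C d i x) - h *\<^sub>C D x) \<le> e * norm h"
          by (simp add: mult.commute)
      qed
    qed
    show "u \<in> ball z t"
      using t by simp
    show "(\<lambda>n. (u - z) ^ n *\<^sub>C a n) sums f u"
      using f u by (rule power_series_onD)
  qed simp
  then obtain g where g: "\<And>x. x \<in> ball z t \<Longrightarrow> (\<lambda>n. (x - z) ^ n *\<^sub>C a n) sums g x"
    "\<And>x. x \<in> ball z t \<Longrightarrow> (g has_derivative (\<lambda>h. h *\<^sub>C D x)) (at x within ball z t)"
    by blast
  have gf: "g x = f x" if "x \<in> ball z t" for x
    using g(1)[OF that] power_series_onD[OF f, of x] that t by (intro sums_unique2) auto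
  have ut: "u \<in> ball z t"
    using t by simp
  have "(g has_derivative (\<lambda>h. h *\<^sub>C D u)) (at u)"
    using g(2)[OF ut] at_within_open[OF ut] by simp
  then have "(f has_derivative (\<lambda>h. h *\<^sub>C D u)) (at u)"
    by (rule has_derivative_transform_within_open[OF _ _ ut gf]) simp
  then have "cderiv f u = D u"
    by (rule cderiv_eq)
  moreover have "(\<lambda>n. d (Suc n) u) sums D u"
  proof -
    have "(\<lambda>n. d n u) sums D u"
      unfolding D_def using dsm[OF ut] by (rule summable_sums)
    moreover have "d 0 u = 0"
      by (simp add: d_def)
    ultimately show ?thesis
      using sums_Suc_iff[of "\<lambda>n. d n u" "D u"] by simp
  qed
  ultimately show "(\<lambda>n. (u - z) ^ n *\<^sub>C (of_nat (Suc n) *\<^sub>C a (Suc n))) sums cderiv f u"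
    by (simp add: d_def scaleC_scaleC mult.commute)
qed

lemma taylor_coeff_power_series:
  assumes f: "power_series_on f z r a" and r: "r > 0"
  shows "taylor_coeff f i z = a i"
proof -
  have ps: "power_series_on ((cderiv ^^ i) f) z r (\<lambda>n. (fact (n + i) / fact n) *\<^sub>C a (n + i))"
  proof (induction i)
    case 0
    then show ?case using f by (simp add: scaleC_one)
  next
    case (Suc i)
    from power_series_on_cderiv[OF this]
    have "power_series_on ((cderiv ^^ Suc i) f) z r
        (\<lambda>n. of_nat (Suc n) *\<^sub>C ((fact (Suc n + i) / fact (Suc n)) *\<^sub>C a (Suc n + i)))"
      by simp
    moreover have "of_nat (Suc n) * (fact (Suc n + i) / fact (Suc n) :: complex)
        = fact (n + Suc i) / fact n" for n
      unfolding fact_Suc[of n] by (simp del: of_nat_Suc fact_Suc)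
    ultimately show ?case
      by (simp only: scaleC_scaleC) simp
  qed
  have "(cderiv ^^ i) f z = fact i *\<^sub>C a i"
    using power_series_on_centre[OF ps r] by simp
  then show ?thesis
    by (simp add: taylor_coeff_def scaleC_scaleC scaleC_one)
qed

lemma analytic_functions_iff:
  "f \<in> analytic_functions U \<longleftrightarrow>
     (\<forall>w. w \<notin> U \<longrightarrow> f w = 0) \<and> (\<forall>w\<in>U. \<exists>r>0. \<exists>a. power_series_on f w r a)"
  by (simp add: analytic_functions_def power_series_on_def)

lemma analytic_functions_power_series:
  assumes "f \<in> analytic_functions U" "z \<in> U"
  obtains r where "r > 0" "power_series_on f z r (\<lambda>i. taylor_coeff f i z)"
proof -
  obtain r a where r: "r > 0" "power_series_on f z r a"
    using assms by (auto simp: analytic_functions_iff)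
  moreover have "(\<lambda>i. taylor_coeff f i z) = a"
    using taylor_coeff_power_series[OF r(2,1)] by auto
  ultimately show ?thesis
    using that by auto
qed

lemma taylor_coeff_add:
  assumes f: "f \<in> analytic_functions U" and g: "g \<in> analytic_functions U" and z: "z \<in> U"
  shows "taylor_coeff (f + g) i z = taylor_coeff f i z + taylor_coeff g i z"
proof -
  obtain r where r: "r > 0" "power_series_on f z r (\<lambda>i. taylor_coeff f i z)"
    using analytic_functions_power_series[OF f z] .
  obtain s where s: "s > 0" "power_series_on g z s (\<lambda>i. taylor_coeff g i z)"
    using analytic_functions_power_series[OF g z] .
  have "power_series_on (f + g) z (min r s) (\<lambda>i. taylor_coeff f i z + taylor_coeff g i z)"
    using power_series_onD[OF r(2)] power_series_onD[OF s(2)]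
    by (auto simp: power_series_on_def scaleC_add_right intro!: sums_add)
  then show ?thesis
    by (rule taylor_coeff_power_series) (use r s in simp)
qed

lemma taylor_coeff_scale:
  assumes f: "f \<in> analytic_functions U" and z: "z \<in> U"
  shows "taylor_coeff (c *\<^sub>C f) i z = c *\<^sub>C taylor_coeff f i z"
proof -
  obtain r where r: "r > 0" "power_series_on f z r (\<lambda>i. taylor_coeff f i z)"
    using analytic_functions_power_series[OF f z] .
  have "power_series_on (c *\<^sub>C f) z r (\<lambda>i. c *\<^sub>C taylor_coeff f i z)"
    unfolding power_series_on_def
  proof
    fix u assume "u \<in> ball z r"
    from bounded_linear.sums[OF bounded_linear_scaleC_right power_series_onD[OF r(2) this], of c]
    show "(\<lambda>n. (u - z) ^ n *\<^sub>C c *\<^sub>C taylor_coeff f n z) sums (c *\<^sub>C f) u"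
      by (simp add: scaleC_scaleC mult.commute scaleC_fun_def)
  qed
  then show ?thesis
    using r(1) by (rule taylor_coeff_power_series)
qed

text \<open>
  Partial sums of the Cauchy product and products of partial sums differ by a sum over the pairs
  \<open>(i, j)\<close> with \<open>i, j < n \<le> i + j\<close>, which is dominated by the same difference for the norms.
\<close>

lemma Cauchy_product_scaleC:
  fixes a :: "nat \<Rightarrow> 'w::complex_banach" and b :: "nat \<Rightarrow> complex"
  assumes b: "summable (\<lambda>n. cmod (b n))" and a: "summable (\<lambda>n. norm (a n))"
  shows "(\<lambda>n. \<Sum>i\<le>n. b i *\<^sub>C a (n - i)) sums ((\<Sum>n. b n) *\<^sub>C (\<Sum>n. a n))"
proof -
  define S1 where "S1 n = {..<n} \<times> {..<n}" for n :: nat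
  define S2 where "S2 n = {(i, j). i + j < n}" for n :: nat
  have sub: "S2 n \<subseteq> S1 n" "finite (S1 n)" for n
    by (auto simp: S1_def S2_def)
  let ?g = "\<lambda>(i, j). b i *\<^sub>C a j"
  let ?f = "\<lambda>(i, j). cmod (b i) * norm (a j)"
  have f1: "sum ?f (S1 n) = (\<Sum>i<n. cmod (b i)) * (\<Sum>j<n. norm (a j))" for n
    by (simp add: S1_def sum_product sum.Sigma)
  have g1: "sum ?g (S1 n) = (\<Sum>i<n. b i) *\<^sub>C (\<Sum>j<n. a j)" for n
    by (simp only: S1_def complex_vector.scale_sum_left)
      (simp only: complex_vector.scale_sum_right sum.cartesian_product)
  have f2: "sum ?f (S2 n) = (\<Sum>k<n. \<Sum>i\<le>k. cmod (b i) * norm (a (k - i)))" for n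
    unfolding S2_def by (rule sum.triangle_reindex)
  have g2: "sum ?g (S2 n) = (\<Sum>k<n. \<Sum>i\<le>k. b i *\<^sub>C a (k - i))" for n
    unfolding S2_def by (rule sum.triangle_reindex)
  have "(\<lambda>n. sum ?f (S1 n) - sum ?f (S2 n)) \<longlonglongrightarrow>
      (\<Sum>n. cmod (b n)) * (\<Sum>n. norm (a n)) - (\<Sum>n. cmod (b n)) * (\<Sum>n. norm (a n))"
  proof (rule tendsto_diff)
    show "(\<lambda>n. sum ?f (S1 n)) \<longlonglongrightarrow> (\<Sum>n. cmod (b n)) * (\<Sum>n. norm (a n))"
      unfolding f1 using a b by (intro tendsto_mult summable_LIMSEQ)
    show "(\<lambda>n. sum ?f (S2 n)) \<longlonglongrightarrow> (\<Sum>n. cmod (b n)) * (\<Sum>n. norm (a n))"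
      unfolding f2 using Cauchy_product_sums[of "\<lambda>n. cmod (b n)" "\<lambda>n. norm (a n)"] a b
      by (simp add: sums_def)
  qed
  then have lim: "(\<lambda>n. sum ?f (S1 n) - sum ?f (S2 n)) \<longlonglongrightarrow> 0"
    by simp
  have le: "norm (sum ?g (S2 n) - sum ?g (S1 n)) \<le> sum ?f (S1 n) - sum ?f (S2 n)" for n
  proof -
    have "norm (sum ?g (S2 n) - sum ?g (S1 n)) = norm (sum ?g (S1 n - S2 n))"
      using sub[of n] by (simp add: sum_diff norm_minus_commute)
    also have "\<dots> \<le> sum ?f (S1 n - S2 n)"
      by (rule sum_norm_le) (auto simp: norm_scaleC)
    also have "\<dots> = sum ?f (S1 n) - sum ?f (S2 n)"
      using sub[of n] by (simp add: sum_diff)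
    finally show ?thesis .
  qed
  have "(\<lambda>n. sum ?g (S2 n) - sum ?g (S1 n)) \<longlonglongrightarrow> 0"
    using le by (intro Lim_null_comparison[OF _ lim] always_eventually allI)
  moreover have "(\<lambda>n. sum ?g (S1 n)) \<longlonglongrightarrow> (\<Sum>n. b n) *\<^sub>C (\<Sum>n. a n)"
    unfolding g1
    by (intro bounded_bilinear.tendsto[OF bounded_bilinear_scaleC] summable_LIMSEQ
        summable_norm_cancel[OF a] summable_norm_cancel[OF b])
  ultimately have "(\<lambda>n. sum ?g (S2 n)) \<longlonglongrightarrow> (\<Sum>n. b n) *\<^sub>C (\<Sum>n. a n)"
    by (rule Lim_transform[rotated])
  then show ?thesis
    unfolding g2 sums_def .
qed

lemma power_series_on_mult:
  assumes h: "h holomorphic_on ball z r" and f: "power_series_on f z r a"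
  shows "power_series_on (\<lambda>u. h u *\<^sub>C f u) z r
    (\<lambda>n. \<Sum>i\<le>n. fps_nth (fps_expansion h z) i *\<^sub>C a (n - i))"
  unfolding power_series_on_def
proof
  fix u assume u: "u \<in> ball z r"
  define b where "b i = fps_nth (fps_expansion h z) i" for i
  have bser: "power_series_on h z r b"
    using holomorphic_power_series[OF h]
    by (simp add: power_series_on_def b_def fps_expansion_def scaleC_complex_def mult.commute)
  have t: "0 \<le> dist z u" "dist z u < r"
    using u by auto
  have norm: "cmod (u - z) = dist z u"
    by (simp add: dist_norm norm_minus_commute)
  have "summable (\<lambda>n. cmod ((u - z) ^ n * b n))"
    using power_series_on_summable_norm[OF bser t] by (simp add: norm_mult norm_power norm mult.commute)
  moreover have "summable (\<lambda>n. norm ((u - z) ^ n *\<^sub>C a n))"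
    using power_series_on_summable_norm[OF f t] by (simp add: norm_scaleC norm_power norm mult.commute)
  ultimately have "(\<lambda>n. \<Sum>i\<le>n. ((u - z) ^ i * b i) *\<^sub>C ((u - z) ^ (n - i) *\<^sub>C a (n - i))) sums
      ((\<Sum>n. (u - z) ^ n * b n) *\<^sub>C (\<Sum>n. (u - z) ^ n *\<^sub>C a n))"
    by (rule Cauchy_product_scaleC)
  moreover have "(\<Sum>n. (u - z) ^ n * b n) = h u"
    using power_series_onD[OF bser u] by (simp add: scaleC_complex_def sums_iff)
  moreover have "(\<Sum>n. (u - z) ^ n *\<^sub>C a n) = f u"
    using power_series_onD[OF f u] by (simp add: sums_iff)
  moreover have "(\<Sum>i\<le>n. ((u - z) ^ i * b i) *\<^sub>C ((u - z) ^ (n - i) *\<^sub>C a (n - i)))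
      = (u - z) ^ n *\<^sub>C (\<Sum>i\<le>n. b i *\<^sub>C a (n - i))" for n
    unfolding complex_vector.scale_sum_right scaleC_scaleC
    by (intro sum.cong) (auto simp: mult_ac simp flip: power_add)
  ultimately show "(\<lambda>n. (u - z) ^ n *\<^sub>C (\<Sum>i\<le>n. fps_nth (fps_expansion h z) i *\<^sub>C a (n - i)))
      sums (h u *\<^sub>C f u)"
    by (simp add: b_def)
qed

lemma taylor_coeff_mult:
  assumes U: "open U" and h: "h holomorphic_on U" and f: "f \<in> analytic_functions U" and z: "z \<in> U"
  shows "taylor_coeff (\<lambda>u. h u *\<^sub>C f u) n z
    = (\<Sum>i\<le>n. fps_nth (fps_expansion h z) i *\<^sub>C taylor_coeff f (n - i) z)"
proof -
  obtain r where r: "r > 0" "power_series_on f z r (\<lambda>i. taylor_coeff f i z)"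
    using analytic_functions_power_series[OF f z] .
  obtain s where s: "s > 0" "ball z s \<subseteq> U"
    using U z openE by blast
  have "power_series_on (\<lambda>u. h u *\<^sub>C f u) z (min r s)
      (\<lambda>n. \<Sum>i\<le>n. fps_nth (fps_expansion h z) i *\<^sub>C taylor_coeff f (n - i) z)"
    using s by (intro power_series_on_mult holomorphic_on_subset[OF h]
        power_series_on_subset[OF r(2)]) auto
  then show ?thesis
    by (rule taylor_coeff_power_series) (use r s in simp)
qed

text \<open>
  Away from \<^term>\<open>z\<close> the quotient is a product with \<open>1 / \<phi>\<close>; at \<^term>\<open>z\<close> the common
  factor \<open>u - z\<close> is split off from both functions.
\<close>

lemma analytic_functions_divide:
  assumes U: "open U" and \<phi>: "\<phi> holomorphic_on U" "inj_on \<phi> U" and z: "z \<in> U" "\<phi> z = 0"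
    and f: "f \<in> analytic_functions U" "f z = 0"
  obtains g where "g \<in> analytic_functions U" "f = (\<lambda>w. \<phi> w *\<^sub>C g w)"
proof -
  have reg: "deriv \<phi> z \<noteq> 0"
    using holomorphic_injective_imp_regular[OF \<phi>(1) U \<phi>(2) z(1)] .
  have nz: "\<phi> w \<noteq> 0" if "w \<in> U" "w \<noteq> z" for w
    using that z inj_onD[OF \<phi>(2), of w z] by auto
  define \<phi>1 where "\<phi>1 = (\<lambda>w. if w = z then deriv \<phi> z else \<phi> w / (w - z))"
  have \<phi>1: "\<phi>1 holomorphic_on U"
    using pole_lemma_open[OF \<phi>(1) U, of z] unfolding \<phi>1_def z(2) diff_zero .
  have \<phi>1_nz: "\<phi>1 w \<noteq> 0" if "w \<in> U" for w
    using reg nz[OF that] by (simp add: \<phi>1_def)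
  define a where "a i = taylor_coeff f i z" for i
  define g where "g = (\<lambda>w. if w = z then (1 / deriv \<phi> z) *\<^sub>C a 1 else (1 / \<phi> w) *\<^sub>C f w)"
  have "\<exists>r>0. \<exists>a. power_series_on g w r a" if w: "w \<in> U" for w
  proof (cases "w = z")
    case False
    have "open (U - {z})"
      using U by (intro open_Diff) auto
    then obtain s where s: "s > 0" "ball w s \<subseteq> U - {z}"
      using w False openE by blast
    obtain r where r: "r > 0" "power_series_on f w r (\<lambda>i. taylor_coeff f i w)"
      using analytic_functions_power_series[OF f(1) w] .
    have "ball w (min r s) \<subseteq> U - {z}"
      using s by auto
    then have su: "u \<in> U" "\<phi> u \<noteq> 0" if "u \<in> ball w (min r s)" for u
      using nz[of u] that by blast+
    have "(\<lambda>u. 1 / \<phi> u) holomorphic_on ball w (min r s)"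
      using su by (intro holomorphic_intros holomorphic_on_subset[OF \<phi>(1)]) auto
    then have "power_series_on (\<lambda>u. (1 / \<phi> u) *\<^sub>C f u) w (min r s)
        (\<lambda>n. \<Sum>i\<le>n. fps_nth (fps_expansion (\<lambda>u. 1 / \<phi> u) w) i *\<^sub>C taylor_coeff f (n - i) w)"
      by (intro power_series_on_mult power_series_on_subset[OF r(2)]) auto
    then have "power_series_on g w (min r s)
        (\<lambda>n. \<Sum>i\<le>n. fps_nth (fps_expansion (\<lambda>u. 1 / \<phi> u) w) i *\<^sub>C taylor_coeff f (n - i) w)"
      using s by (subst power_series_on_cong[where g = "\<lambda>u. (1 / \<phi> u) *\<^sub>C f u"]) (auto simp: g_def)
    moreover have "min r s > 0"
      using r s by simp
    ultimately show ?thesis by blast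
  next
    case True
    obtain r where r: "r > 0" "power_series_on f z r a"
      using analytic_functions_power_series[OF f(1) z(1)] unfolding a_def .
    obtain s where s: "s > 0" "ball z s \<subseteq> U"
      using U z openE by blast
    have a0: "a 0 = 0"
      using power_series_on_centre[OF r(2,1)] f(2) by simp
    define f1 where "f1 u = (if u = z then a 1 else (1 / (u - z)) *\<^sub>C f u)" for u
    have "power_series_on f1 z r (\<lambda>n. a (Suc n))"
      unfolding power_series_on_def
    proof
      fix u assume u: "u \<in> ball z r"
      show "(\<lambda>n. (u - z) ^ n *\<^sub>C a (Suc n)) sums f1 u"
      proof (cases "u = z")
        case True
        then show ?thesis
          using sums_at_centre[of "\<lambda>n. a (Suc n)"] by (simp add: f1_def)
      next
        case False
        have "(\<lambda>n. (u - z) ^ Suc n *\<^sub>C a (Suc n)) sums f u"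
          using power_series_onD[OF r(2) u] a0
            sums_Suc_iff[of "\<lambda>n. (u - z) ^ n *\<^sub>C a n" "f u"] by simp
        from bounded_linear.sums[OF bounded_linear_scaleC_right this, of "1 / (u - z)"]
        show ?thesis
          using False by (simp add: f1_def scaleC_scaleC)
      qed
    qed
    then have "power_series_on f1 z (min r s) (\<lambda>n. a (Suc n))"
      by (rule power_series_on_subset) simp
    moreover have "(\<lambda>u. 1 / \<phi>1 u) holomorphic_on ball z (min r s)"
      using s \<phi>1_nz by (intro holomorphic_intros holomorphic_on_subset[OF \<phi>1]) auto
    ultimately have "power_series_on (\<lambda>u. (1 / \<phi>1 u) *\<^sub>C f1 u) z (min r s)
        (\<lambda>n. \<Sum>i\<le>n. fps_nth (fps_expansion (\<lambda>u. 1 / \<phi>1 u) z) i *\<^sub>C a (Suc (n - i)))"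
      by (intro power_series_on_mult)
    moreover have "g u = (1 / \<phi>1 u) *\<^sub>C f1 u" for u
      by (simp add: g_def \<phi>1_def f1_def scaleC_scaleC)
    then have "g = (\<lambda>u. (1 / \<phi>1 u) *\<^sub>C f1 u)"
      by (rule ext)
    moreover have "min r s > 0"
      using r s by simp
    ultimately show ?thesis
      using True by blast
  qed
  moreover have "g w = 0" if "w \<notin> U" for w
    using that f(1) z by (auto simp: g_def analytic_functions_iff)
  ultimately have "g \<in> analytic_functions U"
    by (simp add: analytic_functions_iff)
  moreover have "f w = \<phi> w *\<^sub>C g w" for w
  proof (cases "w \<in> U")
    case True
    then show ?thesis
      using nz[OF True] z(2) f(2) by (simp add: g_def scaleC_scaleC scaleC_one)
  next
    case False
    then show ?thesis
      using f(1) z by (auto simp: g_def analytic_functions_iff)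
  qed
  then have "f = (\<lambda>w. \<phi> w *\<^sub>C g w)"
    by (rule ext)
  ultimately show ?thesis
    by (rule that)
qed

section \<open>Multiplication by a conformal map and Taylor coefficients\<close>

lemma quotient_map_surj_iff:
  assumes C: "complex_vector.subspace C" and u: "\<And>a. a \<in> A \<Longrightarrow> u a \<in> B"
  shows "(quotient_map B C \<circ> u) ` A = quotient_space B C \<longleftrightarrow> (\<forall>b\<in>B. \<exists>a\<in>A. b - u a \<in> C)"
proof
  assume eq: "(quotient_map B C \<circ> u) ` A = quotient_space B C"
  show "\<forall>b\<in>B. \<exists>a\<in>A. b - u a \<in> C"
  proof
    fix b assume b: "b \<in> B"
    then have "quotient_map B C b \<in> quotient_space B C"
      by (auto simp: quotient_map_def quotient_space_def quotient_def)
    then obtain a where a: "a \<in> A" "quotient_map B C b = quotient_map B C (u a)"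
      unfolding eq[symmetric] by auto
    have "u a \<in> quotient_map B C (u a)"
      using u[OF a(1)] complex_vector.subspace_0[OF C] by (simp add: quotient_map_def cong_mod_def)
    then have "u a \<in> quotient_map B C b"
      using a(2) by simp
    then show "\<exists>a\<in>A. b - u a \<in> C"
      using a(1) by (auto simp: quotient_map_def cong_mod_def)
  qed
next
  assume dec: "\<forall>b\<in>B. \<exists>a\<in>A. b - u a \<in> C"
  have "quotient_map B C b \<in> (quotient_map B C \<circ> u) ` A" if b: "b \<in> B" for b
  proof -
    obtain a where a: "a \<in> A" "b - u a \<in> C"
      using dec b by blast
    have "b - y \<in> C \<longleftrightarrow> u a - y \<in> C" for y
    proof -
      have "b - y = (b - u a) + (u a - y)" "u a - y = (b - y) - (b - u a)"
        by simp_all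
      then show ?thesis
        using a(2) complex_vector.subspace_add[OF C] complex_vector.subspace_diff[OF C] by metis
    qed
    then have "quotient_map B C b = quotient_map B C (u a)"
      using b u[OF a(1)] by (auto simp: quotient_map_def cong_mod_def)
    then show ?thesis
      using a(1) by auto
  qed
  moreover have "quotient_space B C = quotient_map B C ` B"
    by (auto simp: quotient_map_def quotient_space_def quotient_def)
  ultimately show "(quotient_map B C \<circ> u) ` A = quotient_space B C"
    using u by auto
qed

lemma sum_fun_apply: "(\<Sum>i\<in>I. f i) w = (\<Sum>i\<in>I. f i w)"
  for f :: "'i \<Rightarrow> 'a \<Rightarrow> 'b::comm_monoid_add"
  by (induction I rule: infinite_finite_induct) auto

lemma conformal_equivalence_normalise:
  assumes \<phi>: "conformal_equivalence \<phi> U (ball 0 1)" and z: "z \<in> U"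
  obtains \<theta> where "conformal_equivalence \<theta> U (ball 0 1)" "\<theta> z = 0"
proof -
  obtain \<psi> where \<psi>: "\<psi> holomorphic_on ball 0 1" "\<And>w. w \<in> U \<Longrightarrow> \<phi> w \<in> ball 0 1"
    "\<And>w. w \<in> U \<Longrightarrow> \<psi> (\<phi> w) = w" "\<And>w. w \<in> ball 0 1 \<Longrightarrow> \<psi> w \<in> U"
    "\<And>w. w \<in> ball 0 1 \<Longrightarrow> \<phi> (\<psi> w) = w" and hol: "\<phi> holomorphic_on U"
    using \<phi> unfolding conformal_equivalence_def by blast
  obtain f g where fg: "f (\<phi> z) = 0" "f holomorphic_on ball 0 1" "f ` ball 0 1 \<subseteq> ball 0 1"
    "g holomorphic_on ball 0 1" "g ` ball 0 1 \<subseteq> ball 0 1"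
    "\<And>w. w \<in> ball 0 1 \<Longrightarrow> f (g w) = w" "\<And>w. w \<in> ball 0 1 \<Longrightarrow> g (f w) = w"
    using ball_biholomorphism_exists[OF \<psi>(2)[OF z]] by blast
  have fm: "f w \<in> ball 0 1" and gm: "g w \<in> ball 0 1" if "w \<in> ball 0 1" for w
    using fg(3,5) that by blast+
  have "conformal_equivalence (f \<circ> \<phi>) U (ball 0 1)"
    unfolding conformal_equivalence_def
  proof (intro conjI exI[of _ "\<psi> \<circ> g"] ballI)
    show "f \<circ> \<phi> holomorphic_on U"
      using \<psi>(2) by (intro holomorphic_on_compose hol holomorphic_on_subset[OF fg(2)] image_subsetI)
    show "\<psi> \<circ> g holomorphic_on ball 0 1"
      using gm by (intro holomorphic_on_compose fg holomorphic_on_subset[OF \<psi>(1)] image_subsetI)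
  next
    fix w assume "w \<in> U"
    then show "(f \<circ> \<phi>) w \<in> ball 0 1" "(\<psi> \<circ> g) ((f \<circ> \<phi>) w) = w"
      using fm \<psi>(2,3) fg(7) by simp_all
  next
    fix w :: complex assume "w \<in> ball 0 1"
    then show "(\<psi> \<circ> g) w \<in> U" "(f \<circ> \<phi>) ((\<psi> \<circ> g) w) = w"
      using gm \<psi>(4,5) fg(6) by simp_all
  qed
  then show ?thesis
    using fg(1) by (intro that[of "f \<circ> \<phi>"]) simp_all
qed

text \<open>
  With \<open>\<phi> z = 0\<close>, multiplication by \<^term>\<open>\<phi>\<close> is an isometry of \<^term>\<open>\<F>\<close> whose
  \<open>n\<close>-th power has as its range the functions with vanishing Taylor coefficients below \<open>n\<close>.
\<close>

locale admissible_at =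
  fixes U :: "complex set" and \<F> :: "(complex \<Rightarrow> 'w::complex_banach) set"
    and N :: "(complex \<Rightarrow> 'w) \<Rightarrow> real" and z :: complex and \<phi> :: "complex \<Rightarrow> complex"
  assumes U: "open U" and adm: "admissible U \<F> N" and z: "z \<in> U"
    and conf: "conformal_equivalence \<phi> U (ball 0 1)" and \<phi>_z: "\<phi> z = 0"
begin

definition mult :: "(complex \<Rightarrow> 'w) \<Rightarrow> complex \<Rightarrow> 'w" where
  "mult f = (\<lambda>w. \<phi> w *\<^sub>C f w)"

lemma analytic: "f \<in> \<F> \<Longrightarrow> f \<in> analytic_functions U"
  using adm by (auto simp: admissible_def)

lemma mult_mem_iff: "f \<in> analytic_functions U \<Longrightarrow> mult f \<in> \<F> \<longleftrightarrow> f \<in> \<F>"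
  using adm conf unfolding admissible_def mult_def by blast

sublocale isometry_on \<F> N mult
proof
  show "banach_space_on \<F> N"
    using adm by (simp add: admissible_def)
  show "mult f \<in> \<F>" if "f \<in> \<F>" for f
    using mult_mem_iff analytic that by blast
  show "mult (f + g) = mult f + mult g" for f g
    by (simp add: mult_def fun_eq_iff scaleC_add_right)
  show "mult (c *\<^sub>C f) = c *\<^sub>C mult f" for c f
    by (simp add: mult_def fun_eq_iff scaleC_fun_def scaleC_scaleC mult.commute)
  show "N (mult f) = N f" if "f \<in> \<F>" for f
    using adm conf analytic[OF that] that unfolding admissible_def mult_def by blast
qed

lemma \<phi>_holomorphic: "\<phi> holomorphic_on U"
  using conf by (simp add: conformal_equivalence_def)

lemma \<phi>_inj: "inj_on \<phi> U"
  using conf unfolding conformal_equivalence_def inj_on_def by metis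

abbreviation coeff :: "(complex \<Rightarrow> 'w) \<Rightarrow> nat \<Rightarrow> 'w" where
  "coeff f i \<equiv> taylor_coeff f i z"

abbreviation b :: "complex fps" where
  "b \<equiv> fps_expansion \<phi> z"

lemma b_0: "fps_nth b 0 = 0"
  by (simp add: fps_expansion_def \<phi>_z)

lemma b_1: "fps_nth b 1 \<noteq> 0"
  using holomorphic_injective_imp_regular[OF \<phi>_holomorphic U \<phi>_inj z] by (simp add: fps_expansion_def)

lemma fps_expansion_poly:
  "fps_expansion (\<lambda>w. \<Sum>i\<in>I. a i * \<phi> w ^ i) z = (\<Sum>i\<in>I. fps_const (a i) * b ^ i)"
proof (rule fps_expansion_unique_complex)
  have \<phi>: "\<phi> analytic_on {z}"
    using \<phi>_holomorphic U z analytic_at by blast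
  have exp: "(\<lambda>x. \<phi> (z + x)) has_fps_expansion b"
    by (rule analytic_at_imp_has_fps_expansion[OF \<phi>])
  show "(\<lambda>x. \<Sum>i\<in>I. a i * \<phi> (z + x) ^ i) has_fps_expansion (\<Sum>i\<in>I. fps_const (a i) * b ^ i)"
  proof (induction I rule: infinite_finite_induct)
    case (insert i I)
    then show ?case
      by (simp del: sum.lessThan_Suc) (intro fps_expansion_intros exp)
  qed simp_all
  show "(\<lambda>x. \<Sum>i\<in>I. a i * \<phi> (z + x) ^ i) has_fps_expansion
      fps_expansion (\<lambda>w. \<Sum>i\<in>I. a i * \<phi> w ^ i) z"
    by (rule analytic_at_imp_has_fps_expansion) (intro analytic_intros \<phi>)
qed

lemma power_mult_eq: "(mult ^^ j) f = (\<lambda>w. \<phi> w ^ j *\<^sub>C f w)"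
  by (induction j) (simp_all add: mult_def scaleC_scaleC scaleC_one)

lemma poly_mult_eq:
  "(\<Sum>i\<in>I. a i *\<^sub>C (mult ^^ i) f) = (\<lambda>w. (\<Sum>i\<in>I. a i * \<phi> w ^ i) *\<^sub>C f w)"
  by (simp add: fun_eq_iff sum_fun_apply power_mult_eq scaleC_fun_def scaleC_scaleC
      complex_vector.scale_sum_left)

lemma coeff_poly_mult:
  assumes f: "f \<in> \<F>"
  shows "coeff (\<Sum>i\<in>I. a i *\<^sub>C (mult ^^ i) f) m
    = (\<Sum>j\<le>m. (\<Sum>i\<in>I. a i * fps_nth (b ^ i) j) *\<^sub>C coeff f (m - j))"
proof -
  have "(\<lambda>w. \<Sum>i\<in>I. a i * \<phi> w ^ i) holomorphic_on U"
    by (intro holomorphic_intros \<phi>_holomorphic)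
  from taylor_coeff_mult[OF U this analytic[OF f] z, of m]
  show ?thesis
    by (simp add: poly_mult_eq fps_expansion_poly fps_sum_nth)
qed

lemma coeff_power_mult:
  assumes "f \<in> \<F>"
  shows "coeff ((mult ^^ n) f) m = (\<Sum>j\<le>m. fps_nth (b ^ n) j *\<^sub>C coeff f (m - j))"
  using coeff_poly_mult[OF assms, of "\<lambda>_. 1" "{n}" m] by (simp add: scaleC_one)

lemma coeff_power_mult_eq_0:
  assumes "f \<in> \<F>" "m < n"
  shows "coeff ((mult ^^ n) f) m = 0"
  using startsby_zero_power_prefix[OF b_0, of n] assms(2)
  by (auto simp: coeff_power_mult[OF assms(1)] intro!: sum.neutral)

text \<open>
  Each vanishing coefficient allows one division by \<^term>\<open>\<phi>\<close>; the quotient is analytic,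
  and admissibility keeps it in \<^term>\<open>\<F>\<close>.
\<close>

lemma power_image_if_coeff_eq_0:
  assumes "f \<in> \<F>" "\<And>i. i < n \<Longrightarrow> coeff f i = 0"
  shows "f \<in> (mult ^^ n) ` \<F>"
  using assms
proof (induction n arbitrary: f)
  case (Suc n)
  have "f z = coeff f 0"
    by (simp add: taylor_coeff_def scaleC_one)
  then have "f z = 0"
    using Suc.prems by simp
  then obtain g where g: "g \<in> analytic_functions U" "f = mult g"
    using analytic_functions_divide[OF U \<phi>_holomorphic \<phi>_inj z \<phi>_z analytic[OF Suc.prems(1)]]
    unfolding mult_def by metis
  have gF: "g \<in> \<F>"
    using mult_mem_iff[OF g(1)] g(2) Suc.prems(1) by simp
  have "coeff g i = 0" if "i < n" for i
    using that
  proof (induction i rule: less_induct)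
    case (less i)
    have "0 = coeff ((mult ^^ 1) g) (Suc i)"
      using Suc.prems(2)[of "Suc i"] g(2) less.prems by simp
    also have "\<dots> = (\<Sum>j\<le>Suc i. fps_nth b j *\<^sub>C coeff g (Suc i - j))"
      using coeff_power_mult[OF gF, of 1] by simp
    also have "\<dots> = (\<Sum>j\<in>{1}. fps_nth b j *\<^sub>C coeff g (Suc i - j))"
    proof (intro sum.mono_neutral_right ballI)
      fix j assume j: "j \<in> {..Suc i} - {1}"
      show "fps_nth b j *\<^sub>C coeff g (Suc i - j) = 0"
      proof (cases "j = 0")
        case True
        then show ?thesis by (simp add: b_0)
      next
        case False
        then have "coeff g (Suc i - j) = 0"
          using j less by (intro less.IH) auto
        then show ?thesis by simp
      qed
    qed auto
    finally show ?case
      using b_1 by simp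
  qed
  then have "g \<in> (mult ^^ n) ` \<F>"
    using gF by (intro Suc.IH)
  then show ?case
    using g(2) by auto
qed simp

definition coeffs :: "nat \<Rightarrow> (complex \<Rightarrow> 'w) \<Rightarrow> nat \<Rightarrow> 'w" where
  "coeffs n f = (\<lambda>i. if i < n then coeff f i else 0)"

abbreviation X :: "nat \<Rightarrow> (nat \<Rightarrow> 'w) set" where
  "X \<equiv> coeff_space \<F> z"

abbreviation NX :: "nat \<Rightarrow> (nat \<Rightarrow> 'w) \<Rightarrow> real" where
  "NX \<equiv> coeff_norm \<F> N z"

lemma coeffs_add: "f \<in> \<F> \<Longrightarrow> g \<in> \<F> \<Longrightarrow> coeffs n (f + g) = coeffs n f + coeffs n g"
  using taylor_coeff_add[OF analytic analytic z] by (simp add: coeffs_def fun_eq_iff del: plus_fun_apply)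
    (simp add: plus_fun_def)

lemma coeffs_scale: "f \<in> \<F> \<Longrightarrow> coeffs n (c *\<^sub>C f) = c *\<^sub>C coeffs n f"
  using taylor_coeff_scale[OF analytic z, of f c] by (auto simp: coeffs_def fun_eq_iff scaleC_fun_def)

lemma coeffs_diff: "f \<in> \<F> \<Longrightarrow> g \<in> \<F> \<Longrightarrow> coeffs n (f - g) = coeffs n f - coeffs n g"
  using coeffs_add[of f "(- 1) *\<^sub>C g" n] coeffs_scale[of g n "- 1"] VI by (simp add: scaleC_one)

lemma coeffs_zero: "coeffs n 0 = 0"
  using coeffs_diff[of 0 0 n] VI by simp

lemma coeffs_eq_iff: "(\<forall>i<n. x i = coeff f i) \<longleftrightarrow> x = coeffs n f" if "\<forall>i\<ge>n. x i = 0"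
  using that by (auto simp: coeffs_def fun_eq_iff not_less)

lemma coeff_space_eq: "X n = coeffs n ` \<F>"
proof (intro equalityI subsetI)
  show "x \<in> coeffs n ` \<F>" if "x \<in> X n" for x
    using that coeffs_eq_iff by (auto simp: coeff_space_def)
qed (auto simp: coeff_space_def coeffs_def)

lemma coeff_norm_eq: "x \<in> X n \<Longrightarrow> NX n x = Inf (N ` {f \<in> \<F>. coeffs n f = x})"
  unfolding coeff_norm_def
  by (rule arg_cong[where f = Inf]) (auto simp: coeff_space_def coeffs_eq_iff image_def)

lemma coeff_norm_le: "f \<in> \<F> \<Longrightarrow> NX n (coeffs n f) \<le> N f"
  by (auto simp: coeff_norm_eq coeff_space_eq intro!: cInf_lower bdd_belowI2[of _ 0] N_nonneg)

lemma coeff_norm_greatest: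
  assumes "x \<in> X n" "\<And>f. f \<in> \<F> \<Longrightarrow> coeffs n f = x \<Longrightarrow> m \<le> N f"
  shows "m \<le> NX n x"
  using assms by (auto simp: coeff_norm_eq coeff_space_eq intro!: cInf_greatest)

lemma coeff_norm_approx:
  assumes "x \<in> X n" "e > 0"
  obtains f where "f \<in> \<F>" "coeffs n f = x" "N f < NX n x + e"
proof -
  have "\<exists>f\<in>\<F>. coeffs n f = x \<and> N f < NX n x + e"
  proof (rule ccontr)
    assume "\<not> ?thesis"
    then have "NX n x + e \<le> NX n x"
      using assms(1) by (intro coeff_norm_greatest) (auto simp: not_less)
    then show False using assms(2) by simp
  qed
  then show ?thesis using that by blast
qed

lemma coeffs_kernel: "f \<in> \<F> \<Longrightarrow> coeffs n f = 0 \<longleftrightarrow> f \<in> (mult ^^ n) ` \<F>"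
  using power_image_if_coeff_eq_0[of f n] coeff_power_mult_eq_0
  by (auto simp: coeffs_def fun_eq_iff)

text \<open>
  The operator is \<open>p (\<phi>)\<close> for a truncation of the power series \<open>p\<close> with
  \<open>p (\<phi> w) = (w - z) ^ m\<close>, so that it shifts the Taylor coefficients up to the index \<open>n\<close>;
  \<open>(w - z) ^ m\<close> itself need not multiply \<^term>\<open>\<F>\<close> into itself.
\<close>

lemma coefficient_shift:
  assumes m: "m \<ge> 1"
  obtains L K where "\<And>f. f \<in> \<F> \<Longrightarrow> L f \<in> mult ` \<F>" "K > 0" "\<And>f. f \<in> \<F> \<Longrightarrow> N (L f) \<le> K * N f"
    "\<And>f j. f \<in> \<F> \<Longrightarrow> j \<le> n \<Longrightarrow> coeff (L f) j = (if j < m then 0 else coeff f (j - m))"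
proof -
  define a where "a i = fps_nth (fps_inv b ^ m) i" for i
  define L where "L f = (\<Sum>i\<le>n. a i *\<^sub>C (mult ^^ i) f)" for f
  have comp: "(\<Sum>i\<le>n. a i * fps_nth (b ^ i) j) = (if j = m then 1 else 0)" if j: "j \<le> n" for j
  proof -
    have "(\<Sum>i\<le>n. a i * fps_nth (b ^ i) j) = (\<Sum>i=0..j. a i * fps_nth (b ^ i) j)"
      using j startsby_zero_power_prefix[OF b_0] by (intro sum.mono_neutral_right) auto
    also have "\<dots> = fps_nth (fps_inv b ^ m oo b) j"
      by (simp add: a_def fps_compose_nth)
    also have "fps_inv b ^ m oo b = fps_X ^ m"
      using fps_compose_power[OF b_0, of "fps_inv b" m] fps_inv[OF b_0 b_1] by simp
    finally show ?thesis
      by (simp add: fps_X_power_nth)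
  qed
  show ?thesis
  proof
    have "fps_nth (fps_inv b) 0 = 0"
      by (simp add: fps_inv_def)
    then have a0: "a 0 = 0"
      using m by (simp add: a_def fps_power_zeroth)
    show "L f \<in> mult ` \<F>" if f: "f \<in> \<F>" for f
    proof
      define g where "g = (\<Sum>i<n. a (Suc i) *\<^sub>C (mult ^^ i) f)"
      show "g \<in> \<F>"
        unfolding g_def using f by (intro VI(6) VI(2) power_mem)
      have "(\<Sum>i\<le>n. a i * \<phi> w ^ i) = \<phi> w * (\<Sum>i<n. a (Suc i) * \<phi> w ^ i)" for w
        using a0 by (simp add: sum.atMost_shift sum_distrib_left mult_ac)
      then show "L f = mult g"
        by (simp add: L_def g_def poly_mult_eq mult_def scaleC_scaleC)
    qed
    define K where "K = 1 + (\<Sum>i\<le>n. cmod (a i))"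
    show "K > 0"
      unfolding K_def by (intro add_pos_nonneg sum_nonneg) auto
    show "N (L f) \<le> K * N f" if f: "f \<in> \<F>" for f
    proof -
      have "N (L f) \<le> (\<Sum>i\<le>n. N (a i *\<^sub>C (mult ^^ i) f))"
        unfolding L_def using f by (intro N_sum VI(2) power_mem)
      also have "\<dots> = (\<Sum>i\<le>n. cmod (a i)) * N f"
        using f by (simp add: N_scale power_mem power_norm sum_distrib_right)
      also have "\<dots> \<le> K * N f"
        using N_nonneg[OF f] by (intro mult_right_mono) (simp_all add: K_def)
      finally show ?thesis .
    qed
    show "coeff (L f) j = (if j < m then 0 else coeff f (j - m))" if f: "f \<in> \<F>" and j: "j \<le> n" for f j
    proof -
      have "coeff (L f) j = (\<Sum>i\<le>j. (if i = m then 1 else 0) *\<^sub>C coeff f (j - i))"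
        unfolding L_def coeff_poly_mult[OF f] using j comp by (intro sum.cong) auto
      also have "\<dots> = (\<Sum>i\<le>j. if i = m then coeff f (j - i) else 0)"
        by (intro sum.cong) (auto simp: scaleC_one)
      also have "\<dots> = (if j < m then 0 else coeff f (j - m))"
        by auto
      finally show ?thesis .
    qed
  qed
qed

lemma left_inclusion_coeffs:
  assumes kn: "k < n"
  obtains L K where "\<And>f. f \<in> \<F> \<Longrightarrow> L f \<in> mult ` \<F>" "K > 0" "\<And>f. f \<in> \<F> \<Longrightarrow> N (L f) \<le> K * N f"
    "\<And>f. f \<in> \<F> \<Longrightarrow> left_inclusion k n (coeffs k f) = coeffs n (L f)"
proof -
  obtain L K where L: "\<And>f. f \<in> \<F> \<Longrightarrow> L f \<in> mult ` \<F>" "K > 0" "\<And>f. f \<in> \<F> \<Longrightarrow> N (L f) \<le> K * N f"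
    "\<And>f j. f \<in> \<F> \<Longrightarrow> j \<le> n \<Longrightarrow> coeff (L f) j = (if j < n - k then 0 else coeff f (j - (n - k)))"
    by (rule coefficient_shift[of "n - k" n]) (use kn in simp, blast)
  have "left_inclusion k n (coeffs k f) = coeffs n (L f)" if f: "f \<in> \<F>" for f
    using kn L(4)[OF f] by (auto simp: left_inclusion_def coeffs_def fun_eq_iff)
  with L show ?thesis
    by (intro that[of L K])
qed

lemma bounded_left_inclusion:
  assumes kn: "k < n"
  shows "bounded_operator_on (X k) (NX k) (X n) (NX n) (left_inclusion k n)"
proof -
  obtain L K where L: "\<And>f. f \<in> \<F> \<Longrightarrow> L f \<in> mult ` \<F>" "K > 0" "\<And>f. f \<in> \<F> \<Longrightarrow> N (L f) \<le> K * N f"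
    "\<And>f. f \<in> \<F> \<Longrightarrow> left_inclusion k n (coeffs k f) = coeffs n (L f)"
    by (rule left_inclusion_coeffs[OF kn]) blast
  have LF: "L f \<in> \<F>" if "f \<in> \<F>" for f
    using L(1)[OF that] M_mem by auto
  have mem: "left_inclusion k n x \<in> X n" if "x \<in> X k" for x
    using that L(4) LF by (auto simp: coeff_space_eq)
  have "NX n (left_inclusion k n x) \<le> K * NX k x" if x: "x \<in> X k" for x
  proof -
    have "NX n (left_inclusion k n x) / K \<le> NX k x"
    proof (rule coeff_norm_greatest[OF x])
      fix f assume f: "f \<in> \<F>" "coeffs k f = x"
      have "NX n (left_inclusion k n x) \<le> N (L f)"
        using coeff_norm_le[OF LF[OF f(1)], of n] L(4)[OF f(1)] f(2) by simp
      also have "\<dots> \<le> K * N f"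
        using L(3)[OF f(1)] .
      finally show "NX n (left_inclusion k n x) / K \<le> N f"
        using L(2) by (simp add: field_simps)
    qed
    then show ?thesis
      using L(2) by (simp add: field_simps)
  qed
  then show ?thesis
    using mem by (auto simp: bounded_operator_on_def left_inclusion_def fun_eq_iff scaleC_fun_def)
qed

text \<open>
  Closed subspaces of \<open>X 2\<close> correspond to closed subspaces of \<^term>\<open>\<F>\<close> containing the range
  of \<open>mult ^^ 2\<close>, which is the kernel of \<open>coeffs 2\<close>; the range of the inclusion contains the
  coefficients of all multiples of \<^term>\<open>\<phi>\<close>.
\<close>

lemma cosingular_mod_power_2:
  assumes sc: "strictly_cosingular (X 1) (NX 1) (X 2) (NX 2) (left_inclusion 1 2)"
  shows "cosingular_mod_power 2"
  unfolding cosingular_mod_power_def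
proof (intro allI impI, elim conjE)
  fix C assume C: "closed_subspace C" "(mult ^^ 2) ` \<F> \<subseteq> C"
    and dec: "\<forall>f\<in>\<F>. \<exists>c\<in>C. \<exists>g\<in>\<F>. f = c + mult g"
  note CS = closed_subspaceD(1)[OF C(1)]
  have CF: "C \<subseteq> \<F>"
    using C closed_subspaceD(2) by auto
  have saturated: "f \<in> C" if "f \<in> \<F>" "c \<in> C" "coeffs 2 f = coeffs 2 c" for f c
  proof -
    have cF: "c \<in> \<F>"
      using that(2) CF by blast
    have "coeffs 2 (f - c) = 0"
      using coeffs_diff[OF that(1) cF] that(3) by simp
    then have "f - c \<in> (mult ^^ 2) ` \<F>"
      using coeffs_kernel[OF VI(4)[OF that(1) cF]] by simp
    then have "f - c \<in> C"
      using C(2) by blast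
    then have "(f - c) + c \<in> C"
      using that(2) by (rule complex_vector.subspace_add[OF CS])
    then show ?thesis by simp
  qed
  define C2 where "C2 = coeffs 2 ` C"
  have C2S: "complex_vector.subspace C2"
    unfolding complex_vector.subspace_def
  proof (intro conjI ballI allI)
    show "0 \<in> C2"
      using coeffs_zero complex_vector.subspace_0[OF CS] unfolding C2_def by (metis image_eqI)
    show "x + y \<in> C2" if xy: "x \<in> C2" "y \<in> C2" for x y
    proof -
      obtain c d where cd: "c \<in> C" "d \<in> C" "x = coeffs 2 c" "y = coeffs 2 d"
        using xy by (auto simp: C2_def)
      then have "x + y = coeffs 2 (c + d)"
        by (simp add: coeffs_add subsetD[OF CF])
      then show ?thesis
        unfolding C2_def using complex_vector.subspace_add[OF CS cd(1,2)] by (rule image_eqI)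
    qed
    show "t *\<^sub>C x \<in> C2" if x: "x \<in> C2" for t x
    proof -
      obtain c where c: "c \<in> C" "x = coeffs 2 c"
        using x by (auto simp: C2_def)
      then have "t *\<^sub>C x = coeffs 2 (t *\<^sub>C c)"
        by (simp add: coeffs_scale subsetD[OF CF])
      then show ?thesis
        unfolding C2_def using complex_vector.subspace_scale[OF CS c(1)] by (rule image_eqI)
    qed
  qed
  have "closed_subspace_of C2 (X 2) (NX 2)"
    unfolding closed_subspace_of_def
  proof (intro conjI allI impI)
    show "complex_vector.subspace C2" by (rule C2S)
    show "C2 \<subseteq> X 2"
      using CF by (auto simp: C2_def coeff_space_eq)
  next
    fix Y l assume "(\<forall>n. Y n \<in> C2) \<and> l \<in> X 2 \<and> (\<lambda>n. NX 2 (Y n - l)) \<longlonglongrightarrow> 0"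
    then have Y: "\<And>n. Y n \<in> C2" and l: "l \<in> X 2" and lim: "(\<lambda>n. NX 2 (Y n - l)) \<longlonglongrightarrow> 0"
      by auto
    obtain c where c: "\<And>n. c n \<in> C" "\<And>n. Y n = coeffs 2 (c n)"
      using Y unfolding C2_def image_iff by metis
    obtain g where g: "g \<in> \<F>" "l = coeffs 2 g"
      using l by (auto simp: coeff_space_eq)
    have cF: "c n \<in> \<F>" for n
      using c(1) CF by blast
    have diff: "Y n - l = coeffs 2 (c n - g)" for n
      using c(2) g coeffs_diff[OF cF g(1)] by simp
    have "\<exists>f\<in>\<F>. coeffs 2 f = Y n - l \<and> N f < NX 2 (Y n - l) + 1 / Suc n" for n
      using coeff_norm_approx[of "Y n - l" 2 "1 / Suc n"] diff cF g(1) VI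
      by (metis coeff_space_eq image_eqI of_nat_0_less_iff zero_less_Suc zero_less_divide_1_iff)
    then obtain f where f: "\<And>n. f n \<in> \<F>" "\<And>n. coeffs 2 (f n) = Y n - l"
      "\<And>n. N (f n) < NX 2 (Y n - l) + 1 / Suc n"
      by metis
    have "g \<in> C"
    proof (rule closed_subspaceD(3)[OF C(1) _ g(1)])
      show "f n + g \<in> C" for n
        using f g c by (intro saturated[OF _ c(1)[of n]] VI(1)) (simp_all add: coeffs_add)
      have "(\<lambda>n. NX 2 (Y n - l) + 1 / Suc n) \<longlonglongrightarrow> 0 + 0"
        by (intro tendsto_add lim LIMSEQ_Suc[OF lim_1_over_n])
      then have "(\<lambda>n. NX 2 (Y n - l) + 1 / Suc n) \<longlonglongrightarrow> 0"
        by simp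
      from tendsto_sandwich[OF _ _ tendsto_const this, of "\<lambda>n. N (f n)"]
      show "(\<lambda>n. N (f n + g - g)) \<longlonglongrightarrow> 0"
        using f(1,3) N_nonneg by (simp add: less_imp_le)
    qed
    then show "l \<in> C2"
      using g(2) by (simp add: C2_def)
  qed
  moreover have "(quotient_map (X 2) C2 \<circ> left_inclusion 1 2) ` X 1 = quotient_space (X 2) C2"
  proof (subst quotient_map_surj_iff[OF C2S])
    show "left_inclusion 1 2 x \<in> X 2" if "x \<in> X 1" for x
      using bounded_left_inclusion[of 1 2] that by (auto simp: bounded_operator_on_def)
    show "\<forall>y\<in>X 2. \<exists>x\<in>X 1. y - left_inclusion 1 2 x \<in> C2"
    proof
      fix y assume "y \<in> X 2"
      then obtain f where f: "f \<in> \<F>" "y = coeffs 2 f"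
        by (auto simp: coeff_space_eq)
      obtain c g where cg: "c \<in> C" "g \<in> \<F>" "f = c + mult g"
        using dec f(1) by blast
      define x where "x = coeffs 1 (fps_nth b 1 *\<^sub>C g)"
      have "x \<in> X 1"
        unfolding x_def coeff_space_eq using cg(2) VI by blast
      moreover have "left_inclusion 1 2 x = coeffs 2 (mult g)"
      proof
        fix i
        have "coeff (mult g) 0 = 0"
          using coeff_power_mult_eq_0[OF cg(2), of 0 1] by simp
        moreover have "coeff (mult g) 1 = fps_nth b 1 *\<^sub>C coeff g 0"
          using coeff_power_mult[OF cg(2), of 1 1] b_0 by simp
        moreover have "coeff (fps_nth b 1 *\<^sub>C g) 0 = fps_nth b 1 *\<^sub>C coeff g 0"
          by (rule taylor_coeff_scale[OF analytic[OF cg(2)] z])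
        ultimately show "left_inclusion 1 2 x i = coeffs 2 (mult g) i"
          by (cases "i = 0"; cases "i = 1") (auto simp: left_inclusion_def coeffs_def x_def)
      qed
      then have "y - left_inclusion 1 2 x = coeffs 2 c"
        using coeffs_add[of c "mult g" 2] cg CF f M_mem by auto
      then have "y - left_inclusion 1 2 x \<in> C2"
        using cg(1) by (simp add: C2_def)
      ultimately show "\<exists>x\<in>X 1. y - left_inclusion 1 2 x \<in> C2"
        by blast
    qed
  qed
  ultimately have "\<not> infinite_codimension C2 (X 2)"
    using sc unfolding strictly_cosingular_def by blast
  then obtain T where T: "finite T" "T \<subseteq> coeffs 2 ` \<F>" "X 2 \<subseteq> complex_vector.span (T \<union> C2)"
    unfolding infinite_codimension_def coeff_space_eq by blast
  obtain S where S: "S \<subseteq> \<F>" "finite S" "T = coeffs 2 ` S"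
    using finite_subset_image[OF T(1,2)] by blast
  let ?E = "complex_vector.span (S \<union> C)"
  have EF: "?E \<subseteq> \<F>"
    using S CF by (intro complex_vector.span_minimal subspace) auto
  have lift: "y \<in> coeffs 2 ` ?E" if "y \<in> complex_vector.span (T \<union> C2)" for y
    using that
  proof (induction rule: complex_vector.span_induct)
    case base
    have "complex_vector.subspace (coeffs 2 ` ?E)"
      unfolding complex_vector.subspace_def
    proof (intro conjI ballI allI)
      show "0 \<in> coeffs 2 ` ?E"
        using coeffs_zero complex_vector.span_zero by (metis image_eqI)
      show "x + y \<in> coeffs 2 ` ?E" if xy: "x \<in> coeffs 2 ` ?E" "y \<in> coeffs 2 ` ?E" for x y
      proof -
        obtain f g where fg: "f \<in> ?E" "g \<in> ?E" "x = coeffs 2 f" "y = coeffs 2 g"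
          using xy by blast
        then have "x + y = coeffs 2 (f + g)"
          by (simp add: coeffs_add subsetD[OF EF])
        then show ?thesis
          using complex_vector.span_add[OF fg(1,2)] by (rule image_eqI)
      qed
      show "t *\<^sub>C x \<in> coeffs 2 ` ?E" if x: "x \<in> coeffs 2 ` ?E" for t x
      proof -
        obtain f where f: "f \<in> ?E" "x = coeffs 2 f"
          using x by blast
        then have "t *\<^sub>C x = coeffs 2 (t *\<^sub>C f)"
          by (simp add: coeffs_scale subsetD[OF EF])
        then show ?thesis
          using complex_vector.span_scale[OF f(1)] by (rule image_eqI)
      qed
    qed
    then show ?case by simp
  next
    case (step y)
    then show ?case
      using S(3) by (auto simp: C2_def intro: complex_vector.span_base)
  qed
  have "\<F> \<subseteq> ?E"
  proof
    fix f assume f: "f \<in> \<F>"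
    then have "coeffs 2 f \<in> X 2"
      by (simp add: coeff_space_eq)
    then obtain g where g: "g \<in> ?E" "coeffs 2 f = coeffs 2 g"
      using lift T(3) by blast
    have gF: "g \<in> \<F>"
      using g EF by blast
    have "coeffs 2 (f - g) = coeffs 2 0"
      using coeffs_diff[OF f gF] g(2) coeffs_zero by simp
    then have "f - g \<in> C"
      by (rule saturated[OF VI(4)[OF f gF] complex_vector.subspace_0[OF CS]])
    then have "f - g \<in> ?E"
      by (intro complex_vector.span_base) simp
    then have "(f - g) + g \<in> ?E"
      using g(1) by (rule complex_vector.span_add)
    then show "f \<in> ?E" by simp
  qed
  then have "\<exists>S. finite S \<and> S \<subseteq> \<F> \<and> \<F> \<subseteq> complex_vector.span (S \<union> C)"
    using S by (intro exI[of _ S] conjI)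
  then show "\<not> infinite_codimension C \<F>"
    by (simp add: infinite_codimension_def)
qed

text \<open>
  The converse passage, from \<^term>\<open>\<F>\<close> to the coefficient spaces: the range of the inclusion
  consists of coefficient tuples of multiples of \<^term>\<open>\<phi>\<close>.
\<close>

lemma strictly_cosingular_left_inclusion:
  assumes cos: "cosingular_mod_power n" and kn: "k < n"
  shows "strictly_cosingular (X k) (NX k) (X n) (NX n) (left_inclusion k n)"
  unfolding strictly_cosingular_def
proof (intro conjI allI impI notI)
  show "bounded_operator_on (X k) (NX k) (X n) (NX n) (left_inclusion k n)"
    by (rule bounded_left_inclusion[OF kn])
next
  fix C assume "closed_subspace_of C (X n) (NX n) \<and> infinite_codimension C (X n)"
    and surj: "(quotient_map (X n) C \<circ> left_inclusion k n) ` X k = quotient_space (X n) C"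
  then have C: "closed_subspace_of C (X n) (NX n)" "infinite_codimension C (X n)"
    by auto
  have CS: "complex_vector.subspace C"
    using C(1) by (auto simp: closed_subspace_of_def)
  obtain L K where L: "\<And>f. f \<in> \<F> \<Longrightarrow> L f \<in> mult ` \<F>"
    "\<And>f. f \<in> \<F> \<Longrightarrow> left_inclusion k n (coeffs k f) = coeffs n (L f)"
    by (rule left_inclusion_coeffs[OF kn]) blast
  have mem: "left_inclusion k n x \<in> X n" if "x \<in> X k" for x
    using bounded_left_inclusion[OF kn] that by (auto simp: bounded_operator_on_def)
  define D where "D = {f \<in> \<F>. coeffs n f \<in> C}"
  have "closed_subspace D"
    unfolding closed_subspace_of_def
  proof (intro conjI allI impI)
    show "complex_vector.subspace D"
      using VI complex_vector.subspace_add[OF CS] complex_vector.subspace_scale[OF CS]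
        complex_vector.subspace_0[OF CS]
      by (auto simp: complex_vector.subspace_def D_def coeffs_add coeffs_scale coeffs_zero)
  next
    fix Y l assume "(\<forall>n. Y n \<in> D) \<and> l \<in> \<F> \<and> (\<lambda>n. N (Y n - l)) \<longlonglongrightarrow> 0"
    then have Y: "\<And>i. Y i \<in> \<F>" "\<And>i. coeffs n (Y i) \<in> C" and l: "l \<in> \<F>"
      and lim: "(\<lambda>n. N (Y n - l)) \<longlonglongrightarrow> 0"
      by (auto simp: D_def)
    have diff: "coeffs n (Y i) - coeffs n l = coeffs n (Y i - l)" for i
      using coeffs_diff[OF Y(1) l] by simp
    have "0 \<le> NX n (coeffs n (Y i - l))" for i
      using Y(1) l VI N_nonneg by (intro coeff_norm_greatest) (auto simp: coeff_space_eq)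
    moreover have "NX n (coeffs n (Y i - l)) \<le> N (Y i - l)" for i
      using Y(1) l by (intro coeff_norm_le VI(4))
    ultimately have "(\<lambda>i. NX n (coeffs n (Y i) - coeffs n l)) \<longlonglongrightarrow> 0"
      unfolding diff by (intro tendsto_sandwich[OF _ _ tendsto_const lim]) auto
    moreover have "coeffs n l \<in> X n"
      using l by (simp add: coeff_space_eq)
    ultimately have "coeffs n l \<in> C"
      by (intro closed_subspace_of_limit[OF C(1) Y(2)])
    then show "l \<in> D"
      using l by (simp add: D_def)
  qed (auto simp: D_def)
  moreover have "(mult ^^ n) ` \<F> \<subseteq> D"
  proof
    fix f assume f: "f \<in> (mult ^^ n) ` \<F>"
    then have "f \<in> \<F>"
      using power_mem by auto
    moreover from this have "coeffs n f = 0"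
      using coeffs_kernel f by blast
    ultimately show "f \<in> D"
      using complex_vector.subspace_0[OF CS] by (simp add: D_def)
  qed
  moreover have "\<exists>c\<in>D. \<exists>g\<in>\<F>. f = c + mult g" if f: "f \<in> \<F>" for f
  proof -
    have "\<forall>y\<in>X n. \<exists>x\<in>X k. y - left_inclusion k n x \<in> C"
      by (rule quotient_map_surj_iff[THEN iffD1, OF CS mem surj])
    then have "\<exists>x\<in>X k. coeffs n f - left_inclusion k n x \<in> C"
      using f by (simp add: coeff_space_eq)
    then obtain h where h: "h \<in> \<F>" "coeffs n f - coeffs n (L h) \<in> C"
      using L(2) by (auto simp: coeff_space_eq)
    obtain g where g: "g \<in> \<F>" "L h = mult g"
      using L(1)[OF h(1)] by blast
    have "f - mult g \<in> D"
      using h(2) g f M_mem VI by (simp add: D_def coeffs_diff)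
    then show ?thesis
      using g(1) by (intro bexI[of _ "f - mult g"] bexI[of _ g]) auto
  qed
  ultimately have "\<not> infinite_codimension D \<F>"
    using cos by (simp add: cosingular_mod_power_def)
  then obtain S where S: "finite S" "S \<subseteq> \<F>" "\<F> \<subseteq> complex_vector.span (S \<union> D)"
    by (auto simp: infinite_codimension_def)
  let ?E = "complex_vector.span (coeffs n ` S \<union> C)"
  have E: "f \<in> \<F> \<and> coeffs n f \<in> ?E" if "f \<in> complex_vector.span (S \<union> D)" for f
    using that
  proof (induction rule: complex_vector.span_induct)
    case base
    show ?case
      using VI by (auto simp: complex_vector.subspace_def coeffs_add coeffs_scale coeffs_zero
          intro: complex_vector.span_zero complex_vector.span_add complex_vector.span_scale)
  next
    case (step f)
    then show ?case
      using S(2) by (auto simp: D_def intro: complex_vector.span_base)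
  qed
  have "X n \<subseteq> ?E"
    using E S(3) by (auto simp: coeff_space_eq)
  moreover have "finite (coeffs n ` S)" "coeffs n ` S \<subseteq> X n"
    using S by (auto simp: coeff_space_eq)
  ultimately have "\<exists>S. finite S \<and> S \<subseteq> X n \<and> X n \<subseteq> complex_vector.span (S \<union> C)"
    by (intro exI[of _ "coeffs n ` S"] conjI)
  then show False
    using C(2) by (simp add: infinite_codimension_def)
qed

end

theorem corollary3:
  fixes U :: "complex set"
    and \<F> :: "(complex \<Rightarrow> 'w::complex_banach) set"
    and N :: "(complex \<Rightarrow> 'w) \<Rightarrow> real"
    and z :: complex
    and k n :: nat
  assumes "open U"
    and "\<exists>\<phi>. conformal_equivalence \<phi> U (ball 0 1)"
    and "admissible U \<F> N"
    and "z \<in> U"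
    and "strictly_cosingular (coeff_space \<F> z 1) (coeff_norm \<F> N z 1)
           (coeff_space \<F> z 2) (coeff_norm \<F> N z 2) (left_inclusion 1 2)"
    and "1 \<le> k" and "k < n"
  shows "strictly_cosingular (coeff_space \<F> z k) (coeff_norm \<F> N z k)
           (coeff_space \<F> z n) (coeff_norm \<F> N z n) (left_inclusion k n)"
proof -
  obtain \<phi> where \<phi>: "conformal_equivalence \<phi> U (ball 0 1)" "\<phi> z = 0"
    using assms(2,4) conformal_equivalence_normalise by metis
  interpret admissible_at U \<F> N z \<phi>
    by (rule admissible_at.intro) (fact assms \<phi>)+
  have "n \<ge> 2"
    using assms(6,7) by simp
  then have "cosingular_mod_power n"
    by (rule cosingular_mod_power_induct[OF cosingular_mod_power_2[OF assms(5)]])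
  then show ?thesis
    using assms(7) by (rule strictly_cosingular_left_inclusion)
qed

end
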